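(* Let $\sigma$ be a complete intersection cone of dimension $n>1$. Then the number of extreme rays of $\sigma$ is at most $2n-2$, and it equals $2n-2$ if and only if $\sigma$ is a general bipyramidal cone.
   Context: For finite $A\subset\mathbb{Z}^N$ with $\mathbb{N}A\cap(-\mathbb{N}A)=\{\mathbf0\}$, the toric ideal $I_A$ is the kernel of $K[x_1,\dots,x_m]\to K[t_1^{\pm1},\dots,t_N^{\pm1}]$, $x_i\mapsto\mathbf{t}^{\mathbf{a}_i}$; it is a complete intersection if its minimal number of generators equals its height. A cone $\sigma$ is a complete intersection cone if $\sigma=\mathrm{pos}_{\mathbb{Q}}(A)$ (nonnegative rational combinations) for such an $A$ with $I_A$ a complete intersection. The dimension of a cone is the dimension of its rational linear span. Extreme rays are the one-dimensional faces, where a face of $\sigma$ is $\sigma\cap\{\mathbf{x}:\mathbf{c}\cdot\mathbf{x}=0\}$ with $\mathbf{c}\cdot\mathbf{x}\ge0$ on $\sigma$. For strongly convex rational polyhedral cones $\sigma_1,\sigma_2$ with some $\mathbf{a}\in\sigma_1\cap\sigma_2$ such that $\mathrm{span}_{\mathbb{Q}}(\sigma_1)\cap\mathrm{span}_{\mathbb{Q}}(\sigma_2)=\mathbb{Q}\mathbf{a}$, the direct sum $\sigma_1\oplus\sigma_2=\mathrm{pos}_{\mathbb{Q}}(\sigma_1\cup\sigma_2)$ is of internal type if $\mathbf{a}$ lies on no extreme ray of $\sigma_1$ nor of $\sigma_2$. A 2-simplex cone is $\mathrm{pos}_{\mathbb{Q}}(\mathbf{r}_1,\mathbf{r}_2)$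 with $\mathbf{r}_1,\mathbf{r}_2$ linearly independent. General bipyramidal cones are the elements of the smallest class of cones containing all 2-simplex cones and closed under direct sums of internal type. *)

theory Defs
  imports "HOL-Analysis.Analysis" "HOL-Library.Poly_Mapping" "HOL-Library.Extended_Nat"
begin

text \<open>Monomials in the variables x_a (a a lattice point) are finitely supported
  exponent maps; polynomials are finitely supported coefficient maps on monomials.
  The ring K[x_a : a in A] is the subring of polynomials only involving variables in A.\<close>

type_synonym ('k, 'n) lpoly = "((int ^ 'n) \<Rightarrow>\<^sub>0 nat) \<Rightarrow>\<^sub>0 'k"

definition poly_ring :: "'k itself \<Rightarrow> (int ^ 'n) set \<Rightarrow> ('k::field, 'n) lpoly set" where
  "poly_ring K A = {p. \<forall>e \<in> Poly_Mapping.keys p. Poly_Mapping.keys e \<subseteq> A}"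

text \<open>Exponent of the Laurent monomial t^(sum e_a a) that the monomial x^e maps to.\<close>
definition lat_deg :: "((int ^ 'n) \<Rightarrow>\<^sub>0 nat) \<Rightarrow> int ^ 'n" where
  "lat_deg e = (\<Sum>a\<in>Poly_Mapping.keys e. of_int (int (Poly_Mapping.lookup e a)) *s a)"

text \<open>The homomorphism x_a |-> t^a into the Laurent polynomial ring K[t^(+-1)] = K[Z^N],
  the latter represented as finitely supported maps Z^N -> K; we record the coefficient
  of t^u of the image of p.\<close>
definition toric_image_coeff :: "('k::field, 'n) lpoly \<Rightarrow> int ^ 'n \<Rightarrow> 'k" where
  "toric_image_coeff p u = (\<Sum>e\<in>{e\<in>Poly_Mapping.keys p. lat_deg e = u}. Poly_Mapping.lookup p e)"

definition toric_ideal :: "'k itself \<Rightarrow> (int ^ 'n) set \<Rightarrow> ('k::field, 'n) lpoly set" where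
  "toric_ideal K A = {p \<in> poly_ring K A. \<forall>u. toric_image_coeff p u = 0}"

definition ideal_in :: "'a::comm_ring_1 set \<Rightarrow> 'a set \<Rightarrow> bool" where
  "ideal_in R I \<longleftrightarrow> I \<subseteq> R \<and> 0 \<in> I \<and> (\<forall>x\<in>I. \<forall>y\<in>I. x + y \<in> I)
     \<and> (\<forall>r\<in>R. \<forall>x\<in>I. r * x \<in> I)"

definition generated_ideal_in :: "'a::comm_ring_1 set \<Rightarrow> 'a set \<Rightarrow> 'a set" where
  "generated_ideal_in R G = {(\<Sum>g\<in>G. h g * g) | h. \<forall>g\<in>G. h g \<in> R}"

definition min_num_gens :: "'a::comm_ring_1 set \<Rightarrow> 'a set \<Rightarrow> nat" where
  "min_num_gens R I = (LEAST n. \<exists>G. finite G \<and> card G = n \<and> G \<subseteq> R \<and> generated_ideal_in R G = I)"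

definition prime_ideal_in :: "'a::comm_ring_1 set \<Rightarrow> 'a set \<Rightarrow> bool" where
  "prime_ideal_in R P \<longleftrightarrow> ideal_in R P \<and> P \<noteq> R \<and>
     (\<forall>x\<in>R. \<forall>y\<in>R. x * y \<in> P \<longrightarrow> x \<in> P \<or> y \<in> P)"

definition prime_height :: "'a::comm_ring_1 set \<Rightarrow> 'a set \<Rightarrow> enat" where
  "prime_height R P = (SUP n\<in>{n. \<exists>c. (\<forall>i\<le>n. prime_ideal_in R (c i)) \<and>
        (\<forall>i<n. c i \<subset> c (Suc i)) \<and> c n = P}. enat n)"

definition ideal_height :: "'a::comm_ring_1 set \<Rightarrow> 'a set \<Rightarrow> enat" where
  "ideal_height R I = (INF P\<in>{P. prime_ideal_in R P \<and> I \<subseteq> P}. prime_height R P)"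

definition complete_intersection_ideal :: "'a::comm_ring_1 set \<Rightarrow> 'a set \<Rightarrow> bool" where
  "complete_intersection_ideal R I \<longleftrightarrow> enat (min_num_gens R I) = ideal_height R I"

definition rat_of_lat :: "int ^ 'n \<Rightarrow> rat ^ 'n" where
  "rat_of_lat a = (\<chi> i. of_int (a $ i))"

definition pos_cone :: "(rat ^ 'n) set \<Rightarrow> (rat ^ 'n) set" where
  "pos_cone S = {(\<Sum>v\<in>F. c v *s v) | F c. finite F \<and> F \<subseteq> S \<and> (\<forall>v\<in>F. c v \<ge> 0)}"

definition nat_monoid :: "(int ^ 'n) set \<Rightarrow> (int ^ 'n) set" where
  "nat_monoid A = {(\<Sum>a\<in>A. of_int (int (c a)) *s a) | c. True}"

definition ci_cone :: "'k::field itself \<Rightarrow> (rat ^ 'n) set \<Rightarrow> bool" where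
  "ci_cone K \<sigma> \<longleftrightarrow> (\<exists>A. finite A \<and> nat_monoid A \<inter> uminus ` nat_monoid A = {0}
       \<and> \<sigma> = pos_cone (rat_of_lat ` A)
       \<and> complete_intersection_ideal (poly_ring K A) (toric_ideal K A))"

definition qdot :: "rat ^ 'n \<Rightarrow> rat ^ 'n \<Rightarrow> rat" where
  "qdot c x = (\<Sum>i\<in>UNIV. c $ i * x $ i)"

definition cone_dim :: "(rat ^ 'n) set \<Rightarrow> nat" where
  "cone_dim \<sigma> = vec.dim \<sigma>"

definition faces :: "(rat ^ 'n) set \<Rightarrow> (rat ^ 'n) set set" where
  "faces \<sigma> = {\<sigma> \<inter> {x. qdot c x = 0} | c. \<forall>x\<in>\<sigma>. qdot c x \<ge> 0}"

definition extreme_rays :: "(rat ^ 'n) set \<Rightarrow> (rat ^ 'n) set set" where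
  "extreme_rays \<sigma> = {\<tau> \<in> faces \<sigma>. cone_dim \<tau> = 1}"

definition rational_polyhedral_cone :: "(rat ^ 'n) set \<Rightarrow> bool" where
  "rational_polyhedral_cone \<sigma> \<longleftrightarrow> (\<exists>S. finite S \<and> \<sigma> = pos_cone S)"

definition strongly_convex :: "(rat ^ 'n) set \<Rightarrow> bool" where
  "strongly_convex \<sigma> \<longleftrightarrow> \<sigma> \<inter> uminus ` \<sigma> = {0}"

definition internal_direct_sum :: "(rat ^ 'n) set \<Rightarrow> (rat ^ 'n) set \<Rightarrow> (rat ^ 'n) set \<Rightarrow> bool" where
  "internal_direct_sum \<sigma>1 \<sigma>2 \<sigma> \<longleftrightarrow>
     rational_polyhedral_cone \<sigma>1 \<and> strongly_convex \<sigma>1 \<and>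
     rational_polyhedral_cone \<sigma>2 \<and> strongly_convex \<sigma>2 \<and>
     (\<exists>a\<in>\<sigma>1 \<inter> \<sigma>2. vec.span \<sigma>1 \<inter> vec.span \<sigma>2 = {t *s a | t. True}
        \<and> (\<forall>\<rho>\<in>extreme_rays \<sigma>1. a \<notin> \<rho>) \<and> (\<forall>\<rho>\<in>extreme_rays \<sigma>2. a \<notin> \<rho>)) \<and>
     \<sigma> = pos_cone (\<sigma>1 \<union> \<sigma>2)"

inductive_set general_bipyramidal :: "(rat ^ 'n) set set" where
  simplex2: "vec.independent {r1, r2} \<Longrightarrow> r1 \<noteq> r2 \<Longrightarrow> pos_cone {r1, r2} \<in> general_bipyramidal"
| dsum: "\<sigma>1 \<in> general_bipyramidal \<Longrightarrow> \<sigma>2 \<in> general_bipyramidal \<Longrightarrow>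
         internal_direct_sum \<sigma>1 \<sigma>2 \<sigma> \<Longrightarrow> \<sigma> \<in> general_bipyramidal"

end

theory Submission
  imports Defs "HOL-Library.Function_Algebras"
begin

text \<open>
  Let \<open>A\<close> be a configuration of \<open>m\<close> nonzero points of rank \<open>d\<close> whose toric ideal \<open>I\<close> is a complete intersection.
  Comparing the number of generators with the dimension of \<open>I / (\<mm> \<cdot> I)\<close> shows that \<open>I\<close> is generated by
  \<open>m - d\<close> binomials. They are dominating: fewer than \<open>card C\<close> of them have variables from a nonempty set \<open>C\<close> in
  both monomials, since otherwise \<open>C\<close> could be enlarged to the complement of a face of full dimension.
  View a binomial as a complete bipartite graph of its own colour between the supports of its two monomials.
  Domination says that no cycle has pairwise distinct colours, and this forces a partition \<open>A = A\<^sub>1 \<union> A\<^sub>2\<close>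
  such that at most one binomial crosses it, with its two monomials on different sides. The cone is then the sum
  of two cones whose spans meet at most in a line, and the bound on extreme rays and its equality case follow by
  induction on \<open>m\<close>.
\<close>

section \<open>Rainbow walks\<close>

definition colour_edge :: "('i \<Rightarrow> 'a set) \<Rightarrow> ('i \<Rightarrow> 'a set) \<Rightarrow> 'i \<Rightarrow> 'a \<Rightarrow> 'a \<Rightarrow> bool" where
  "colour_edge P N i x y \<longleftrightarrow> x \<in> P i \<and> y \<in> N i \<or> x \<in> N i \<and> y \<in> P i"

fun colour_walk :: "('i \<Rightarrow> 'a set) \<Rightarrow> ('i \<Rightarrow> 'a set) \<Rightarrow> 'a \<Rightarrow> 'i list \<Rightarrow> 'a \<Rightarrow> bool" where
  "colour_walk P N x [] z \<longleftrightarrow> x = z"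
| "colour_walk P N x (i # cs) z \<longleftrightarrow> (\<exists>y. colour_edge P N i x y \<and> colour_walk P N y cs z)"

definition rainbow_walk ::
    "'i set \<Rightarrow> ('i \<Rightarrow> 'a set) \<Rightarrow> ('i \<Rightarrow> 'a set) \<Rightarrow> 'a \<Rightarrow> 'i list \<Rightarrow> 'a \<Rightarrow> bool" where
  "rainbow_walk I P N x cs y \<longleftrightarrow> colour_walk P N x cs y \<and> distinct cs \<and> set cs \<subseteq> I"

lemma colour_edge_commute: "colour_edge P N i x y \<longleftrightarrow> colour_edge P N i y x"
  by (auto simp: colour_edge_def)

lemma colour_walk_append:
  "colour_walk P N x (cs @ ds) z \<longleftrightarrow> (\<exists>y. colour_walk P N x cs y \<and> colour_walk P N y ds z)"
  by (induction cs arbitrary: x) auto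

lemma colour_walk_rev: "colour_walk P N x cs y \<Longrightarrow> colour_walk P N y (rev cs) x"
  by (induction cs arbitrary: x) (auto simp: colour_walk_append colour_edge_commute)

lemma colour_walk_mono:
  assumes "colour_walk P' N' x cs y" "\<And>i. i \<in> set cs \<Longrightarrow> P' i \<subseteq> P i \<and> N' i \<subseteq> N i"
  shows "colour_walk P N x cs y"
  using assms
proof (induction cs arbitrary: x)
  case (Cons i cs)
  then obtain w where "colour_edge P' N' i x w" "colour_walk P' N' w cs y" by auto
  moreover from this have "colour_edge P N i x w"
    using Cons.prems(2)[of i] by (auto simp: colour_edge_def)
  ultimately show ?case using Cons by auto
qed simp

lemma colour_walk_vertices:
  assumes "colour_walk P N x cs y"
  shows "\<exists>C. finite C \<and> C \<subseteq> (\<Union>i\<in>set cs. P i \<union> N i) \<and> card C \<le> length cs \<and> (cs \<noteq> [] \<longrightarrow> x \<in> C) \<and>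
    (\<forall>i\<in>set cs. P i \<inter> insert y C \<noteq> {} \<and> N i \<inter> insert y C \<noteq> {})"
  using assms
proof (induction cs arbitrary: x)
  case (Cons i cs)
  then obtain w where edge: "colour_edge P N i x w" and walk: "colour_walk P N w cs y" by auto
  obtain C where C: "finite C" "C \<subseteq> (\<Union>i\<in>set cs. P i \<union> N i)" "card C \<le> length cs"
    "cs \<noteq> [] \<longrightarrow> w \<in> C" "\<forall>i\<in>set cs. P i \<inter> insert y C \<noteq> {} \<and> N i \<inter> insert y C \<noteq> {}"
    using Cons.IH[OF walk] by blast
  have "w \<in> insert y C" using C(4) walk by (cases cs) auto
  then have "P i \<inter> insert y (insert x C) \<noteq> {} \<and> N i \<inter> insert y (insert x C) \<noteq> {}"
    using edge by (auto simp: colour_edge_def)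
  moreover have "x \<in> P i \<union> N i" using edge by (auto simp: colour_edge_def)
  moreover have "card (insert x C) \<le> length (i # cs)" using C(1,3) by (simp add: card_insert_if)
  ultimately show ?case using C by (intro exI[of _ "insert x C"]) auto
qed (auto intro: exI[of _ "{}"])

lemma rainbow_walk_mono: "rainbow_walk I P N x cs y \<Longrightarrow> I \<subseteq> J \<Longrightarrow> rainbow_walk J P N x cs y"
  by (auto simp: rainbow_walk_def)

lemma rainbow_walk_Diff:
  "rainbow_walk (I - J) P N x cs y \<longleftrightarrow> rainbow_walk I P N x cs y \<and> set cs \<inter> J = {}"
  by (auto simp: rainbow_walk_def)

lemma rainbow_walk_split:
  assumes "rainbow_walk I P N x cs y" "c \<in> set cs"
  obtains bs u v ds where "cs = bs @ c # ds" "rainbow_walk (I - {c}) P N x bs u"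
    "colour_edge P N c u v" "rainbow_walk (I - {c}) P N v ds y"
proof -
  obtain bs ds where cs: "cs = bs @ c # ds" using assms(2) by (meson split_list)
  obtain u v where "colour_walk P N x bs u" "colour_edge P N c u v" "colour_walk P N v ds y"
    using assms(1) by (auto simp: rainbow_walk_def cs colour_walk_append)
  then show thesis using assms(1) cs by (intro that) (auto simp: rainbow_walk_def)
qed

text \<open>Leave the first walk at its first colour that occurs in the second walk: an edge of this colour leads
  to one of the two ends of the edge in the second walk.\<close>

lemma rainbow_walk_join:
  assumes first: "rainbow_walk I P N u bs v" and second: "rainbow_walk I P N x cs y"
    and common: "set bs \<inter> set cs \<noteq> {}"
  obtains (onward) ds where "rainbow_walk I P N u ds y"
    | (backward) ds where "rainbow_walk I P N u ds x"
proof -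
  obtain bs' c bs'' where bs: "bs = bs' @ c # bs''" "c \<in> set cs" "\<forall>d\<in>set bs'. d \<notin> set cs"
    using split_list_first_prop[of bs "\<lambda>c. c \<in> set cs"] common by auto
  obtain w w' where to_c: "colour_walk P N u bs' w" "colour_edge P N c w w'"
    using first by (auto simp: rainbow_walk_def bs(1) colour_walk_append)
  obtain cs' s t cs'' where cs: "cs = cs' @ c # cs''" "rainbow_walk (I - {c}) P N x cs' s"
    "colour_edge P N c s t" "rainbow_walk (I - {c}) P N t cs'' y"
    by (rule rainbow_walk_split[OF second bs(2)])
  have colours: "distinct bs" "distinct cs" "set bs \<subseteq> I" "set cs \<subseteq> I"
    using first second by (auto simp: rainbow_walk_def)
  have "colour_edge P N c w t \<or> colour_edge P N c w s"
    using to_c(2) cs(3) by (auto simp: colour_edge_def)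
  then show thesis
  proof
    assume "colour_edge P N c w t"
    then have "rainbow_walk I P N u (bs' @ c # cs'') y"
      using to_c(1) cs(4) colours bs cs(1) by (auto simp: rainbow_walk_def colour_walk_append)
    then show thesis by (rule onward)
  next
    assume "colour_edge P N c w s"
    then have "rainbow_walk I P N u (bs' @ c # rev cs') x"
      using to_c(1) cs(2) colours bs cs(1) colour_walk_rev[of P N x cs' s]
      by (auto simp: rainbow_walk_def colour_walk_append)
    then show thesis by (rule backward)
  qed
qed

lemma rainbow_walk_extend:
  assumes walk: "rainbow_walk I (\<lambda>i. {p i}) (\<lambda>i. {n i}) z cs x"
    and edge: "i \<in> I" "colour_edge (\<lambda>i. {p i}) (\<lambda>i. {n i}) i x y"
  obtains ds where "rainbow_walk I (\<lambda>i. {p i}) (\<lambda>i. {n i}) z ds y"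
proof (cases "i \<in> set cs")
  case False
  then have "rainbow_walk I (\<lambda>i. {p i}) (\<lambda>i. {n i}) z (cs @ [i]) y"
    using walk edge by (auto simp: rainbow_walk_def colour_walk_append)
  then show thesis by (rule that)
next
  case True
  obtain bs u v ds where split: "cs = bs @ i # ds" "rainbow_walk (I - {i}) (\<lambda>i. {p i}) (\<lambda>i. {n i}) z bs u"
    "colour_edge (\<lambda>i. {p i}) (\<lambda>i. {n i}) i u v"
    by (rule rainbow_walk_split[OF walk True])
  then have "rainbow_walk I (\<lambda>i. {p i}) (\<lambda>i. {n i}) z (bs @ [i]) v"
    using edge(1) by (auto simp: rainbow_walk_def colour_walk_append)
  moreover have "rainbow_walk I (\<lambda>i. {p i}) (\<lambda>i. {n i}) z bs u"
    using split(2) by (simp add: rainbow_walk_Diff)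
  moreover have "y = u \<or> y = v" using split(3) edge(2) by (auto simp: colour_edge_def)
  ultimately show thesis using that by blast
qed

section \<open>Dominating systems\<close>

definition straddling :: "'i set \<Rightarrow> ('i \<Rightarrow> 'a set) \<Rightarrow> ('i \<Rightarrow> 'a set) \<Rightarrow> 'a set \<Rightarrow> 'i set" where
  "straddling I P N C = {i \<in> I. P i \<inter> C \<noteq> {} \<and> N i \<inter> C \<noteq> {}}"

lemma finite_straddling: "finite I \<Longrightarrow> finite (straddling I P N C)"
  by (simp add: straddling_def)

definition mergeable :: "'a set \<Rightarrow> 'i set \<Rightarrow> ('i \<Rightarrow> 'a set) \<Rightarrow> ('i \<Rightarrow> 'a set) \<Rightarrow> 'a \<Rightarrow> 'a \<Rightarrow> bool" where
  "mergeable A I P N z b \<longleftrightarrow> z \<in> A \<and> b \<in> A \<and> z \<noteq> b \<and>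
    (\<forall>C\<subseteq>A. z \<in> C \<longrightarrow> b \<in> C \<longrightarrow> card (straddling I P N C) + 1 < card C)"

locale dominating =
  fixes A :: "'a set" and I :: "'i set" and P N :: "'i \<Rightarrow> 'a set"
  assumes finite_A: "finite A" and finite_I: "finite I"
    and P_subset: "i \<in> I \<Longrightarrow> P i \<subseteq> A" and N_subset: "i \<in> I \<Longrightarrow> N i \<subseteq> A"
    and P_nonempty: "i \<in> I \<Longrightarrow> P i \<noteq> {}" and N_nonempty: "i \<in> I \<Longrightarrow> N i \<noteq> {}"
    and card_straddling_less:
      "C \<subseteq> A \<Longrightarrow> C \<noteq> {} \<Longrightarrow> card (straddling I P N C) < card C"
begin

lemma straddling_carrier: "straddling I P N A = I"
proof -
  have "P i \<inter> A \<noteq> {} \<and> N i \<inter> A \<noteq> {}" if "i \<in> I" for i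
    using that P_subset N_subset P_nonempty N_nonempty by (simp add: Int_absorb2)
  then show ?thesis by (auto simp: straddling_def)
qed

lemma card_I_less: "A \<noteq> {} \<Longrightarrow> card I < card A"
  using card_straddling_less[of A] straddling_carrier by simp

lemma sides_disjoint:
  assumes "i \<in> I" shows "P i \<inter> N i = {}"
proof -
  have "x \<notin> N i" if "x \<in> P i" for x
  proof
    assume "x \<in> N i"
    then have "i \<in> straddling I P N {x}" using that assms by (simp add: straddling_def)
    then have "card (straddling I P N {x}) \<noteq> 0" by (auto simp: finite_straddling finite_I)
    moreover have "card (straddling I P N {x}) < card {x}"
      using P_subset[OF assms] that by (intro card_straddling_less) auto
    ultimately show False by simp
  qed
  then show ?thesis by blast
qed

lemma closed_rainbow_walk_Nil:
  assumes "rainbow_walk I P N x cs x" shows "cs = []"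
proof (rule ccontr)
  assume "cs \<noteq> []"
  have walk: "colour_walk P N x cs x" "distinct cs" "set cs \<subseteq> I"
    using assms by (auto simp: rainbow_walk_def)
  obtain C where C: "finite C" "C \<subseteq> (\<Union>i\<in>set cs. P i \<union> N i)" "card C \<le> length cs" "x \<in> C"
    "\<forall>i\<in>set cs. P i \<inter> C \<noteq> {} \<and> N i \<inter> C \<noteq> {}"
    using colour_walk_vertices[OF walk(1)] \<open>cs \<noteq> []\<close> by (auto simp: insert_absorb)
  have "set cs \<subseteq> straddling I P N C" using C(5) walk(3) by (auto simp: straddling_def)
  then have "length cs \<le> card (straddling I P N C)"
    using card_mono[OF finite_straddling[OF finite_I]] distinct_card[OF walk(2)] by metis
  moreover have "C \<subseteq> A" using C(2) walk(3) P_subset N_subset by blast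
  ultimately show False using card_straddling_less[of C] C(3,4) by auto
qed

lemma tight_straddling_separates:
  assumes C: "C \<subseteq> A" "card C \<le> card (straddling I P N C) + 1" and X: "X \<subseteq> C" "X \<noteq> {}" "X \<noteq> C"
  obtains i where "i \<in> straddling I P N C" "i \<notin> straddling I P N X" "i \<notin> straddling I P N (C - X)"
proof (rule ccontr)
  assume "\<not> thesis"
  then have "straddling I P N C \<subseteq> straddling I P N X \<union> straddling I P N (C - X)" using that by blast
  then have "card (straddling I P N C) \<le> card (straddling I P N X \<union> straddling I P N (C - X))"
    by (intro card_mono finite_UnI finite_straddling finite_I)
  also have "\<dots> \<le> card (straddling I P N X) + card (straddling I P N (C - X))" by (rule card_Un_le)
  finally have "card (straddling I P N C) \<le> \<dots>" .
  moreover have "card (straddling I P N X) < card X" "card (straddling I P N (C - X)) < card (C - X)"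
    using C(1) X by (auto intro!: card_straddling_less)
  moreover have "card X + card (C - X) = card C"
    using card_Diff_subset[of X C] card_mono[of C X] X(1) finite_subset[OF C(1) finite_A]
    by (simp add: finite_subset)
  ultimately show False using C(2) by linarith
qed

lemma tight_rainbow_walk:
  assumes C: "C \<subseteq> A" "z \<in> C" "b \<in> C" and tight: "card C \<le> card (straddling I P N C) + 1"
  obtains cs where "rainbow_walk I P N z cs b"
proof -
  let ?S = "straddling I P N C"
  have "\<forall>i\<in>?S. \<exists>x. x \<in> P i \<inter> C" "\<forall>i\<in>?S. \<exists>x. x \<in> N i \<inter> C" by (auto simp: straddling_def)
  then obtain p n where p: "\<And>i. i \<in> ?S \<Longrightarrow> p i \<in> P i \<inter> C" and n: "\<And>i. i \<in> ?S \<Longrightarrow> n i \<in> N i \<inter> C" by metis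
  let ?walk = "rainbow_walk ?S (\<lambda>i. {p i}) (\<lambda>i. {n i})"
  define X where "X = {y \<in> C. \<exists>cs. ?walk z cs y}"
  have "?walk z [] z" by (simp add: rainbow_walk_def)
  then have "z \<in> X" using C(2) X_def by blast
  have closed: "y \<in> X"
    if "x \<in> X" and i: "i \<in> ?S" and edge: "colour_edge (\<lambda>i. {p i}) (\<lambda>i. {n i}) i x y" for x y i
  proof -
    obtain cs where "?walk z cs x" using \<open>x \<in> X\<close> X_def by blast
    then obtain ds where "?walk z ds y" using i edge by (rule rainbow_walk_extend)
    moreover have "y \<in> C" using p[OF i] n[OF i] edge by (auto simp: colour_edge_def)
    ultimately show ?thesis using X_def by blast
  qed
  have "X = C"
  proof (rule ccontr)
    assume "X \<noteq> C"
    then obtain i where i: "i \<in> ?S" "i \<notin> straddling I P N X" "i \<notin> straddling I P N (C - X)"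
      using tight_straddling_separates[OF C(1) tight, of X] \<open>z \<in> X\<close> X_def by blast
    have "p i \<in> X \<longleftrightarrow> n i \<in> X"
      using closed[OF _ i(1), of "p i" "n i"] closed[OF _ i(1), of "n i" "p i"]
      by (auto simp: colour_edge_def)
    then show False using i p[OF i(1)] n[OF i(1)] by (auto simp: straddling_def)
  qed
  then obtain cs where "?walk z cs b" using C(3) X_def by blast
  then have cs: "colour_walk (\<lambda>i. {p i}) (\<lambda>i. {n i}) z cs b" "distinct cs" "set cs \<subseteq> ?S"
    by (auto simp: rainbow_walk_def)
  have "colour_walk P N z cs b"
    by (rule colour_walk_mono[OF cs(1)]) (use p n cs(3) in blast)
  moreover have "set cs \<subseteq> I" using cs(3) by (auto simp: straddling_def)
  ultimately show thesis using cs(2) by (intro that) (simp add: rainbow_walk_def)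
qed

lemma unreachable_mergeable:
  assumes "z \<in> A" "b \<in> A" "z \<noteq> b" "\<And>cs. \<not> rainbow_walk I P N z cs b"
  shows "mergeable A I P N z b"
  unfolding mergeable_def
proof (intro conjI allI impI assms(1-3))
  fix C assume "C \<subseteq> A" "z \<in> C" "b \<in> C"
  then show "card (straddling I P N C) + 1 < card C"
    using tight_rainbow_walk[of C z b] assms(4) by (meson not_le)
qed

definition incident :: "'a \<Rightarrow> 'i set" where
  "incident z = {i \<in> I. z \<in> P i \<union> N i}"

definition near :: "'a \<Rightarrow> 'i \<Rightarrow> 'a set" where
  "near z i = (if z \<in> P i then P i else N i)"

definition far :: "'a \<Rightarrow> 'i \<Rightarrow> 'a set" where
  "far z i = (if z \<in> P i then N i else P i)"

text \<open>If every vertex is reached from \<open>z\<close> by a rainbow walk and no side is \<open>{z}\<close>, then \<open>precedes z\<close> is a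
  strict order without maximal element on the finite set of colours at \<open>z\<close>, which is absurd.\<close>

definition precedes :: "'a \<Rightarrow> 'i \<Rightarrow> 'i \<Rightarrow> bool" where
  "precedes z j l \<longleftrightarrow> (\<exists>n\<in>far z l. \<exists>p\<in>near z j. \<exists>cs. rainbow_walk (I - {j, l}) P N n cs p)"

lemma precedesI:
  "n \<in> far z l \<Longrightarrow> p \<in> near z j \<Longrightarrow> rainbow_walk (I - {j, l}) P N n cs p \<Longrightarrow> precedes z j l"
  by (auto simp: precedes_def)

lemma colour_edge_near_far:
  "colour_edge P N i x y \<longleftrightarrow> x \<in> near z i \<and> y \<in> far z i \<or> x \<in> far z i \<and> y \<in> near z i"
  by (auto simp: colour_edge_def near_def far_def)

lemma near_far_disjoint: "i \<in> I \<Longrightarrow> near z i \<inter> far z i = {}"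
  using sides_disjoint[of i] by (auto simp: near_def far_def)

lemma incidentD: "i \<in> incident z \<Longrightarrow> i \<in> I \<and> z \<in> near z i"
  by (auto simp: incident_def near_def)

lemma rainbow_walk_enters_near:
  assumes j: "j \<in> incident z" and walk: "rainbow_walk (I - {j}) P N z cs x"
    and edge: "colour_edge P N j x y"
  shows "x \<in> near z j \<and> y \<in> far z j"
proof -
  have "x \<notin> far z j"
  proof
    assume "x \<in> far z j"
    then have "colour_edge P N j x z" using incidentD[OF j] by (auto simp: colour_edge_near_far[of _ _ _ z])
    then have "rainbow_walk I P N z (cs @ [j]) z"
      using walk incidentD[OF j] by (auto simp: rainbow_walk_def colour_walk_append)
    then show False using closed_rainbow_walk_Nil by blast
  qed
  then show ?thesis using edge by (auto simp: colour_edge_near_far[of _ _ _ z])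
qed

lemma precedes_irrefl:
  assumes "j \<in> I" shows "\<not> precedes z j j"
proof
  assume "precedes z j j"
  then obtain n p cs where "n \<in> far z j" "p \<in> near z j" "rainbow_walk (I - {j}) P N n cs p"
    by (auto simp: precedes_def)
  then have "rainbow_walk I P N n (cs @ [j]) n"
    using assms by (auto simp: rainbow_walk_def colour_walk_append colour_edge_near_far[of _ _ _ z])
  then show False using closed_rainbow_walk_Nil by blast
qed

lemma precedes_if_colour_of_walk_from_far:
  assumes j: "j \<in> incident z" and h: "h \<in> incident z"
    and walk: "n \<in> far z h" "rainbow_walk (I - {h}) P N n cs p" "j \<in> set cs"
  shows "precedes z j h"
proof -
  obtain bs x y where split: "rainbow_walk (I - {h} - {j}) P N n bs x" "colour_edge P N j x y"
    by (rule rainbow_walk_split[OF walk(2,3)]) (rule that)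
  have "j \<noteq> h" using walk(2,3) by (auto simp: rainbow_walk_def)
  then have "rainbow_walk (I - {j}) P N z (h # bs) x"
    using split(1) incidentD[OF h] walk(1)
    by (auto simp: rainbow_walk_def colour_edge_near_far[of _ _ _ z])
  then have "x \<in> near z j" using rainbow_walk_enters_near[OF j] split(2) by blast
  moreover have "rainbow_walk (I - {j, h}) P N n bs x"
    using split(1) by (rule rainbow_walk_mono) auto
  ultimately show ?thesis using walk(1) by (intro precedesI)
qed

lemma precedes_if_colour_of_walk_to_near:
  assumes h: "h \<in> incident z" and l: "l \<in> incident z"
    and walk: "n \<in> far z l" "p \<in> near z j" "rainbow_walk (I - {j, l}) P N n cs p" "h \<in> set cs"
  shows "precedes z j h"
proof -
  obtain bs x y ds where split: "rainbow_walk (I - {j, l} - {h}) P N n bs x" "colour_edge P N h x y"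
    "rainbow_walk (I - {j, l} - {h}) P N y ds p"
    by (rule rainbow_walk_split[OF walk(3,4)]) (rule that)
  have "l \<noteq> h" using walk(3,4) by (auto simp: rainbow_walk_def)
  then have "rainbow_walk (I - {h}) P N z (l # bs) x"
    using split(1) incidentD[OF l] walk(1)
    by (auto simp: rainbow_walk_def colour_edge_near_far[of _ _ _ z])
  then have "y \<in> far z h" using rainbow_walk_enters_near[OF h] split(2) by blast
  moreover have "rainbow_walk (I - {j, h}) P N y ds p"
    using split(3) by (rule rainbow_walk_mono) auto
  ultimately show ?thesis using walk(2) by (intro precedesI)
qed

lemma precedes_if_walks_share_colour:
  assumes incident: "l \<in> incident z" "h \<in> incident z" and "l \<noteq> h"
    and to_j: "nl \<in> far z l" "pj \<in> near z j" "rainbow_walk (I - {j, l, h}) P N nl cs pj"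
    and to_l: "nh \<in> far z h" "rainbow_walk (I - {j, l, h}) P N nh bs pl"
    and common: "set bs \<inter> set cs \<noteq> {}"
  shows "precedes z j h"
proof (rule rainbow_walk_join[OF to_l(2) to_j(3) common])
  fix ds assume "rainbow_walk (I - {j, l, h}) P N nh ds pj"
  then have "rainbow_walk (I - {j, h}) P N nh ds pj" by (rule rainbow_walk_mono) auto
  then show ?thesis by (rule precedesI[OF to_l(1) to_j(2)])
next
  fix ds assume "rainbow_walk (I - {j, l, h}) P N nh ds nl"
  then have "rainbow_walk I P N z (h # ds @ [l]) z"
    using \<open>l \<noteq> h\<close> to_j(1) to_l(1) incidentD[OF incident(1)] incidentD[OF incident(2)]
    by (auto simp: rainbow_walk_def colour_walk_append colour_edge_near_far[of _ _ _ z])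
  then show ?thesis using closed_rainbow_walk_Nil by blast
qed

lemma precedes_trans:
  assumes j: "j \<in> incident z" and l: "l \<in> incident z" and h: "h \<in> incident z"
    and jl: "precedes z j l" and lh: "precedes z l h"
  shows "precedes z j h"
proof -
  obtain nl pj cs where to_j: "nl \<in> far z l" "pj \<in> near z j" "rainbow_walk (I - {j, l}) P N nl cs pj"
    using jl by (auto simp: precedes_def)
  obtain nh pl bs where to_l: "nh \<in> far z h" "pl \<in> near z l" "rainbow_walk (I - {l, h}) P N nh bs pl"
    using lh by (auto simp: precedes_def)
  have distinct: "j \<noteq> l" "l \<noteq> h" using precedes_irrefl incidentD j l jl lh by blast+
  consider (j) "j \<in> set bs" | (h) "h \<in> set cs"
    | (disjoint) "j \<notin> set bs" "h \<notin> set cs" "set bs \<inter> set cs = {}"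
    | (common) "j \<notin> set bs" "h \<notin> set cs" "set bs \<inter> set cs \<noteq> {}" by blast
  then show ?thesis
  proof cases
    case j
    have "rainbow_walk (I - {h}) P N nh bs pl" using to_l(3) by (rule rainbow_walk_mono) auto
    then show ?thesis using j by (rule precedes_if_colour_of_walk_from_far[OF assms(1) h to_l(1)])
  next
    case h
    then show ?thesis by (rule precedes_if_colour_of_walk_to_near[OF assms(3) l to_j])
  next
    case disjoint
    have "rainbow_walk (I - {j, h}) P N nh (bs @ l # cs) pj"
      using disjoint distinct to_j to_l incidentD[OF l]
      by (auto simp: rainbow_walk_def colour_walk_append colour_edge_near_far[of _ _ _ z])
    then show ?thesis by (rule precedesI[OF to_l(1) to_j(2)])
  next
    case common
    have "rainbow_walk (I - {j, l, h}) P N nl cs pj" "rainbow_walk (I - {j, l, h}) P N nh bs pl"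
      using to_j(3) to_l(3) common by (auto simp: rainbow_walk_def)
    then show ?thesis
      using precedes_if_walks_share_colour[OF l h distinct(2) to_j(1,2)] to_l(1) common(3) by blast
  qed
qed

lemma rainbow_walk_starts_incident:
  assumes "rainbow_walk J P N z cs b" "J \<subseteq> I" "b \<noteq> z"
  obtains l n ds where "cs = l # ds" "l \<in> incident z" "n \<in> far z l" "rainbow_walk (J - {l}) P N n ds b"
proof (cases cs)
  case (Cons l ds)
  then obtain n where n: "l \<in> J" "colour_edge P N l z n" "rainbow_walk (J - {l}) P N n ds b"
    using assms(1) by (auto simp: rainbow_walk_def)
  then have "l \<in> incident z" using assms(2) by (auto simp: incident_def colour_edge_def)
  moreover have "n \<in> far z l"
    using n(2) incidentD[OF calculation] near_far_disjoint[of l z]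
    by (auto simp: colour_edge_near_far[of _ _ _ z])
  ultimately show thesis using that Cons n(3) by blast
qed (use assms in \<open>simp add: rainbow_walk_def\<close>)

lemma precedes_serial:
  assumes j: "j \<in> incident z" and "near z j \<noteq> {z}"
    and reachable: "\<And>b. b \<in> A \<Longrightarrow> b \<noteq> z \<Longrightarrow> \<exists>cs. rainbow_walk I P N z cs b"
  obtains l where "l \<in> incident z" "precedes z j l"
proof -
  have "j \<in> I" using incidentD[OF j] by blast
  obtain p where p: "p \<in> near z j" "p \<noteq> z" using assms(2) incidentD[OF j] by blast
  then have "p \<in> A" using \<open>j \<in> I\<close> P_subset N_subset by (auto simp: near_def split: if_splits)
  then obtain cs where cs: "rainbow_walk I P N z cs p" using reachable p by blast
  have "j \<notin> set cs"
  proof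
    assume "j \<in> set cs"
    obtain bs x y ds where split: "rainbow_walk (I - {j}) P N z bs x" "colour_edge P N j x y"
      "rainbow_walk (I - {j}) P N y ds p"
      by (rule rainbow_walk_split[OF cs \<open>j \<in> set cs\<close>]) (rule that)
    have "y \<in> far z j" using rainbow_walk_enters_near[OF j split(1,2)] by blast
    then have "precedes z j j" using p(1) split(3) by (intro precedesI) auto
    then show False using precedes_irrefl[OF \<open>j \<in> I\<close>] by blast
  qed
  then have "rainbow_walk (I - {j}) P N z cs p" using cs by (simp add: rainbow_walk_Diff)
  then obtain l n ds where l: "l \<in> incident z" "n \<in> far z l" "rainbow_walk (I - {j} - {l}) P N n ds p"
    by (rule rainbow_walk_starts_incident) (use p(2) in auto)
  moreover have "I - {j} - {l} = I - {j, l}" by blast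
  ultimately show thesis using that p(1) by (metis precedesI)
qed

lemma exists_rainbow_unreachable:
  assumes z: "z \<in> A" and card: "card A \<ge> 2"
    and sides: "\<And>i. i \<in> I \<Longrightarrow> P i \<noteq> {z} \<and> N i \<noteq> {z}"
  obtains b where "b \<in> A" "b \<noteq> z" "\<And>cs. \<not> rainbow_walk I P N z cs b"
proof (rule ccontr)
  assume "\<not> thesis"
  then have reachable: "\<exists>cs. rainbow_walk I P N z cs b" if "b \<in> A" "b \<noteq> z" for b
    using that \<open>\<And>b. b \<in> A \<Longrightarrow> b \<noteq> z \<Longrightarrow> (\<And>cs. \<not> rainbow_walk I P N z cs b) \<Longrightarrow> thesis\<close> by blast
  have "card (A - {z}) \<noteq> 0" using card z finite_A by (simp add: card_Diff_singleton)
  then obtain b where "b \<in> A" "b \<noteq> z" by (metis Diff_iff card.empty equals0I singletonI)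
  then have "incident z \<noteq> {}"
    using reachable rainbow_walk_starts_incident[OF _ order_refl] by (metis empty_iff)
  moreover have "finite (incident z)" using finite_I by (auto simp: incident_def)
  moreover have "asymp_on (incident z) (precedes z)"
    using precedes_irrefl precedes_trans incidentD by (intro asymp_onI) blast
  moreover have "transp_on (incident z) (precedes z)" using precedes_trans by (intro transp_onI) blast
  ultimately obtain j where j: "j \<in> incident z" "\<forall>l\<in>incident z. l \<noteq> j \<longrightarrow> \<not> precedes z j l"
    using Finite_Set.bex_max_element[of "incident z" "precedes z"] by blast
  have "near z j \<noteq> {z}" using sides incidentD[OF j(1)] by (auto simp: near_def)
  then obtain l where "l \<in> incident z" "precedes z j l" using precedes_serial[OF j(1)] reachable by blast
  then show False using j(2) precedes_irrefl incidentD[OF j(1)] by metis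
qed

lemma singleton_sides_mergeable:
  assumes i: "i \<in> I" "P i = {z} \<and> N i = {b} \<or> P i = {b} \<and> N i = {z}" and "z \<noteq> b"
  shows "mergeable A (I - {i}) P N z b"
  unfolding mergeable_def
proof (intro conjI allI impI)
  show "z \<in> A" "b \<in> A" using i P_subset N_subset by blast+
  fix C assume C: "C \<subseteq> A" "z \<in> C" "b \<in> C"
  have "i \<in> straddling I P N C" using i C by (auto simp: straddling_def)
  moreover have "straddling (I - {i}) P N C = straddling I P N C - {i}" by (auto simp: straddling_def)
  ultimately have "card (straddling (I - {i}) P N C) + 1 = card (straddling I P N C)"
    by (metis Suc_eq_plus1 card_Suc_Diff1 finite_straddling finite_I)
  then show "card (straddling (I - {i}) P N C) + 1 < card C" using card_straddling_less[of C] C by auto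
qed (rule \<open>z \<noteq> b\<close>)

lemma exists_mergeable:
  assumes card: "card A \<ge> 2"
  obtains z b J where "J \<subseteq> I" "mergeable A J P N z b" "\<And>i. i \<in> I - J \<Longrightarrow> P i \<union> N i \<subseteq> {z, b}"
proof (cases "\<exists>z\<in>A. \<forall>i\<in>I. P i \<noteq> {z} \<and> N i \<noteq> {z}")
  case True
  then obtain z where "z \<in> A" "\<And>i. i \<in> I \<Longrightarrow> P i \<noteq> {z} \<and> N i \<noteq> {z}" by blast
  moreover from this card obtain b where "b \<in> A" "b \<noteq> z" "\<And>cs. \<not> rainbow_walk I P N z cs b"
    using exists_rainbow_unreachable by metis
  ultimately have "mergeable A I P N z b" by (intro unreachable_mergeable) auto
  then show thesis using that[of I] by blast
next
  case False
  then have "\<forall>z\<in>A. \<exists>i\<in>I. P i = {z} \<or> N i = {z}" by blast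
  then obtain f where f: "\<And>z. z \<in> A \<Longrightarrow> f z \<in> I \<and> (P (f z) = {z} \<or> N (f z) = {z})" by metis
  have "A \<noteq> {}" using card by auto
  then have "\<not> inj_on f A" using card_I_less card_inj_on_le[of f A I] finite_I f by fastforce
  then obtain z b where zb: "z \<in> A" "b \<in> A" "z \<noteq> b" "f z = f b" by (auto simp: inj_on_def)
  then have i: "f z \<in> I" "P (f z) = {z} \<and> N (f z) = {b} \<or> P (f z) = {b} \<and> N (f z) = {z}"
    using f[of z] f[of b] by auto
  have "P i \<union> N i \<subseteq> {z, b}" if "i \<in> I - (I - {f z})" for i using that i(2) by auto
  then show thesis using that singleton_sides_mergeable[OF i zb(3)] by blast
qed

lemma dominating_merge:
  assumes "mergeable A J P N z b" and J: "J \<subseteq> I"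
  shows "dominating (A - {b}) J (\<lambda>i. id(b := z) ` P i) (\<lambda>i. id(b := z) ` N i)"
    (is "dominating _ _ (\<lambda>i. ?q ` P i) (\<lambda>i. ?q ` N i)")
proof
  have zb: "z \<in> A" "b \<in> A" "z \<noteq> b"
    and slack: "\<And>C. C \<subseteq> A \<Longrightarrow> z \<in> C \<Longrightarrow> b \<in> C \<Longrightarrow> card (straddling J P N C) + 1 < card C"
    using assms(1) by (auto simp: mergeable_def)
  show "finite J" using J finite_I by (rule finite_subset)
  show "?q ` P i \<subseteq> A - {b}" "?q ` N i \<subseteq> A - {b}" if "i \<in> J" for i
    using that J zb P_subset[of i] N_subset[of i] by auto
  fix C assume C: "C \<subseteq> A - {b}" "C \<noteq> {}"
  let ?merged = "straddling J (\<lambda>i. ?q ` P i) (\<lambda>i. ?q ` N i) C"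
  have "C \<subseteq> A" "finite C" using C finite_A finite_subset by blast+
  show "card ?merged < card C"
  proof (cases "z \<in> C")
    case True
    have "?merged \<subseteq> straddling J P N (insert b C)"
      using C by (auto simp: straddling_def split: if_splits)
    then have "card ?merged \<le> card (straddling J P N (insert b C))"
      by (intro card_mono finite_straddling \<open>finite J\<close>)
    moreover have "card (straddling J P N (insert b C)) + 1 < card (insert b C)"
      using slack[of "insert b C"] C True zb by auto
    moreover have "b \<notin> C" using C(1) by blast
    ultimately show ?thesis using \<open>finite C\<close> by simp
  next
    case False
    have "?merged \<subseteq> straddling I P N C"
      using C J False by (auto simp: straddling_def split: if_splits)
    then have "card ?merged \<le> card (straddling I P N C)"
      by (intro card_mono finite_straddling finite_I)
    then show ?thesis using card_straddling_less[OF \<open>C \<subseteq> A\<close> C(2)] by linarith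
  qed
qed (use finite_A P_nonempty N_nonempty J in auto)

end

definition enclosed :: "'i set \<Rightarrow> ('i \<Rightarrow> 'a set) \<Rightarrow> ('i \<Rightarrow> 'a set) \<Rightarrow> 'a set \<Rightarrow> 'i set" where
  "enclosed I P N B = {i \<in> I. P i \<union> N i \<subseteq> B}"

definition crossing ::
    "'i set \<Rightarrow> ('i \<Rightarrow> 'a set) \<Rightarrow> ('i \<Rightarrow> 'a set) \<Rightarrow> 'a set \<Rightarrow> 'a set \<Rightarrow> 'i set" where
  "crossing I P N A1 A2 = I - enclosed I P N A1 - enclosed I P N A2"

definition splitting ::
    "'a set \<Rightarrow> 'i set \<Rightarrow> ('i \<Rightarrow> 'a set) \<Rightarrow> ('i \<Rightarrow> 'a set) \<Rightarrow> 'a set \<Rightarrow> 'a set \<Rightarrow> bool" where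
  "splitting A I P N A1 A2 \<longleftrightarrow>
    A1 \<noteq> {} \<and> A2 \<noteq> {} \<and> A1 \<inter> A2 = {} \<and> A1 \<union> A2 = A \<and>
    card (crossing I P N A1 A2) \<le> 1 \<and> (\<forall>i\<in>crossing I P N A1 A2. P i \<subseteq> A1 \<and> N i \<subseteq> A2)"

lemma splitting_unmerge:
  assumes q: "q = id(b := z)" and zb: "z \<in> A" "b \<in> A" "z \<noteq> b"
    and J: "J \<subseteq> I" "\<And>i. i \<in> I - J \<Longrightarrow> P i \<union> N i \<subseteq> {z, b}"
    and sides: "\<And>i. i \<in> I \<Longrightarrow> P i \<subseteq> A \<and> N i \<subseteq> A"
    and split: "splitting (A - {b}) J (\<lambda>i. q ` P i) (\<lambda>i. q ` N i) B1 B2"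
  shows "splitting A I P N {x \<in> A. q x \<in> B1} {x \<in> A. q x \<in> B2}" (is "splitting A I P N ?A1 ?A2")
proof -
  have B: "B1 \<noteq> {}" "B2 \<noteq> {}" "B1 \<inter> B2 = {}" "B1 \<union> B2 = A - {b}" using split by (auto simp: splitting_def)
  have q_cases: "q x \<in> B1 \<union> B2" if "x \<in> A" for x unfolding B(4) using that zb by (simp add: q)
  have image: "X \<subseteq> ?A1 \<longleftrightarrow> q ` X \<subseteq> B1" "X \<subseteq> ?A2 \<longleftrightarrow> q ` X \<subseteq> B2" if "X \<subseteq> A" for X
    using that by auto
  have "{z, b} \<subseteq> ?A1 \<or> {z, b} \<subseteq> ?A2" using q_cases[OF zb(1)] zb by (auto simp: q)
  then have "i \<notin> crossing I P N ?A1 ?A2" if "i \<in> I - J" for i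
    using J(2)[OF that] unfolding crossing_def enclosed_def by blast
  moreover have "i \<in> crossing I P N ?A1 ?A2 \<longleftrightarrow> i \<in> crossing J (\<lambda>i. q ` P i) (\<lambda>i. q ` N i) B1 B2"
    if "i \<in> J" for i
    using that J(1) image[of "P i \<union> N i"] sides[of i] unfolding crossing_def enclosed_def image_Un by blast
  moreover have "crossing I P N ?A1 ?A2 \<subseteq> I" "crossing J (\<lambda>i. q ` P i) (\<lambda>i. q ` N i) B1 B2 \<subseteq> J"
    unfolding crossing_def by blast+
  ultimately have crossing: "crossing I P N ?A1 ?A2 = crossing J (\<lambda>i. q ` P i) (\<lambda>i. q ` N i) B1 B2"
    by blast
  have "P i \<subseteq> ?A1 \<and> N i \<subseteq> ?A2" if i: "i \<in> crossing I P N ?A1 ?A2" for i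
  proof -
    have "i \<in> I" using i by (simp add: crossing_def)
    moreover have "q ` P i \<subseteq> B1" "q ` N i \<subseteq> B2"
      using split i unfolding crossing by (auto simp: splitting_def)
    ultimately show ?thesis using image(1)[of "P i"] image(2)[of "N i"] sides[of i] by simp
  qed
  moreover have "card (crossing I P N ?A1 ?A2) \<le> 1"
    using split unfolding crossing by (simp add: splitting_def)
  moreover have "B1 \<subseteq> ?A1" "B2 \<subseteq> ?A2" using B(4) by (auto simp: q)
  then have "?A1 \<noteq> {}" "?A2 \<noteq> {}" using B(1,2) by auto
  moreover have "?A1 \<union> ?A2 = A" using q_cases by auto
  moreover have "?A1 \<inter> ?A2 = {}" using B(3) by auto
  ultimately show ?thesis unfolding splitting_def by simp
qed

lemma (in dominating) splitting_if_card_2: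
  assumes "card A = 2" shows "\<exists>A1 A2. splitting A I P N A1 A2"
proof (cases "I = {}")
  case True
  obtain a b where "A = {a, b}" "a \<noteq> b" using assms by (meson card_2_iff)
  then have "splitting A I P N {a} {b}" using True by (auto simp: splitting_def crossing_def)
  then show ?thesis by blast
next
  case False
  then have "card I \<noteq> 0" using finite_I by simp
  moreover have "A \<noteq> {}" using assms by auto
  then have "card I < 2" using card_I_less assms by simp
  ultimately have "card I = 1" by linarith
  then obtain i where i: "I = {i}" by (meson card_1_singletonE)
  note side = P_subset[of i] N_subset[of i] P_nonempty[of i] N_nonempty[of i] sides_disjoint[of i]
  have fin: "finite (P i)" "finite (N i)" using side finite_A i by (auto intro: finite_subset)
  then have "card (P i) \<ge> 1" "card (N i) \<ge> 1" using side i by (simp_all add: Suc_le_eq card_gt_0_iff)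
  then have "card A \<le> card (P i \<union> N i)" using fin side assms i by (simp add: card_Un_disjoint)
  then have "P i \<union> N i = A" using side finite_A i by (intro card_seteq) auto
  moreover have "crossing I P N (P i) (N i) \<subseteq> {i}" using i by (auto simp: crossing_def)
  then have "card (crossing I P N (P i) (N i)) \<le> 1" using card_mono[of "{i}"] by fastforce
  ultimately have "splitting A I P N (P i) (N i)" using side i by (auto simp: splitting_def crossing_def)
  then show ?thesis by blast
qed

theorem dominating_splitting:
  assumes "dominating A I P N" "card A \<ge> 2"
  shows "\<exists>A1 A2. splitting A I P N A1 A2"
  using assms
proof (induction "card A" arbitrary: A I P N rule: less_induct)
  case less
  interpret dominating A I P N by fact
  show ?case
  proof (cases "card A = 2")
    case False
    obtain z b J where J: "J \<subseteq> I" and merge: "mergeable A J P N z b"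
      and outside: "\<And>i. i \<in> I - J \<Longrightarrow> P i \<union> N i \<subseteq> {z, b}"
      by (rule exists_mergeable[OF less.prems(2)]) (rule that)
    have zb: "z \<in> A" "b \<in> A" "z \<noteq> b" using merge by (auto simp: mergeable_def)
    define q where "q = id(b := z)"
    have "dominating (A - {b}) J (\<lambda>i. q ` P i) (\<lambda>i. q ` N i)"
      unfolding q_def by (rule dominating_merge[OF merge J])
    moreover have "card (A - {b}) < card A" "card (A - {b}) \<ge> 2"
      using False less.prems(2) zb(2) finite_A by (simp_all add: card_Diff_singleton)
    ultimately obtain B1 B2 where "splitting (A - {b}) J (\<lambda>i. q ` P i) (\<lambda>i. q ` N i) B1 B2"
      using less.hyps[of "A - {b}" J "\<lambda>i. q ` P i" "\<lambda>i. q ` N i"] by blast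
    then have "splitting A I P N {x \<in> A. q x \<in> B1} {x \<in> A. q x \<in> B2}"
      by (rule splitting_unmerge[OF q_def zb J, rotated 2]) (use outside P_subset N_subset in blast)+
    then show ?thesis by blast
  qed (rule splitting_if_card_2)
qed

lemma dominating_restrict:
  assumes "dominating A I P N" "B \<subseteq> A"
  shows "dominating B (enclosed I P N B) P N"
proof -
  interpret dominating A I P N by fact
  show ?thesis
  proof
    fix C assume C: "C \<subseteq> B" "C \<noteq> {}"
    have "card (straddling (enclosed I P N B) P N C) \<le> card (straddling I P N C)"
      by (intro card_mono finite_straddling finite_I) (auto simp: straddling_def enclosed_def)
    also have "\<dots> < card C" using C assms(2) by (intro card_straddling_less) auto
    finally show "card (straddling (enclosed I P N B) P N C) < card C" .
  qed (use finite_subset[OF assms(2) finite_A] finite_I P_nonempty N_nonempty in \<open>auto simp: enclosed_def\<close>)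
qed

lemma dominating_image:
  assumes "dominating A I P N" "inj_on f A"
  shows "dominating (f ` A) I (\<lambda>i. f ` P i) (\<lambda>i. f ` N i)"
proof -
  interpret dominating A I P N by fact
  show ?thesis
  proof
    fix C assume C: "C \<subseteq> f ` A" "C \<noteq> {}"
    then obtain D where D: "D \<subseteq> A" "C = f ` D" by (meson subset_image_iff)
    have meets: "f ` X \<inter> C = {} \<longleftrightarrow> X \<inter> D = {}" if "X \<subseteq> A" for X
      unfolding D(2) using inj_on_image_Int[OF assms(2) that D(1)] by (metis image_is_empty)
    have "straddling I (\<lambda>i. f ` P i) (\<lambda>i. f ` N i) C = straddling I P N D"
      unfolding straddling_def
      by (intro Collect_cong conj_cong refl) (simp_all add: meets[OF P_subset] meets[OF N_subset])
    moreover have "card C = card D" using card_image[OF inj_on_subset[OF assms(2) D(1)]] D(2) by simp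
    moreover have "card (straddling I P N D) < card D" using C D by (intro card_straddling_less) auto
    ultimately show "card (straddling I (\<lambda>i. f ` P i) (\<lambda>i. f ` N i) C) < card C" by simp
  next
    fix i assume "i \<in> I"
    then show "f ` P i \<subseteq> f ` A" "f ` N i \<subseteq> f ` A" using P_subset N_subset by blast+
  qed (use finite_A finite_I P_nonempty N_nonempty in auto)
qed

lemma saturated_violation:
  assumes fin: "finite A" "finite I"
    and sides: "\<And>i. i \<in> I \<Longrightarrow> P i \<subseteq> A \<and> N i \<subseteq> A \<and> P i \<noteq> {} \<and> N i \<noteq> {}"
    and C: "C \<subseteq> A" "card C \<le> card (straddling I P N C)"
  obtains D where "C \<subseteq> D" "D \<subseteq> A" "card D \<le> card (straddling I P N D)"
    "\<And>i. i \<in> I \<Longrightarrow> P i \<inter> D = {} \<longleftrightarrow> N i \<inter> D = {}"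
proof -
  define \<V> where "\<V> = {D. C \<subseteq> D \<and> D \<subseteq> A \<and> card D \<le> card (straddling I P N D)}"
  have "\<V> \<subseteq> Pow A" by (auto simp: \<V>_def)
  then have "finite \<V>" using fin(1) finite_subset by blast
  moreover have "C \<in> \<V>" using C by (auto simp: \<V>_def)
  ultimately obtain D where D: "D \<in> \<V>" "\<And>D'. D' \<in> \<V> \<Longrightarrow> D \<subseteq> D' \<Longrightarrow> D = D'"
    using finite_has_maximal[of \<V>] by blast
  have violating: "C \<subseteq> D" "D \<subseteq> A" "card D \<le> card (straddling I P N D)" using D(1) by (auto simp: \<V>_def)
  have finD: "finite D" using violating(2) fin(1) finite_subset by blast
  have maximal: "i \<notin> straddling I P N (insert x D)"
    if "x \<in> A - D" and "i \<notin> straddling I P N D" for i x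
  proof
    assume "i \<in> straddling I P N (insert x D)"
    then have "insert i (straddling I P N D) \<subseteq> straddling I P N (insert x D)" by (auto simp: straddling_def)
    then have "card (insert i (straddling I P N D)) \<le> card (straddling I P N (insert x D))"
      by (intro card_mono finite_straddling fin(2))
    then have "insert x D \<in> \<V>"
      using that violating finD by (auto simp: \<V>_def finite_straddling[OF fin(2)])
    then show False using D(2)[of "insert x D"] that(1) by blast
  qed
  have "P i \<inter> D = {} \<longleftrightarrow> N i \<inter> D = {}" if i: "i \<in> I" for i
  proof (rule ccontr)
    assume mixed: "(P i \<inter> D = {}) \<noteq> (N i \<inter> D = {})"
    then obtain x where "x \<in> A - D" "x \<in> P i \<and> N i \<inter> D \<noteq> {} \<or> x \<in> N i \<and> P i \<inter> D \<noteq> {}"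
      using sides[OF i] by (cases "P i \<inter> D = {}") blast+
    then show False using maximal[of x i] mixed i by (auto simp: straddling_def)
  qed
  then show thesis using that violating by blast
qed

section \<open>Linear functionals over the rationals\<close>

lemma finitely_supported_functions_dependent:
  fixes V :: "('t \<Rightarrow> 'k::field) set"
  assumes "finite T" "finite V" "card T < card V" and support: "\<And>v t. v \<in> V \<Longrightarrow> t \<notin> T \<Longrightarrow> v t = 0"
  obtains u where "\<exists>v\<in>V. u v \<noteq> 0" "\<And>t. (\<Sum>v\<in>V. u v * v t) = 0"
proof -
  interpret fun_space: vector_space "\<lambda>(k::'k) f (t::'t). k * f t"
    by unfold_locales (auto simp: fun_eq_iff algebra_simps)
  have sum_apply: "(\<Sum>x\<in>X. f x) t = (\<Sum>x\<in>X. f x t)" for X :: "'x set" and f :: "'x \<Rightarrow> 't \<Rightarrow> 'k" and t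
    by (induction X rule: infinite_finite_induct) auto
  define unit :: "'t \<Rightarrow> 't \<Rightarrow> 'k" where "unit t t' = of_bool (t' = t)" for t t'
  have "v \<in> fun_space.span (unit ` T)" if "v \<in> V" for v
  proof -
    have "v = (\<Sum>t\<in>T. (\<lambda>t'. v t * unit t t'))"
    proof
      fix t'
      show "v t' = (\<Sum>t\<in>T. (\<lambda>t'. v t * unit t t')) t'"
        unfolding sum_apply using assms(1) support[OF that, of t'] by (cases "t' \<in> T") (auto simp: unit_def)
    qed
    also have "\<dots> \<in> fun_space.span (unit ` T)"
      by (intro fun_space.span_sum fun_space.span_scale fun_space.span_base imageI)
    finally show ?thesis .
  qed
  then have "V \<subseteq> fun_space.span (unit ` T)" by blast
  moreover have "card (unit ` T) < card V" using card_image_le[OF assms(1), of unit] assms(3) by simp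
  ultimately have "fun_space.dependent V"
    using fun_space.independent_span_bound[of "unit ` T" V] assms(1) by force
  then obtain u where u: "\<exists>v\<in>V. u v \<noteq> 0" "(\<Sum>v\<in>V. (\<lambda>t. u v * v t)) = 0"
    using assms(2) by (auto simp: fun_space.dependent_finite)
  have "(\<Sum>v\<in>V. u v * v t) = 0" for t using fun_cong[OF u(2), of t] by (simp add: sum_apply)
  then show thesis using that u(1) by blast
qed

lemma homogeneous_system_nontrivial:
  fixes a :: "'s \<Rightarrow> 't \<Rightarrow> 'k::field"
  assumes "finite T" "finite S" "card T < card S"
  obtains c where "\<exists>s\<in>S. c s \<noteq> 0" "\<And>t. t \<in> T \<Longrightarrow> (\<Sum>s\<in>S. c s * a s t) = 0"
proof -
  define row where "row s t = (if t \<in> T then a s t else 0)" for s t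
  show thesis
  proof (cases "inj_on row S")
    case False
    then obtain s s' where s: "s \<in> S" "s' \<in> S" "s \<noteq> s'" "row s = row s'" by (auto simp: inj_on_def)
    define c :: "'s \<Rightarrow> 'k" where "c r = of_bool (r = s) - of_bool (r = s')" for r
    have "(\<Sum>r\<in>S. c r * a r t) = row s t - row s' t" if "t \<in> T" for t
      using that s(1,2) assms(2) by (simp add: c_def row_def left_diff_distrib sum_subtractf)
    moreover have "c s \<noteq> 0" using s(3) by (simp add: c_def)
    ultimately show thesis using that[of c] s by auto
  next
    case True
    obtain u where u: "\<exists>v\<in>row ` S. u v \<noteq> 0" "\<And>t. (\<Sum>v\<in>row ` S. u v * v t) = 0"
      by (rule finitely_supported_functions_dependent[of T "row ` S"])
         (use assms card_image[OF True] in \<open>auto simp: row_def\<close>)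
    then have "(\<Sum>s\<in>S. u (row s) * row s t) = 0" for t by (simp add: sum.reindex[OF True])
    then have "(\<Sum>s\<in>S. u (row s) * a s t) = 0" if "t \<in> T" for t
      using that unfolding row_def by (metis (mono_tags, lifting) sum.cong)
    then show thesis using that[of "\<lambda>s. u (row s)"] u(1) by blast
  qed
qed

lemma dim_Un_Int_span:
  fixes S T :: "('a::field ^ 'n) set"
  shows "vec.dim (S \<union> T) + vec.dim (vec.span S \<inter> vec.span T) = vec.dim S + vec.dim T"
proof -
  have "vec.dim (vec.span (S \<union> T)) + vec.dim (vec.span S \<inter> vec.span T) =
      vec.dim (vec.span S) + vec.dim (vec.span T)"
    using vec.dim_sums_Int[of "vec.span S" "vec.span T"] by (simp add: vec.span_Un)
  then show ?thesis by simp
qed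

lemma dim_pos_iff: "vec.dim S > 0 \<longleftrightarrow> (\<exists>x\<in>S. x \<noteq> 0)"
  for S :: "('a::field ^ 'n) set"
  unfolding neq0_conv[symmetric] vec.dim_eq_0 by blast

lemma qdot_simps:
  "qdot c (x + y) = qdot c x + qdot c y" "qdot c (t *s x) = t * qdot c x" "qdot c (- x) = - qdot c x"
  "qdot c (x - y) = qdot c x - qdot c y" "qdot c 0 = 0"
  "qdot (c + d) x = qdot c x + qdot d x" "qdot (t *s c) x = t * qdot c x"
  "qdot (c - d) x = qdot c x - qdot d x"
  by (auto simp: qdot_def sum.distrib sum_distrib_left algebra_simps sum_subtractf sum_negf)

lemma qdot_sum: "qdot c (\<Sum>i\<in>I. f i) = (\<Sum>i\<in>I. qdot c (f i))"
  by (induction I rule: infinite_finite_induct) (auto simp: qdot_simps)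

lemma qdot_self_pos:
  assumes "x \<noteq> 0" shows "qdot x x > 0"
proof -
  obtain i where "x $ i \<noteq> 0" using assms by (auto simp: vec_eq_iff)
  then show ?thesis unfolding qdot_def
    by (intro sum_pos2[of _ i]) (auto simp: zero_less_mult_iff)
qed

lemma qdot_eq_on_span:
  assumes "\<And>b. b \<in> B \<Longrightarrow> qdot c b = qdot d b" "x \<in> vec.span B"
  shows "qdot c x = qdot d x"
  using assms(2) by (induction rule: vec.span_induct_alt) (auto simp: qdot_simps assms(1))

lemma qdot_independent_extend:
  fixes B :: "(rat ^ 'n) set"
  assumes "vec.independent B"
  obtains c where "\<And>b. b \<in> B \<Longrightarrow> qdot c b = g b"
proof -
  obtain f :: "rat ^ 'n \<Rightarrow> rat ^ 'n" where f: "Vector_Spaces.linear (*s) (*s) f"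
    "\<And>b. b \<in> B \<Longrightarrow> f b = (\<chi> i. g b)"
    using vec.linear_independent_extend[OF assms, of "\<lambda>b. \<chi> i. g b"] by blast
  have "qdot (matrix f $ i) x = (matrix f *v x) $ i" for x i
    by (simp add: qdot_def matrix_vector_mult_def)
  then have "qdot (matrix f $ i) b = g b" if "b \<in> B" for b i
    using f that by (simp add: matrix_works)
  then show thesis by (rule that)
qed

lemma qdot_glue:
  fixes U V :: "(rat ^ 'n) set"
  assumes U: "vec.subspace U" and V: "vec.subspace V"
    and agree: "\<And>x. x \<in> U \<inter> V \<Longrightarrow> qdot c x = qdot d x"
  obtains e where "\<And>x. x \<in> U \<Longrightarrow> qdot e x = qdot c x" "\<And>x. x \<in> V \<Longrightarrow> qdot e x = qdot d x"
proof -
  obtain BU where BU: "BU \<subseteq> U" "vec.independent BU" "U \<subseteq> vec.span BU"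
    by (rule vec.maximal_independent_subset)
  obtain B where B: "BU \<subseteq> B" "B \<subseteq> BU \<union> V" "vec.independent B" "BU \<union> V \<subseteq> vec.span B"
    using vec.maximal_independent_subset_extend[of BU "BU \<union> V"] BU(2) by blast
  obtain e where e: "\<And>b. b \<in> B \<Longrightarrow> qdot e b = (if b \<in> BU then qdot c b else qdot d b)"
    by (rule qdot_independent_extend[OF B(3), of "\<lambda>b. if b \<in> BU then qdot c b else qdot d b"]) (rule that)
  have on_U: "qdot e x = qdot c x" if "x \<in> U" for x
    by (rule qdot_eq_on_span[of BU]) (use e B(1) BU(3) that in auto)
  have "qdot e x = qdot d x" if "x \<in> V" for x
  proof -
    have "x \<in> vec.span (BU \<union> (B - BU))" using B(1,4) that by (auto simp: Un_absorb1)
    then obtain u w where x: "x = u + w" "u \<in> vec.span BU" "w \<in> vec.span (B - BU)"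
      unfolding vec.span_Un by blast
    have "u \<in> U" using x(2) vec.span_minimal[OF BU(1) U] by blast
    moreover have "w \<in> V" using x(3) B(2) vec.span_minimal[of "B - BU" V] V by blast
    moreover have "u \<in> V" using vec.subspace_diff[OF V that calculation(2)] x(1) by simp
    moreover have "qdot e w = qdot d w"
      by (rule qdot_eq_on_span[OF _ x(3)]) (use e in auto)
    ultimately show ?thesis using on_U agree by (simp add: x(1) qdot_simps)
  qed
  then show thesis using that on_U by blast
qed

lemma small_perturbation:
  fixes u v :: "'i \<Rightarrow> rat"
  assumes "finite I" "\<And>i. i \<in> I \<Longrightarrow> u i > 0"
  obtains e where "e > 0" "\<And>i. i \<in> I \<Longrightarrow> u i + e * v i > 0"
proof
  let ?bounds = "insert 1 ((\<lambda>i. u i / (\<bar>v i\<bar> + 1)) ` I)"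
  define e where "e = Min ?bounds"
  show "e > 0" using assms by (auto simp: e_def)
  fix i assume i: "i \<in> I"
  have "e \<le> u i / (\<bar>v i\<bar> + 1)" unfolding e_def using assms(1) i by (intro Min_le) auto
  then have "e * \<bar>v i\<bar> + e \<le> u i" by (simp add: pos_le_divide_eq distrib_left)
  moreover have "- (e * \<bar>v i\<bar>) \<le> e * v i"
    using \<open>e > 0\<close> mult_left_mono[of "- \<bar>v i\<bar>" "v i" e] by simp
  ultimately show "u i + e * v i > 0" using \<open>e > 0\<close> by linarith
qed

definition positively_dependent :: "'i set \<Rightarrow> ('i \<Rightarrow> rat ^ 'n) \<Rightarrow> bool" where
  "positively_dependent I f \<longleftrightarrow>
    (\<exists>l. (\<forall>i\<in>I. l i \<ge> 0) \<and> (\<exists>i\<in>I. l i > 0) \<and> (\<Sum>i\<in>I. l i *s f i) = 0)"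

lemma positively_dependent_mono:
  assumes "positively_dependent I f" "I \<subseteq> J" "finite J"
  shows "positively_dependent J f"
proof -
  obtain l where l: "\<forall>i\<in>I. l i \<ge> 0" "\<exists>i\<in>I. l i > 0" "(\<Sum>i\<in>I. l i *s f i) = 0"
    using assms(1) by (auto simp: positively_dependent_def)
  let ?l = "\<lambda>i. if i \<in> I then l i else 0"
  have "(\<Sum>i\<in>J. ?l i *s f i) = (\<Sum>i\<in>I. l i *s f i)"
    using assms(2,3) by (intro sum.mono_neutral_cong_right) auto
  then show ?thesis unfolding positively_dependent_def using l assms(2)
    by (intro exI[of _ ?l]) auto
qed

lemma positively_dependent_zero: "positively_dependent {i} f" if "f i = 0"
  using that by (auto simp: positively_dependent_def intro: exI[of _ "\<lambda>_. 1"])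

lemma positively_dependent_eliminate:
  assumes I: "finite I" "t \<notin> I" and r: "\<And>i. i \<in> I \<Longrightarrow> r i \<le> 0"
    and dep: "positively_dependent I (\<lambda>i. f i - r i *s f t)"
  shows "positively_dependent (insert t I) f"
proof -
  obtain l where l: "\<forall>i\<in>I. l i \<ge> 0" "\<exists>i\<in>I. l i > 0" "(\<Sum>i\<in>I. l i *s (f i - r i *s f t)) = 0"
    using dep by (auto simp: positively_dependent_def)
  define m where "m = - (\<Sum>i\<in>I. l i * r i)"
  have "m \<ge> 0" unfolding m_def using l(1) r by (simp add: sum_nonpos mult_nonneg_nonpos)
  have "(\<Sum>i\<in>I. (l(t := m)) i *s f i) = (\<Sum>i\<in>I. l i *s f i)"
    using I(2) by (intro sum.cong) auto
  moreover have "(\<Sum>i\<in>I. l i *s (f i - r i *s f t)) = (\<Sum>i\<in>I. l i *s f i) + m *s f t"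
    by (simp add: m_def vec.scale_right_diff_distrib sum_subtractf vec.scale_sum_left)
  ultimately have "(\<Sum>i\<in>insert t I. (l(t := m)) i *s f i) = 0"
    using I l(3) by (simp add: add.commute)
  then show ?thesis unfolding positively_dependent_def using I(2) l(1,2) \<open>m \<ge> 0\<close>
    by (intro exI[of _ "l(t := m)"]) auto
qed

lemma positive_functional_eliminate:
  fixes f :: "'i \<Rightarrow> rat ^ 'n"
  assumes I: "finite I" and t: "qdot c (f t) < 0"
    and d: "\<And>i. i \<in> I \<Longrightarrow> qdot d (f i - (qdot c (f i) / qdot c (f t)) *s f t) > 0"
  obtains b where "\<And>i. i \<in> insert t I \<Longrightarrow> qdot b (f i) > 0"
proof -
  let ?r = "\<lambda>i. qdot c (f i) / qdot c (f t)"
  obtain e where e: "e > 0" "\<And>i. i \<in> I \<Longrightarrow> qdot d (f i - ?r i *s f t) + e * ?r i > 0"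
    by (rule small_perturbation[OF I, of "\<lambda>i. qdot d (f i - ?r i *s f t)" ?r]) (use d in auto)
  define k where "k = (e - qdot d (f t)) / qdot c (f t)"
  have "qdot (d + k *s c) (f t) = e" using t by (simp add: qdot_simps k_def)
  moreover have "qdot (d + k *s c) (f i) = qdot d (f i - ?r i *s f t) + e * ?r i" for i
    by (simp add: qdot_simps k_def left_diff_distrib diff_divide_distrib mult.commute)
  ultimately have "qdot (d + k *s c) (f i) > 0" if "i \<in> insert t I" for i
    using that e by (metis insertE)
  then show thesis by (rule that)
qed

theorem gordan:
  fixes f :: "'i \<Rightarrow> rat ^ 'n"
  assumes "finite I" "\<not> positively_dependent I f"
  obtains c where "\<And>i. i \<in> I \<Longrightarrow> qdot c (f i) > 0"
proof -
  have "\<exists>c. \<forall>i\<in>I. qdot c (f i) > 0" using assms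
  proof (induction I arbitrary: f)
    case (insert t I)
    have fin: "finite (insert t I)" using insert.hyps(1) by simp
    have "\<not> positively_dependent I f"
      using insert.prems positively_dependent_mono[OF _ subset_insertI fin] by blast
    then obtain c where c: "\<forall>i\<in>I. qdot c (f i) > 0" using insert.IH by blast
    consider (pos) "qdot c (f t) > 0" | (zero) "qdot c (f t) = 0" | (neg) "qdot c (f t) < 0" by linarith
    then show ?case
    proof cases
      case pos
      then show ?thesis using c by blast
    next
      case zero
      have "f t \<noteq> 0"
        using insert.prems positively_dependent_mono[OF positively_dependent_zero _ fin, of f t] by auto
      then have "qdot (f t) (f t) > 0" by (rule qdot_self_pos)
      moreover obtain e where "e > 0" "\<And>i. i \<in> I \<Longrightarrow> qdot c (f i) + e * qdot (f t) (f i) > 0"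
        by (rule small_perturbation[OF insert.hyps(1), of "\<lambda>i. qdot c (f i)" "\<lambda>i. qdot (f t) (f i)"])
           (use c in auto)
      ultimately show ?thesis using zero
        by (intro exI[of _ "c + e *s f t"]) (auto simp: qdot_simps)
    next
      case neg
      let ?r = "\<lambda>i. qdot c (f i) / qdot c (f t)"
      have "?r i \<le> 0" if "i \<in> I" for i using c neg that by (simp add: divide_nonneg_neg less_imp_le)
      then have "\<not> positively_dependent I (\<lambda>i. f i - ?r i *s f t)"
        using positively_dependent_eliminate[OF insert.hyps(1,2), of ?r f] insert.prems by blast
      then obtain d where "\<forall>i\<in>I. qdot d (f i - ?r i *s f t) > 0" using insert.IH by blast
      then show ?thesis
        using positive_functional_eliminate[of I c f t d] insert.hyps(1) neg by metis
    qed
  qed simp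
  then show thesis using that by blast
qed

section \<open>Rational cones and their extreme rays\<close>

definition qcone :: "(rat ^ 'n) set \<Rightarrow> bool" where
  "qcone T \<longleftrightarrow> 0 \<in> T \<and> (\<forall>x\<in>T. \<forall>y\<in>T. x + y \<in> T) \<and> (\<forall>x\<in>T. \<forall>c\<ge>0. c *s x \<in> T)"

lemma qcone_0: "qcone T \<Longrightarrow> 0 \<in> T"
  and qcone_add: "qcone T \<Longrightarrow> x \<in> T \<Longrightarrow> y \<in> T \<Longrightarrow> x + y \<in> T"
  and qcone_scale: "qcone T \<Longrightarrow> x \<in> T \<Longrightarrow> c \<ge> 0 \<Longrightarrow> c *s x \<in> T"
  by (auto simp: qcone_def)

lemma qcone_sum:
  assumes "qcone T" "\<And>i. i \<in> F \<Longrightarrow> f i \<in> T"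
  shows "(\<Sum>i\<in>F. f i) \<in> T"
  using assms(2)
  by (induction F rule: infinite_finite_induct) (auto intro: assms(1) qcone_0 qcone_add)

lemma subspace_qcone: "vec.subspace V \<Longrightarrow> qcone V"
  by (auto simp: qcone_def vec.subspace_def)

lemma qcone_pos_cone: "qcone (pos_cone S)"
proof -
  have "(\<Sum>v\<in>F. c v *s v) + (\<Sum>v\<in>G. d v *s v) \<in> pos_cone S"
    if F: "finite F" "F \<subseteq> S" "\<forall>v\<in>F. c v \<ge> 0" and G: "finite G" "G \<subseteq> S" "\<forall>v\<in>G. d v \<ge> 0" for F G c d
  proof -
    define e where "e v = (if v \<in> F then c v else 0) + (if v \<in> G then d v else 0)" for v
    have "(\<Sum>v\<in>F \<union> G. e v *s v) = (\<Sum>v\<in>F \<union> G. (if v \<in> F then c v else 0) *s v) +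
        (\<Sum>v\<in>F \<union> G. (if v \<in> G then d v else 0) *s v)"
      by (simp add: e_def vec.scale_left_distrib sum.distrib)
    also have "(\<Sum>v\<in>F \<union> G. (if v \<in> F then c v else 0) *s v) = (\<Sum>v\<in>F. c v *s v)"
      using F G by (intro sum.mono_neutral_cong_right) auto
    also have "(\<Sum>v\<in>F \<union> G. (if v \<in> G then d v else 0) *s v) = (\<Sum>v\<in>G. d v *s v)"
      using F G by (intro sum.mono_neutral_cong_right) auto
    finally have "(\<Sum>v\<in>F. c v *s v) + (\<Sum>v\<in>G. d v *s v) = (\<Sum>v\<in>F \<union> G. e v *s v)" by simp
    then show ?thesis unfolding pos_cone_def using F G
      by (intro CollectI exI[of _ "F \<union> G"] exI[of _ e]) (auto simp: e_def)
  qed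
  moreover have "c *s (\<Sum>v\<in>F. d v *s v) \<in> pos_cone S"
    if "finite F" "F \<subseteq> S" "\<forall>v\<in>F. d v \<ge> 0" "c \<ge> 0" for F c d
    unfolding pos_cone_def using that
    by (intro CollectI exI[of _ F] exI[of _ "\<lambda>v. c * d v"]) (auto simp: vec.scale_sum_right)
  moreover have "0 \<in> pos_cone S" unfolding pos_cone_def
    by (intro CollectI exI[of _ "{}"]) auto
  ultimately show ?thesis by (auto simp: qcone_def pos_cone_def[of S])
qed

lemmas pos_cone_0 = qcone_0[OF qcone_pos_cone]
lemmas pos_cone_add = qcone_add[OF qcone_pos_cone]
lemmas pos_cone_scale = qcone_scale[OF qcone_pos_cone]
lemmas pos_cone_sum = qcone_sum[OF qcone_pos_cone]

lemma pos_cone_superset: "S \<subseteq> pos_cone S"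
proof
  fix x assume "x \<in> S"
  then show "x \<in> pos_cone S" unfolding pos_cone_def
    by (intro CollectI exI[of _ "{x}"] exI[of _ "\<lambda>_. 1"]) auto
qed

lemma pos_cone_base: "x \<in> S \<Longrightarrow> x \<in> pos_cone S"
  using pos_cone_superset by blast

lemma pos_cone_scale_base: "x \<in> S \<Longrightarrow> c \<ge> 0 \<Longrightarrow> c *s x \<in> pos_cone S"
  by (intro pos_cone_scale pos_cone_base)

lemma pos_cone_minimal: "qcone T \<Longrightarrow> S \<subseteq> T \<Longrightarrow> pos_cone S \<subseteq> T"
  by (auto simp: pos_cone_def intro!: qcone_sum qcone_scale)

lemma pos_cone_mono: "S \<subseteq> T \<Longrightarrow> pos_cone S \<subseteq> pos_cone T"
  using pos_cone_minimal[OF qcone_pos_cone, of S T] pos_cone_superset[of T] by blast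

lemma pos_cone_Un:
  "pos_cone (S \<union> T) = {x + y | x y. x \<in> pos_cone S \<and> y \<in> pos_cone T}" (is "_ = ?sums")
proof
  show "pos_cone (S \<union> T) \<subseteq> ?sums"
  proof
    fix x assume "x \<in> pos_cone (S \<union> T)"
    then obtain F c where F: "finite F" "F \<subseteq> S \<union> T" "\<forall>v\<in>F. c v \<ge> 0" "x = (\<Sum>v\<in>F. c v *s v)"
      by (auto simp: pos_cone_def)
    have "x = (\<Sum>v\<in>F \<inter> S. c v *s v) + (\<Sum>v\<in>F - S. c v *s v)"
      unfolding F(4) by (rule sum.Int_Diff[OF F(1)])
    moreover have "(\<Sum>v\<in>F \<inter> S. c v *s v) \<in> pos_cone S" "(\<Sum>v\<in>F - S. c v *s v) \<in> pos_cone T"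
      using F(2,3) by (auto intro!: pos_cone_sum pos_cone_scale_base)
    ultimately show "x \<in> ?sums" by blast
  qed
  show "?sums \<subseteq> pos_cone (S \<union> T)"
    using pos_cone_mono[of S "S \<union> T"] pos_cone_mono[of T "S \<union> T"] pos_cone_add by blast
qed

lemma pos_cone_idem: "pos_cone (pos_cone S) = pos_cone S"
  using pos_cone_minimal[OF qcone_pos_cone, of "pos_cone S" S] pos_cone_superset by blast

lemma pos_cone_Un_pos_cone: "pos_cone (pos_cone S \<union> pos_cone T) = pos_cone (S \<union> T)"
  by (simp add: pos_cone_Un pos_cone_idem)

lemma pos_cone_absorb: "S \<subseteq> pos_cone T \<Longrightarrow> pos_cone (S \<union> T) = pos_cone T"
  using pos_cone_minimal[OF qcone_pos_cone, of "S \<union> T" T] pos_cone_superset[of T]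
    pos_cone_mono[of T "S \<union> T"] by blast

lemma pos_cone_delete_0: "pos_cone (S - {0}) = pos_cone S"
proof
  have "v \<in> pos_cone (S - {0})" if "v \<in> S" for v
    using that pos_cone_0[of "S - {0}"] pos_cone_base[of v "S - {0}"] by (cases "v = 0") auto
  then show "pos_cone S \<subseteq> pos_cone (S - {0})" by (intro pos_cone_minimal qcone_pos_cone) blast
qed (intro pos_cone_mono Diff_subset)

lemma pos_cone_singleton: "pos_cone {v} = {t *s v | t. t \<ge> 0}"
proof
  have "(\<Sum>w\<in>F. c w *s w) \<in> {t *s v | t. t \<ge> 0}" if "F \<subseteq> {v}" "\<forall>w\<in>F. c w \<ge> 0" for F c
  proof (cases "F = {}")
    case True
    then show ?thesis by (auto intro: exI[of _ 0])
  next
    case False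
    then have "F = {v}" using that(1) by blast
    then show ?thesis using that(2) by auto
  qed
  then show "pos_cone {v} \<subseteq> {t *s v | t. t \<ge> 0}" unfolding pos_cone_def by blast
  show "{t *s v | t. t \<ge> 0} \<subseteq> pos_cone {v}" using pos_cone_base[of v "{v}"] pos_cone_scale by blast
qed

lemma pos_cone_singleton_eqI:
  assumes "w \<in> pos_cone {v}" "w \<noteq> 0" shows "pos_cone {w} = pos_cone {v}"
proof -
  obtain t where t: "w = t *s v" "t \<ge> 0" using assms(1) by (auto simp: pos_cone_singleton)
  then have "v = (1 / t) *s w" using assms(2) by auto
  then have "v \<in> pos_cone {w}" using t(2) by (auto simp: pos_cone_singleton)
  then show ?thesis
    using assms(1) pos_cone_minimal[OF qcone_pos_cone, of "{v}" "{w}"]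
      pos_cone_minimal[OF qcone_pos_cone, of "{w}" "{v}"] by blast
qed

lemma span_pos_cone: "vec.span (pos_cone S) = vec.span S"
proof -
  have "pos_cone S \<subseteq> vec.span S"
    by (intro pos_cone_minimal subspace_qcone vec.subspace_span vec.span_superset)
  then show ?thesis
    by (metis pos_cone_superset subset_antisym vec.span_mono vec.span_span)
qed

lemma pos_cone_in_span: "x \<in> pos_cone S \<Longrightarrow> x \<in> vec.span S"
  using vec.span_base[of x "pos_cone S"] by (simp add: span_pos_cone)

lemma cone_dim_pos_cone: "cone_dim (pos_cone S) = vec.dim S"
  unfolding cone_dim_def by (metis span_pos_cone vec.dim_span)

lemma pos_cone_positive_functional:
  assumes pos: "\<And>s. s \<in> S \<Longrightarrow> s \<noteq> 0 \<Longrightarrow> qdot c s > 0" and x: "x \<in> pos_cone S" "x \<noteq> 0"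
  shows "qdot c x > 0"
proof -
  obtain F l where F: "finite F" "F \<subseteq> S" "\<forall>v\<in>F. l v \<ge> 0" "x = (\<Sum>v\<in>F. l v *s v)"
    using x(1) by (auto simp: pos_cone_def)
  obtain v where v: "v \<in> F" "l v *s v \<noteq> 0"
    using x(2) unfolding F(4) by (rule sum.not_neutral_contains_not_neutral)
  have "l w * qdot c w \<ge> 0" if "w \<in> F" for w
    using pos[of w] F(2,3) that by (cases "w = 0") (auto simp: qdot_simps intro!: mult_nonneg_nonneg)
  moreover have "l v * qdot c v > 0"
    using pos[of v] F(2,3) v by (auto simp: zero_less_mult_iff less_le)
  ultimately have "(\<Sum>w\<in>F. l w * qdot c w) > 0" by (intro sum_pos2[OF F(1) v(1)])
  then show ?thesis by (simp add: F(4) qdot_sum qdot_simps)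
qed

lemma strongly_convexD: "strongly_convex \<sigma> \<Longrightarrow> x \<in> \<sigma> \<Longrightarrow> - x \<in> \<sigma> \<Longrightarrow> x = 0"
  unfolding strongly_convex_def by (metis Int_iff image_eqI minus_minus singletonD)

lemma strongly_convexI:
  assumes "qcone \<sigma>" "\<And>x. x \<in> \<sigma> \<Longrightarrow> - x \<in> \<sigma> \<Longrightarrow> x = 0"
  shows "strongly_convex \<sigma>"
proof -
  have "x = 0" if "x \<in> \<sigma> \<inter> uminus ` \<sigma>" for x using that assms(2)[of x] by auto
  moreover have "0 \<in> \<sigma> \<inter> uminus ` \<sigma>" using qcone_0[OF assms(1)] by (metis IntI imageI minus_zero)
  ultimately show ?thesis unfolding strongly_convex_def by blast
qed

lemma strongly_convex_subset:
  "strongly_convex \<sigma> \<Longrightarrow> qcone \<tau> \<Longrightarrow> \<tau> \<subseteq> \<sigma> \<Longrightarrow> strongly_convex \<tau>"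
  by (metis strongly_convexI strongly_convexD subsetD)

lemma strongly_convex_sum_eq_0:
  assumes "strongly_convex \<sigma>" and \<sigma>: "qcone \<sigma>" and "finite F"
    and f: "\<And>i. i \<in> F \<Longrightarrow> f i \<in> \<sigma>" and sum: "(\<Sum>i\<in>F. f i) = 0" and i: "i \<in> F"
  shows "f i = 0"
proof -
  have "f i + (\<Sum>j\<in>F - {i}. f j) = 0" using sum sum.remove[OF \<open>finite F\<close> i, of f] by simp
  then have "- f i = (\<Sum>j\<in>F - {i}. f j)" by (simp add: neg_eq_iff_add_eq_0)
  also have "\<dots> \<in> \<sigma>" using f by (intro qcone_sum[OF \<sigma>]) auto
  finally show ?thesis using strongly_convexD[OF assms(1)] f[OF i] by blast
qed

lemma strongly_convex_pos_cone_iff: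
  assumes "finite S"
  shows "strongly_convex (pos_cone S) \<longleftrightarrow> (\<exists>c. \<forall>s\<in>S. s \<noteq> 0 \<longrightarrow> qdot c s > 0)"
proof
  assume pointed: "strongly_convex (pos_cone S)"
  have "\<not> positively_dependent (S - {0}) (\<lambda>s. s)"
  proof
    assume "positively_dependent (S - {0}) (\<lambda>s. s)"
    then obtain l t where l: "\<forall>s\<in>S - {0}. l s \<ge> 0" "(\<Sum>s\<in>S - {0}. l s *s s) = 0"
      and t: "t \<in> S - {0}" "l t > 0" unfolding positively_dependent_def by blast
    have "l t *s t = 0"
      using l(1) assms t(1)
      by (intro strongly_convex_sum_eq_0[OF pointed qcone_pos_cone _ _ l(2)] pos_cone_scale_base) auto
    then show False using t by simp
  qed
  with finite_Diff[OF assms] obtain c where "\<And>s. s \<in> S - {0} \<Longrightarrow> qdot c s > 0"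
    by (rule gordan) (rule that)
  then show "\<exists>c. \<forall>s\<in>S. s \<noteq> 0 \<longrightarrow> qdot c s > 0" by auto
next
  assume "\<exists>c. \<forall>s\<in>S. s \<noteq> 0 \<longrightarrow> qdot c s > 0"
  then obtain c where c: "\<And>s. s \<in> S \<Longrightarrow> s \<noteq> 0 \<Longrightarrow> qdot c s > 0" by blast
  show "strongly_convex (pos_cone S)"
  proof (rule strongly_convexI[OF qcone_pos_cone], rule ccontr)
    fix x assume x: "x \<in> pos_cone S" "- x \<in> pos_cone S" "x \<noteq> 0"
    have "qdot c x > 0" "qdot c (- x) > 0"
      using x by (auto intro: pos_cone_positive_functional[OF c])
    then show False by (simp add: qdot_simps)
  qed
qed

lemma strongly_convex_positive_functional:
  assumes "finite S" "strongly_convex (pos_cone S)"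
  obtains c where "\<And>x. x \<in> pos_cone S \<Longrightarrow> x \<noteq> 0 \<Longrightarrow> qdot c x > 0"
proof -
  obtain c where "\<forall>s\<in>S. s \<noteq> 0 \<longrightarrow> qdot c s > 0"
    using assms strongly_convex_pos_cone_iff by blast
  then show thesis using that pos_cone_positive_functional by blast
qed

lemma strongly_convex_pos_cone_singleton: "strongly_convex (pos_cone {v})"
  using qdot_self_pos by (subst strongly_convex_pos_cone_iff) auto

lemma strongly_convex_line_eq:
  assumes "strongly_convex \<tau>" "qcone \<tau>" "cone_dim \<tau> = 1" and v: "v \<in> \<tau>" "v \<noteq> 0"
  shows "\<tau> = pos_cone {v}"
proof
  show "pos_cone {v} \<subseteq> \<tau>" using v by (intro pos_cone_minimal assms(2)) auto
  show "\<tau> \<subseteq> pos_cone {v}"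
  proof
    fix x assume x: "x \<in> \<tau>"
    have "\<tau> \<subseteq> vec.span {v}"
      using v assms(3) by (intro vec.card_ge_dim_independent) (auto simp: cone_dim_def)
    then obtain t where t: "x = t *s v" using x by (auto simp: vec.span_singleton)
    have "t \<ge> 0"
    proof (rule ccontr)
      assume "\<not> t \<ge> 0"
      then have "- v = (- 1 / t) *s x" by (simp add: t)
      also have "\<dots> \<in> \<tau>" using \<open>\<not> t \<ge> 0\<close> by (intro qcone_scale assms(2) x) (simp add: divide_nonneg_neg)
      finally show False using strongly_convexD[OF assms(1) v(1)] v(2) by simp
    qed
    then show "x \<in> pos_cone {v}" using t by (auto simp: pos_cone_singleton)
  qed
qed

definition exposes :: "rat ^ 'n \<Rightarrow> (rat ^ 'n) set \<Rightarrow> rat ^ 'n \<Rightarrow> bool" where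
  "exposes c \<sigma> v \<longleftrightarrow> v \<noteq> 0 \<and> (\<forall>x\<in>\<sigma>. qdot c x \<ge> 0) \<and> \<sigma> \<inter> {x. qdot c x = 0} = pos_cone {v}"

lemma exposes_eq_0_iff:
  assumes "exposes c \<sigma> v" "x \<in> \<sigma>" shows "qdot c x = 0 \<longleftrightarrow> x \<in> pos_cone {v}"
  using assms unfolding exposes_def by blast

lemma exposes_extreme_ray:
  assumes "exposes c \<sigma> v" shows "pos_cone {v} \<in> extreme_rays \<sigma>"
proof -
  have "cone_dim (pos_cone {v}) = 1" using assms by (simp add: cone_dim_pos_cone exposes_def)
  then show ?thesis using assms unfolding exposes_def extreme_rays_def faces_def by auto
qed

lemma extreme_rayE:
  assumes "\<rho> \<in> extreme_rays \<sigma>" "strongly_convex \<sigma>" "qcone \<sigma>"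
  obtains c v where "\<rho> = pos_cone {v}" "v \<in> \<sigma>" "exposes c \<sigma> v"
proof -
  obtain c where c: "\<rho> = \<sigma> \<inter> {x. qdot c x = 0}" "\<forall>x\<in>\<sigma>. qdot c x \<ge> 0" "cone_dim \<rho> = 1"
    using assms(1) by (auto simp: extreme_rays_def faces_def)
  have "qcone \<rho>" unfolding c(1) using assms(3) by (auto simp: qcone_def qdot_simps)
  then have "strongly_convex \<rho>" using strongly_convex_subset[OF assms(2)] c(1) by blast
  obtain v where v: "v \<in> \<rho>" "v \<noteq> 0" using c(3) dim_pos_iff[of \<rho>] by (auto simp: cone_dim_def)
  have "\<rho> = pos_cone {v}" by (rule strongly_convex_line_eq) fact+
  then show thesis using that[of v c] c v by (auto simp: exposes_def)
qed

lemma extreme_ray_subcone: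
  assumes \<rho>: "\<rho> \<in> extreme_rays \<sigma>" and \<sigma>: "strongly_convex \<sigma>" "qcone \<sigma>"
    and \<tau>: "\<tau> \<subseteq> \<sigma>" "qcone \<tau>" and w: "w \<in> \<rho>" "w \<in> \<tau>" "w \<noteq> 0"
  shows "\<rho> \<in> extreme_rays \<tau>"
proof -
  obtain c v where c: "\<rho> = pos_cone {v}" "exposes c \<sigma> v" by (rule extreme_rayE[OF \<rho> \<sigma>])
  have ray: "\<rho> = pos_cone {w}" using pos_cone_singleton_eqI w c(1) by blast
  then have "\<rho> \<subseteq> \<tau>" using pos_cone_minimal[OF \<tau>(2), of "{w}"] w(2) by blast
  then have "exposes c \<tau> w" using c \<tau>(1) w(3) ray by (auto simp: exposes_def)
  then show ?thesis using exposes_extreme_ray ray by blast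
qed

lemma extreme_rays_Un_subset:
  assumes pointed: "strongly_convex (pos_cone (S \<union> T))"
  shows "extreme_rays (pos_cone (S \<union> T)) \<subseteq> extreme_rays (pos_cone S) \<union> extreme_rays (pos_cone T)"
proof
  fix \<rho> assume \<rho>: "\<rho> \<in> extreme_rays (pos_cone (S \<union> T))"
  obtain c v where c: "\<rho> = pos_cone {v}" "v \<in> pos_cone (S \<union> T)" "exposes c (pos_cone (S \<union> T)) v"
    by (rule extreme_rayE[OF \<rho> pointed qcone_pos_cone])
  obtain x y where xy: "v = x + y" "x \<in> pos_cone S" "y \<in> pos_cone T"
    using c(2) unfolding pos_cone_Un by blast
  have sub: "pos_cone S \<subseteq> pos_cone (S \<union> T)" "pos_cone T \<subseteq> pos_cone (S \<union> T)" by (auto intro!: pos_cone_mono)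
  have "qdot c v = 0" using exposes_eq_0_iff[OF c(3,2)] by (simp add: pos_cone_base)
  then have "qdot c x + qdot c y = 0" by (simp add: xy(1) qdot_simps)
  moreover have "qdot c x \<ge> 0" "qdot c y \<ge> 0" using c(3) xy sub by (auto simp: exposes_def)
  ultimately have "x \<in> \<rho>" "y \<in> \<rho>" using c xy sub unfolding exposes_def by auto
  moreover have "x \<noteq> 0 \<or> y \<noteq> 0" using c(3) xy(1) by (auto simp: exposes_def)
  ultimately show "\<rho> \<in> extreme_rays (pos_cone S) \<union> extreme_rays (pos_cone T)"
    using extreme_ray_subcone[OF \<rho> pointed qcone_pos_cone sub(1) qcone_pos_cone, of x]
      extreme_ray_subcone[OF \<rho> pointed qcone_pos_cone sub(2) qcone_pos_cone, of y] xy by blast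
qed

lemma extreme_rays_singleton: "extreme_rays (pos_cone {v}) \<subseteq> {pos_cone {v}}"
proof
  fix \<rho> assume \<rho>: "\<rho> \<in> extreme_rays (pos_cone {v})"
  obtain c w where "\<rho> = pos_cone {w}" "w \<in> pos_cone {v}" "exposes c (pos_cone {v}) w"
    by (rule extreme_rayE[OF \<rho> strongly_convex_pos_cone_singleton qcone_pos_cone])
  then show "\<rho> \<in> {pos_cone {v}}" using pos_cone_singleton_eqI by (auto simp: exposes_def)
qed

lemma extreme_rays_pos_cone_subset:
  assumes "finite S" "strongly_convex (pos_cone S)"
  shows "extreme_rays (pos_cone S) \<subseteq> (\<lambda>s. pos_cone {s}) ` S"
  using assms
proof (induction S)
  case empty
  have "pos_cone {} = {0}" by (auto simp: pos_cone_def)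
  then have "cone_dim \<tau> = 0" if "\<tau> \<in> faces (pos_cone {})" for \<tau> :: "(rat ^ 'a) set"
    using that by (auto simp: faces_def cone_dim_def)
  then show ?case by (force simp: extreme_rays_def)
next
  case (insert s S)
  have "strongly_convex (pos_cone S)"
    by (rule strongly_convex_subset[OF insert.prems qcone_pos_cone]) (auto intro!: pos_cone_mono)
  then show ?case
    using insert.IH extreme_rays_Un_subset[of "{s}" S] extreme_rays_singleton[of s] insert.prems by auto
qed

lemma finite_extreme_rays:
  "finite S \<Longrightarrow> strongly_convex (pos_cone S) \<Longrightarrow> finite (extreme_rays (pos_cone S))"
  using extreme_rays_pos_cone_subset finite_subset by blast

lemma pos_cone_line:
  assumes "strongly_convex (pos_cone S)" "vec.dim S = 1" "v \<in> pos_cone S" "v \<noteq> 0"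
  shows "pos_cone S = pos_cone {v}"
  using assms by (intro strongly_convex_line_eq qcone_pos_cone) (simp_all add: cone_dim_pos_cone)

lemma card_extreme_rays_line:
  assumes pointed: "strongly_convex (pos_cone S)" and dim: "vec.dim S = 1"
  shows "card (extreme_rays (pos_cone S)) \<le> 1"
proof -
  obtain v where "v \<in> S" "v \<noteq> 0" using dim dim_pos_iff[of S] by auto
  then have "pos_cone S = pos_cone {v}" by (intro pos_cone_line pointed dim pos_cone_base)
  then show ?thesis using card_mono[OF _ extreme_rays_singleton[of v]] by simp
qed

lemma card_extreme_rays_Un_le:
  assumes fin: "finite S" "finite T" and pointed: "strongly_convex (pos_cone (S \<union> T))"
  shows "card (extreme_rays (pos_cone (S \<union> T))) \<le>
    card (extreme_rays (pos_cone S)) + card (extreme_rays (pos_cone T))"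
proof -
  have "strongly_convex (pos_cone S)" "strongly_convex (pos_cone T)"
    by (auto intro!: strongly_convex_subset[OF pointed qcone_pos_cone] pos_cone_mono)
  then have "finite (extreme_rays (pos_cone S) \<union> extreme_rays (pos_cone T))"
    using fin finite_extreme_rays by blast
  then show ?thesis using card_mono[OF _ extreme_rays_Un_subset[OF pointed]] card_Un_le le_trans by blast
qed

lemma simplex_exposes:
  assumes "vec.independent {r, s}" "r \<noteq> s"
  obtains c where "exposes c (pos_cone {r, s}) r" "qdot c s > 0"
proof -
  obtain c where "\<And>b. b \<in> {r, s} \<Longrightarrow> qdot c b = (if b = r then 0 else 1)"
    by (rule qdot_independent_extend[OF assms(1), of "\<lambda>b. if b = r then 0 else 1"]) (rule that)
  then have c: "qdot c r = 0" "qdot c s = 1" using assms(2) by auto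
  have cone: "pos_cone {r, s} = {x + t *s s | x t. x \<in> pos_cone {r} \<and> t \<ge> 0}"
    unfolding insert_is_Un[of r "{s}"] pos_cone_Un by (auto simp: pos_cone_singleton[of s])
  have "qdot c x = 0" if "x \<in> pos_cone {r}" for x
    using that c(1) by (auto simp: pos_cone_singleton qdot_simps)
  then have qdot_eq: "qdot c (x + t *s s) = t" if "x \<in> pos_cone {r}" for x t
    using that c(2) by (simp add: qdot_simps)
  have "pos_cone {r, s} \<inter> {x. qdot c x = 0} \<subseteq> pos_cone {r}" unfolding cone using qdot_eq by auto
  moreover have "pos_cone {r} \<subseteq> pos_cone {r, s} \<inter> {x. qdot c x = 0}"
    using pos_cone_mono[of "{r}" "{r, s}"] qdot_eq[of _ 0] by auto
  moreover have "r \<noteq> 0" using assms(1) vec.dependent_zero[of "{r, s}"] by auto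
  moreover have "\<forall>x\<in>pos_cone {r, s}. qdot c x \<ge> 0" unfolding cone using qdot_eq by auto
  ultimately show thesis using that c(2) by (auto simp: exposes_def)
qed

lemma simplex_cone:
  assumes ind: "vec.independent {r, s}" "r \<noteq> s"
  defines "\<sigma> \<equiv> pos_cone {r, s}"
  shows "strongly_convex \<sigma>" "cone_dim \<sigma> = 2" "card (extreme_rays \<sigma>) = 2"
proof -
  have swap: "vec.independent {s, r}" "s \<noteq> r" "pos_cone {s, r} = \<sigma>"
    using ind by (simp_all add: insert_commute \<sigma>_def)
  obtain c where c: "exposes c \<sigma> r" "qdot c s > 0" unfolding \<sigma>_def by (rule simplex_exposes[OF ind])
  obtain d where d: "exposes d \<sigma> s" "qdot d r > 0"
    using simplex_exposes[OF swap(1,2)] unfolding swap(3) by blast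
  have rs: "r \<in> \<sigma>" "s \<in> \<sigma>" by (auto simp: \<sigma>_def intro: pos_cone_base)
  then have "qdot (c + d) x > 0" if "x \<in> {r, s}" for x
    using that c d by (auto simp: exposes_def qdot_simps intro: add_nonneg_pos add_pos_nonneg)
  then show pointed: "strongly_convex \<sigma>" unfolding \<sigma>_def by (subst strongly_convex_pos_cone_iff) auto
  show "cone_dim \<sigma> = 2" unfolding \<sigma>_def cone_dim_pos_cone
    using vec.dim_eq_card_independent[OF ind(1)] ind(2) by simp
  have "extreme_rays \<sigma> = {pos_cone {r}, pos_cone {s}}"
  proof
    show "extreme_rays \<sigma> \<subseteq> {pos_cone {r}, pos_cone {s}}"
      using extreme_rays_pos_cone_subset[of "{r, s}"] pointed by (auto simp: \<sigma>_def)
    show "{pos_cone {r}, pos_cone {s}} \<subseteq> extreme_rays \<sigma>" using exposes_extreme_ray c(1) d(1) by blast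
  qed
  moreover have "pos_cone {r} \<noteq> pos_cone {s}"
  proof
    assume "pos_cone {r} = pos_cone {s}"
    then have "s \<in> pos_cone {r}" by (simp add: pos_cone_base)
    then show False using exposes_eq_0_iff[OF c(1) rs(2)] c(2) by simp
  qed
  ultimately show "card (extreme_rays \<sigma>) = 2" by simp
qed

lemma exposes_Un:
  assumes exposes: "exposes c (pos_cone S) v" and v: "v \<in> pos_cone S"
    and pos: "\<And>y. y \<in> pos_cone T \<Longrightarrow> y \<noteq> 0 \<Longrightarrow> qdot c y > 0"
  shows "exposes c (pos_cone (S \<union> T)) v"
proof -
  have on_S: "qdot c x \<ge> 0" "qdot c x = 0 \<longleftrightarrow> x \<in> pos_cone {v}" if "x \<in> pos_cone S" for x
    using exposes exposes_eq_0_iff[OF exposes that] that by (auto simp: exposes_def)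
  have on_T: "qdot c y \<ge> 0" "qdot c y = 0 \<longleftrightarrow> y = 0" if "y \<in> pos_cone T" for y
    using pos[OF that] by (cases "y = 0"; force simp: qdot_simps)+
  have "pos_cone {v} \<subseteq> pos_cone S" using v by (intro pos_cone_minimal qcone_pos_cone) simp
  then have "pos_cone {v} \<subseteq> pos_cone (S \<union> T) \<inter> {x. qdot c x = 0}"
    using pos_cone_mono[of S "S \<union> T"] on_S(2) by auto
  moreover have "pos_cone (S \<union> T) \<inter> {x. qdot c x = 0} \<subseteq> pos_cone {v}"
  proof
    fix z assume "z \<in> pos_cone (S \<union> T) \<inter> {x. qdot c x = 0}"
    then obtain x y where z: "z = x + y" "x \<in> pos_cone S" "y \<in> pos_cone T" "qdot c x + qdot c y = 0"
      unfolding pos_cone_Un by (auto simp: qdot_simps)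
    then have "qdot c x = 0" "qdot c y = 0" using on_S(1)[of x] on_T(1)[of y] by linarith+
    then show "z \<in> pos_cone {v}" using on_S(2)[of x] on_T(2)[of y] z by simp
  qed
  moreover have "\<forall>z\<in>pos_cone (S \<union> T). qdot c z \<ge> 0"
    using on_S(1) on_T(1) unfolding pos_cone_Un by (auto simp: qdot_simps)
  ultimately show ?thesis using exposes by (auto simp: exposes_def)
qed

locale cone_direct_sum =
  fixes S1 S2 :: "(rat ^ 'n) set" and a
  assumes finite_generators: "finite S1" "finite S2"
    and pointed: "strongly_convex (pos_cone S1)" "strongly_convex (pos_cone S2)"
    and common_point: "a \<in> pos_cone S1" "a \<in> pos_cone S2" "a \<noteq> 0"
    and span_Int: "vec.span S1 \<inter> vec.span S2 = vec.span {a}"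
begin

lemma swap: "cone_direct_sum S2 S1 a"
  using finite_generators pointed common_point span_Int by unfold_locales (auto simp: Int_commute)

text \<open>Functionals that are positive on the two cones can be scaled to agree at \<open>a\<close>, hence on the intersection
  of the two spans, and glued; likewise for a functional exposing a ray of the first cone.\<close>

lemma glue_functionals:
  assumes "qdot c a > 0" "qdot d a > 0"
  obtains e k where "k > 0" "\<And>x. x \<in> pos_cone S1 \<Longrightarrow> qdot e x = qdot c x"
    "\<And>y. y \<in> pos_cone S2 \<Longrightarrow> qdot e y = k * qdot d y"
proof -
  define k where "k = qdot c a / qdot d a"
  have "qdot c x = qdot (k *s d) x" if "x \<in> vec.span S1 \<inter> vec.span S2" for x
    using that assms unfolding span_Int by (auto simp: vec.span_singleton qdot_simps k_def)
  then obtain e where "\<And>x. x \<in> vec.span S1 \<Longrightarrow> qdot e x = qdot c x"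
    "\<And>y. y \<in> vec.span S2 \<Longrightarrow> qdot e y = qdot (k *s d) y"
    by (rule qdot_glue[of "vec.span S1" "vec.span S2", OF vec.subspace_span vec.subspace_span])
      (assumption, rule that)
  moreover have "k > 0" using assms by (simp add: k_def)
  ultimately show thesis using that[of k e] by (simp add: qdot_simps pos_cone_in_span)
qed

lemma strongly_convex_sum: "strongly_convex (pos_cone (S1 \<union> S2))"
proof -
  obtain c where c: "\<And>x. x \<in> pos_cone S1 \<Longrightarrow> x \<noteq> 0 \<Longrightarrow> qdot c x > 0"
    by (rule strongly_convex_positive_functional[OF finite_generators(1) pointed(1)]) (rule that)
  obtain d where d: "\<And>y. y \<in> pos_cone S2 \<Longrightarrow> y \<noteq> 0 \<Longrightarrow> qdot d y > 0"
    by (rule strongly_convex_positive_functional[OF finite_generators(2) pointed(2)]) (rule that)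
  obtain e k where "k > 0" "\<And>x. x \<in> pos_cone S1 \<Longrightarrow> qdot e x = qdot c x"
    "\<And>y. y \<in> pos_cone S2 \<Longrightarrow> qdot e y = k * qdot d y"
    by (rule glue_functionals[of c d]) (use c d common_point that in auto)
  then have "qdot e s > 0" if "s \<in> S1 \<union> S2" "s \<noteq> 0" for s
    using that c d pos_cone_base by (metis Un_iff mult_pos_pos)
  then show ?thesis using finite_generators by (auto simp: strongly_convex_pos_cone_iff)
qed

lemma cone_dim_sum: "cone_dim (pos_cone (S1 \<union> S2)) + 1 = cone_dim (pos_cone S1) + cone_dim (pos_cone S2)"
  using dim_Un_Int_span[of S1 S2] common_point(3) by (simp add: cone_dim_pos_cone span_Int)

lemma extreme_ray_sum:
  assumes \<rho>: "\<rho> \<in> extreme_rays (pos_cone S1)" and "a \<notin> \<rho>"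
  shows "\<rho> \<in> extreme_rays (pos_cone (S1 \<union> S2))"
proof -
  obtain c v where c: "\<rho> = pos_cone {v}" "v \<in> pos_cone S1" "exposes c (pos_cone S1) v"
    by (rule extreme_rayE[OF \<rho> pointed(1) qcone_pos_cone])
  obtain d where d: "\<And>y. y \<in> pos_cone S2 \<Longrightarrow> y \<noteq> 0 \<Longrightarrow> qdot d y > 0"
    by (rule strongly_convex_positive_functional[OF finite_generators(2) pointed(2)]) (rule that)
  have "qdot c a > 0"
    using exposes_eq_0_iff[OF c(3) common_point(1)] \<open>a \<notin> \<rho>\<close> c(1,3) common_point(1)
    by (auto simp: exposes_def less_le)
  then obtain e k where e: "k > 0" "\<And>x. x \<in> pos_cone S1 \<Longrightarrow> qdot e x = qdot c x"
    "\<And>y. y \<in> pos_cone S2 \<Longrightarrow> qdot e y = k * qdot d y"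
    by (rule glue_functionals[of c d]) (use d common_point that in auto)
  have "pos_cone S1 \<inter> {x. qdot e x = 0} = pos_cone S1 \<inter> {x. qdot c x = 0}" using e(2) by auto
  then have "exposes e (pos_cone S1) v" using c(3) e(2) by (simp add: exposes_def)
  moreover have "qdot e y > 0" if "y \<in> pos_cone S2" "y \<noteq> 0" for y
    using d[OF that] e(1) e(3)[OF that(1)] by simp
  ultimately have "exposes e (pos_cone (S1 \<union> S2)) v" using c(2) by (intro exposes_Un)
  then show ?thesis using exposes_extreme_ray c(1) by blast
qed

lemma extreme_ray_common:
  assumes \<rho>: "\<rho> \<in> extreme_rays (pos_cone S1)" "\<rho> \<in> extreme_rays (pos_cone S2)"
  shows "a \<in> \<rho>"
proof -
  obtain c v where c: "\<rho> = pos_cone {v}" "v \<in> pos_cone S1" "exposes c (pos_cone S1) v"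
    by (rule extreme_rayE[OF \<rho>(1) pointed(1) qcone_pos_cone])
  have "v \<in> \<rho>" "v \<noteq> 0" using c by (auto simp: pos_cone_base exposes_def)
  moreover have "v \<in> pos_cone S2" using \<rho>(2) \<open>v \<in> \<rho>\<close> by (auto simp: extreme_rays_def faces_def)
  ultimately have "v \<in> vec.span {a}" using c(2) pos_cone_in_span span_Int by blast
  then obtain t where t: "v = t *s a" by (auto simp: vec.span_singleton)
  obtain d where d: "\<And>x. x \<in> pos_cone S1 \<Longrightarrow> x \<noteq> 0 \<Longrightarrow> qdot d x > 0"
    by (rule strongly_convex_positive_functional[OF finite_generators(1) pointed(1)]) (rule that)
  have "t * qdot d a > 0" using d[OF c(2) \<open>v \<noteq> 0\<close>] by (simp add: t qdot_simps)
  then have "t > 0" using d[OF common_point(1,3)] by (simp add: zero_less_mult_iff)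
  then have "a = (1 / t) *s v" by (simp add: t)
  then show ?thesis unfolding c(1) pos_cone_singleton using \<open>t > 0\<close> by auto
qed

lemma card_extreme_rays_sum:
  assumes "\<And>\<rho>. \<rho> \<in> extreme_rays (pos_cone S1) \<Longrightarrow> a \<notin> \<rho>" "\<And>\<rho>. \<rho> \<in> extreme_rays (pos_cone S2) \<Longrightarrow> a \<notin> \<rho>"
  shows "card (extreme_rays (pos_cone (S1 \<union> S2))) =
    card (extreme_rays (pos_cone S1)) + card (extreme_rays (pos_cone S2))"
proof -
  have "extreme_rays (pos_cone (S1 \<union> S2)) = extreme_rays (pos_cone S1) \<union> extreme_rays (pos_cone S2)"
    using extreme_rays_Un_subset[OF strongly_convex_sum] extreme_ray_sum
      cone_direct_sum.extreme_ray_sum[OF swap] assms by (auto simp: Un_commute)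
  moreover have "extreme_rays (pos_cone S1) \<inter> extreme_rays (pos_cone S2) = {}"
    using extreme_ray_common assms(1) by blast
  moreover have "finite (extreme_rays (pos_cone S1))" "finite (extreme_rays (pos_cone S2))"
    using finite_extreme_rays finite_generators pointed by blast+
  ultimately show ?thesis by (simp add: card_Un_disjoint)
qed

end

lemma internal_direct_sumE:
  assumes "internal_direct_sum \<sigma>1 \<sigma>2 \<sigma>" and "extreme_rays \<sigma>1 \<noteq> {}"
  obtains S1 S2 a where "\<sigma>1 = pos_cone S1" "\<sigma>2 = pos_cone S2" "\<sigma> = pos_cone (S1 \<union> S2)"
    "cone_direct_sum S1 S2 a"
    "\<And>\<rho>. \<rho> \<in> extreme_rays \<sigma>1 \<Longrightarrow> a \<notin> \<rho>" "\<And>\<rho>. \<rho> \<in> extreme_rays \<sigma>2 \<Longrightarrow> a \<notin> \<rho>"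
proof -
  obtain S1 S2 where S: "finite S1" "\<sigma>1 = pos_cone S1" "finite S2" "\<sigma>2 = pos_cone S2"
    using assms(1) by (auto simp: internal_direct_sum_def rational_polyhedral_cone_def)
  have \<sigma>: "strongly_convex \<sigma>1" "strongly_convex \<sigma>2" "\<sigma> = pos_cone (S1 \<union> S2)"
    using assms(1) S by (auto simp: internal_direct_sum_def pos_cone_Un_pos_cone)
  obtain a where a: "a \<in> \<sigma>1 \<inter> \<sigma>2" "vec.span \<sigma>1 \<inter> vec.span \<sigma>2 = {t *s a | t. True}"
    and off_rays: "\<forall>\<rho>\<in>extreme_rays \<sigma>1. a \<notin> \<rho>" "\<forall>\<rho>\<in>extreme_rays \<sigma>2. a \<notin> \<rho>"
    using assms(1) unfolding internal_direct_sum_def by (elim conjE bexE)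
  obtain \<rho> where \<rho>: "\<rho> \<in> extreme_rays \<sigma>1" using assms(2) by blast
  then have "0 \<in> \<rho>"
    by (rule extreme_rayE[OF _ \<sigma>(1)]) (auto simp: S(2) qcone_pos_cone pos_cone_0)
  then have "a \<noteq> 0" using off_rays(1) \<rho> by blast
  moreover have "vec.span S1 \<inter> vec.span S2 = vec.span {a}"
    using a(2) by (auto simp: S span_pos_cone vec.span_singleton)
  ultimately have "cone_direct_sum S1 S2 a" using S \<sigma> a(1) by unfold_locales simp_all
  then show thesis using that[OF S(2,4) \<sigma>(3)] off_rays by blast
qed

theorem general_bipyramidal_extreme_rays:
  assumes "\<sigma> \<in> general_bipyramidal"
  shows "cone_dim \<sigma> \<ge> 2 \<and> card (extreme_rays \<sigma>) = 2 * cone_dim \<sigma> - 2"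
  using assms
proof induction
  case (simplex2 r1 r2)
  then show ?case using simplex_cone[of r1 r2] by simp
next
  case (dsum \<sigma>1 \<sigma>2 \<sigma>)
  have "extreme_rays \<sigma>1 \<noteq> {}" using dsum.IH(1) by auto
  then obtain S1 S2 a where S: "\<sigma>1 = pos_cone S1" "\<sigma>2 = pos_cone S2" "\<sigma> = pos_cone (S1 \<union> S2)"
    and sum: "cone_direct_sum S1 S2 a"
    and a: "\<And>\<rho>. \<rho> \<in> extreme_rays \<sigma>1 \<Longrightarrow> a \<notin> \<rho>" "\<And>\<rho>. \<rho> \<in> extreme_rays \<sigma>2 \<Longrightarrow> a \<notin> \<rho>"
    by (rule internal_direct_sumE[OF dsum.hyps(3)]) (rule that)
  have "card (extreme_rays \<sigma>) = card (extreme_rays \<sigma>1) + card (extreme_rays \<sigma>2)"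
    using cone_direct_sum.card_extreme_rays_sum[OF sum] a by (simp add: S)
  moreover have "cone_dim \<sigma> + 1 = cone_dim \<sigma>1 + cone_dim \<sigma>2"
    using cone_direct_sum.cone_dim_sum[OF sum] by (simp add: S)
  ultimately show ?case using dsum.IH by linarith
qed

section \<open>Cones with the maximal number of extreme rays\<close>

definition bipyramid_bounded :: "(rat ^ 'n) set \<Rightarrow> bool" where
  "bipyramid_bounded \<sigma> \<longleftrightarrow> card (extreme_rays \<sigma>) \<le> 2 * cone_dim \<sigma> - 2 \<and>
    (card (extreme_rays \<sigma>) = 2 * cone_dim \<sigma> - 2 \<longrightarrow> \<sigma> \<in> general_bipyramidal)"

lemma lines_sum_bipyramidal:
  assumes pointed: "strongly_convex (pos_cone S)" "strongly_convex (pos_cone T)"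
    and dim: "vec.dim S = 1" "vec.dim T = 1" "vec.dim (S \<union> T) = 2"
  shows "pos_cone (S \<union> T) \<in> general_bipyramidal"
proof -
  obtain r s where r: "r \<in> S" "r \<noteq> 0" and s: "s \<in> T" "s \<noteq> 0"
    using dim dim_pos_iff[of S] dim_pos_iff[of T] by auto
  have "pos_cone S = pos_cone {r}" "pos_cone T = pos_cone {s}"
    using pos_cone_line[OF pointed(1) dim(1)] pos_cone_line[OF pointed(2) dim(2)] r s pos_cone_base
    by blast+
  then have cone: "pos_cone (S \<union> T) = pos_cone {r, s}"
    unfolding insert_is_Un[of r "{s}"] by (simp only: pos_cone_Un)
  then have "vec.dim {r, s} = 2"
    using dim(3) cone_dim_pos_cone[of "S \<union> T"] cone_dim_pos_cone[of "{r, s}"] by simp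
  moreover have "card {r, s} \<le> 2" by (simp add: card_insert_if)
  moreover have "vec.dim {r, s} \<le> card {r, s}" by (intro vec.dim_le_card') simp
  ultimately have card: "card {r, s} = vec.dim {r, s}" "r \<noteq> s" by auto
  then have "vec.independent {r, s}"
    by (intro vec.card_le_dim_spanning[of _ "{r, s}"]) (auto simp: vec.span_superset)
  then show ?thesis unfolding cone using card(2) by (rule general_bipyramidal.simplex2)
qed

lemma card_extreme_rays_le_odd:
  assumes "strongly_convex (pos_cone S)" "vec.dim S > 0"
    and "vec.dim S \<ge> 2 \<Longrightarrow> bipyramid_bounded (pos_cone S)"
  shows "card (extreme_rays (pos_cone S)) \<le> 2 * vec.dim S - 1"
    and "card (extreme_rays (pos_cone S)) = 2 * vec.dim S - 1 \<Longrightarrow> vec.dim S = 1"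
proof -
  consider "vec.dim S = 1" | "vec.dim S \<ge> 2" "card (extreme_rays (pos_cone S)) \<le> 2 * vec.dim S - 2"
    using assms(2,3) by (fastforce simp: bipyramid_bounded_def cone_dim_pos_cone)
  then show "card (extreme_rays (pos_cone S)) \<le> 2 * vec.dim S - 1"
    "card (extreme_rays (pos_cone S)) = 2 * vec.dim S - 1 \<Longrightarrow> vec.dim S = 1"
    using card_extreme_rays_line[OF assms(1)] by (cases; simp)+
qed

lemma bipyramid_bounded_independent_sum:
  assumes fin: "finite S" "finite T" and pointed: "strongly_convex (pos_cone (S \<union> T))"
    and dim: "vec.dim S > 0" "vec.dim T > 0" "vec.dim (S \<union> T) = vec.dim S + vec.dim T"
    and bounded: "vec.dim S \<ge> 2 \<Longrightarrow> bipyramid_bounded (pos_cone S)"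
      "vec.dim T \<ge> 2 \<Longrightarrow> bipyramid_bounded (pos_cone T)"
  shows "bipyramid_bounded (pos_cone (S \<union> T))"
proof -
  have pointed': "strongly_convex (pos_cone S)" "strongly_convex (pos_cone T)"
    by (auto intro!: strongly_convex_subset[OF pointed qcone_pos_cone] pos_cone_mono)
  note S = card_extreme_rays_le_odd[OF pointed'(1) dim(1) bounded(1)]
    and T = card_extreme_rays_le_odd[OF pointed'(2) dim(2) bounded(2)]
  note sum = card_extreme_rays_Un_le[OF fin pointed]
  have "pos_cone (S \<union> T) \<in> general_bipyramidal"
    if max: "card (extreme_rays (pos_cone (S \<union> T))) = 2 * vec.dim (S \<union> T) - 2"
  proof (rule lines_sum_bipyramidal[OF pointed'])
    have "card (extreme_rays (pos_cone S)) = 2 * vec.dim S - 1"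
      "card (extreme_rays (pos_cone T)) = 2 * vec.dim T - 1"
      using max S(1) T(1) sum dim by linarith+
    then show "vec.dim S = 1" "vec.dim T = 1" using S(2) T(2) by blast+
    then show "vec.dim (S \<union> T) = 2" using dim(3) by simp
  qed
  moreover have "card (extreme_rays (pos_cone (S \<union> T))) \<le> 2 * vec.dim (S \<union> T) - 2"
    using S(1) T(1) sum dim by linarith
  ultimately show ?thesis by (simp add: bipyramid_bounded_def cone_dim_pos_cone)
qed

context cone_direct_sum
begin

lemma internal_direct_sum_if_card_extreme_rays:
  assumes card: "card (extreme_rays (pos_cone (S1 \<union> S2))) =
    card (extreme_rays (pos_cone S1)) + card (extreme_rays (pos_cone S2))"
  shows "internal_direct_sum (pos_cone S1) (pos_cone S2) (pos_cone (S1 \<union> S2))"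
proof -
  let ?R1 = "extreme_rays (pos_cone S1)" and ?R2 = "extreme_rays (pos_cone S2)"
  have fin: "finite ?R1" "finite ?R2" using finite_extreme_rays finite_generators pointed by blast+
  have sub: "extreme_rays (pos_cone (S1 \<union> S2)) \<subseteq> ?R1 \<union> ?R2"
    by (rule extreme_rays_Un_subset[OF strongly_convex_sum])
  have card_Un: "card (?R1 \<union> ?R2) = card ?R1 + card ?R2"
    using card_mono[OF _ sub] card_Un_le[of ?R1 ?R2] fin card by simp
  then have disjoint: "?R1 \<inter> ?R2 = {}" using card_Un_Int[OF fin] fin by simp
  have all: "extreme_rays (pos_cone (S1 \<union> S2)) = ?R1 \<union> ?R2"
    using sub fin card card_Un by (intro card_subset_eq) auto
  have "a \<notin> \<rho>" if \<rho>: "\<rho> \<in> ?R1 \<union> ?R2" for \<rho>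
  proof
    assume "a \<in> \<rho>"
    moreover have "pos_cone S1 \<subseteq> pos_cone (S1 \<union> S2)" "pos_cone S2 \<subseteq> pos_cone (S1 \<union> S2)"
      by (auto intro!: pos_cone_mono)
    ultimately have "\<rho> \<in> ?R1 \<inter> ?R2"
      using \<rho> extreme_ray_subcone[OF _ strongly_convex_sum qcone_pos_cone _ qcone_pos_cone, of \<rho>]
        common_point
      unfolding all by blast
    then show False using disjoint by blast
  qed
  moreover have "vec.span (pos_cone S1) \<inter> vec.span (pos_cone S2) = {t *s a | t. True}"
    by (auto simp: span_pos_cone span_Int vec.span_singleton)
  ultimately show ?thesis
    using common_point(1,2) finite_generators pointed
    unfolding internal_direct_sum_def rational_polyhedral_cone_def
    by (auto simp: pos_cone_Un_pos_cone intro!: bexI[of _ a])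
qed

lemma bipyramid_bounded_sum:
  assumes dim: "vec.dim S1 \<ge> 2" "vec.dim S2 \<ge> 2"
    and bounded: "bipyramid_bounded (pos_cone S1)" "bipyramid_bounded (pos_cone S2)"
  shows "bipyramid_bounded (pos_cone (S1 \<union> S2))"
proof -
  let ?rays = "\<lambda>S. card (extreme_rays (pos_cone S))"
  have le: "?rays S1 \<le> 2 * vec.dim S1 - 2" "?rays S2 \<le> 2 * vec.dim S2 - 2"
    "?rays (S1 \<union> S2) \<le> ?rays S1 + ?rays S2"
    using bounded card_extreme_rays_Un_le[OF finite_generators strongly_convex_sum]
    by (simp_all add: bipyramid_bounded_def cone_dim_pos_cone)
  have sum: "vec.dim (S1 \<union> S2) + 1 = vec.dim S1 + vec.dim S2"
    using cone_dim_sum by (simp add: cone_dim_pos_cone)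
  have "pos_cone (S1 \<union> S2) \<in> general_bipyramidal" if max: "?rays (S1 \<union> S2) = 2 * vec.dim (S1 \<union> S2) - 2"
  proof (rule general_bipyramidal.dsum)
    have eq: "?rays S1 = 2 * vec.dim S1 - 2" "?rays S2 = 2 * vec.dim S2 - 2"
      and rays: "?rays (S1 \<union> S2) = ?rays S1 + ?rays S2"
      using max le sum dim by linarith+
    show "pos_cone S1 \<in> general_bipyramidal" "pos_cone S2 \<in> general_bipyramidal"
      using bounded eq by (simp_all add: bipyramid_bounded_def cone_dim_pos_cone)
    show "internal_direct_sum (pos_cone S1) (pos_cone S2) (pos_cone (S1 \<union> S2))"
      by (rule internal_direct_sum_if_card_extreme_rays[OF rays])
  qed
  moreover have "?rays (S1 \<union> S2) \<le> 2 * vec.dim (S1 \<union> S2) - 2" using le sum dim by linarith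
  ultimately show ?thesis by (simp add: bipyramid_bounded_def cone_dim_pos_cone)
qed

end

lemma pos_cone_Un_line:
  assumes "strongly_convex (pos_cone S)" "vec.dim S = 1" "a \<in> pos_cone S" "a \<in> pos_cone T" "a \<noteq> 0"
  shows "pos_cone (S \<union> T) = pos_cone T"
proof (rule pos_cone_absorb)
  have "pos_cone S = pos_cone {a}" by (rule pos_cone_line) fact+
  also have "\<dots> \<subseteq> pos_cone T" using assms(4) by (intro pos_cone_minimal qcone_pos_cone) simp
  finally show "S \<subseteq> pos_cone T" using pos_cone_superset by blast
qed

text \<open>The case \<open>a = 0\<close> covers two cones with independent spans.\<close>

lemma bipyramid_bounded_Un:
  assumes fin: "finite S" "finite T" and pointed: "strongly_convex (pos_cone (S \<union> T))"
    and a: "a \<in> pos_cone S" "a \<in> pos_cone T" "vec.span S \<inter> vec.span T = vec.span {a}"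
    and dim: "vec.dim S > 0" "vec.dim T > 0" "vec.dim (S \<union> T) \<ge> 2"
    and bounded: "vec.dim S \<ge> 2 \<Longrightarrow> bipyramid_bounded (pos_cone S)"
      "vec.dim T \<ge> 2 \<Longrightarrow> bipyramid_bounded (pos_cone T)"
  shows "bipyramid_bounded (pos_cone (S \<union> T))"
proof (cases "a = 0")
  case True
  then have "vec.dim (S \<union> T) = vec.dim S + vec.dim T" using dim_Un_Int_span[of S T] a(3) by simp
  then show ?thesis using bipyramid_bounded_independent_sum[OF fin pointed dim(1,2)] bounded by blast
next
  case False
  have pointed': "strongly_convex (pos_cone S)" "strongly_convex (pos_cone T)"
    by (auto intro!: strongly_convex_subset[OF pointed qcone_pos_cone] pos_cone_mono)
  have sum: "vec.dim (S \<union> T) + 1 = vec.dim S + vec.dim T" using dim_Un_Int_span[of S T] a(3) False by simp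
  consider (S) "vec.dim S = 1" | (T) "vec.dim T = 1" | (both) "vec.dim S \<ge> 2" "vec.dim T \<ge> 2"
    using dim(1,2) by linarith
  then show ?thesis
  proof cases
    case S
    then have "pos_cone (S \<union> T) = pos_cone T" using pos_cone_Un_line pointed'(1) a(1,2) False by blast
    then show ?thesis using bounded(2) sum dim(3) S by simp
  next
    case T
    then have "pos_cone (S \<union> T) = pos_cone S"
      using pos_cone_Un_line[of T a S] pointed'(2) a(1,2) False by (simp add: Un_commute)
    then show ?thesis using bounded(1) sum dim(3) T by simp
  next
    case both
    interpret cone_direct_sum S T a using fin pointed' a False by unfold_locales
    show ?thesis using bipyramid_bounded_sum both bounded by blast
  qed
qed

section \<open>Relation systems\<close>

locale relation_system = dominating A I P N
  for A :: "(rat ^ 'n) set" and I :: "'i set" and P N +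
  assumes nonzero: "0 \<notin> A" and pointed: "strongly_convex (pos_cone A)"
    and relation: "i \<in> I \<Longrightarrow> \<exists>a. a \<noteq> 0 \<and> a \<in> pos_cone (P i) \<inter> pos_cone (N i)"
begin

lemma relation_system_restrict:
  assumes "B \<subseteq> A" shows "relation_system B (enclosed I P N B) P N"
proof -
  interpret restrict: dominating B "enclosed I P N B" P N
    by (rule dominating_restrict[OF dominating_axioms assms])
  show ?thesis
  proof
    show "strongly_convex (pos_cone B)"
      by (rule strongly_convex_subset[OF pointed qcone_pos_cone pos_cone_mono[OF assms]])
  qed (use assms nonzero relation in \<open>auto simp: enclosed_def\<close>)
qed

lemma card_I_splitting:
  assumes "splitting A I P N A1 A2"
  shows "card I = card (enclosed I P N A1) + card (enclosed I P N A2) + card (crossing I P N A1 A2)"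
proof -
  have disjoint: "enclosed I P N A1 \<inter> enclosed I P N A2 = {}"
    using assms P_nonempty unfolding enclosed_def splitting_def by blast
  have "I = (enclosed I P N A1 \<union> enclosed I P N A2) \<union> crossing I P N A1 A2"
    by (auto simp: enclosed_def crossing_def)
  moreover have "(enclosed I P N A1 \<union> enclosed I P N A2) \<inter> crossing I P N A1 A2 = {}"
    by (auto simp: crossing_def)
  moreover have "finite (enclosed I P N A1)" "finite (enclosed I P N A2)" "finite (crossing I P N A1 A2)"
    using finite_I by (auto simp: enclosed_def crossing_def)
  ultimately show ?thesis using disjoint by (metis card_Un_disjoint finite_UnI)
qed

lemma splitting_common_point:
  assumes "splitting A I P N A1 A2"
  obtains a where "a \<in> pos_cone A1" "a \<in> pos_cone A2"
    "card I = card (enclosed I P N A1) + card (enclosed I P N A2) + vec.dim {a}"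
proof (cases "crossing I P N A1 A2 = {}")
  case True
  then show thesis using that[of 0] card_I_splitting[OF assms] by (simp add: pos_cone_0)
next
  case False
  then obtain i where i: "i \<in> crossing I P N A1 A2" by blast
  then have sides: "i \<in> I" "P i \<subseteq> A1" "N i \<subseteq> A2" using assms by (auto simp: splitting_def crossing_def)
  obtain a where "a \<noteq> 0" "a \<in> pos_cone (P i) \<inter> pos_cone (N i)" using relation[OF sides(1)] by blast
  moreover from this have "a \<in> pos_cone A1" "a \<in> pos_cone A2"
    using pos_cone_mono[OF sides(2)] pos_cone_mono[OF sides(3)] by blast+
  moreover have "finite (crossing I P N A1 A2)" using finite_I by (auto simp: crossing_def)
  then have "card (crossing I P N A1 A2) = 1"
    using assms i by (auto simp: splitting_def le_Suc_eq)
  ultimately show thesis using that card_I_splitting[OF assms] by simp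
qed

lemma splitting_card_less:
  assumes "splitting A I P N A1 A2"
  shows "card A1 + card A2 = card A" "card A1 < card A" "card A2 < card A" "vec.dim A1 > 0" "vec.dim A2 > 0"
proof -
  have split: "A1 \<noteq> {}" "A2 \<noteq> {}" "A1 \<inter> A2 = {}" "A1 \<union> A2 = A" using assms by (auto simp: splitting_def)
  then have fin: "finite A1" "finite A2" using finite_A by auto
  then show card: "card A1 + card A2 = card A" using card_Un_disjoint[of A1 A2] split by simp
  show "card A1 < card A" "card A2 < card A"
    using card fin split(1,2) card_gt_0_iff[of A1] card_gt_0_iff[of A2] by linarith+
  show "vec.dim A1 > 0" "vec.dim A2 > 0" using split nonzero by (auto simp: dim_pos_iff)
qed

end

lemma relation_system_dim_le:
  assumes "relation_system A I P N" shows "vec.dim A + card I \<le> card A"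
  using assms
proof (induction "card A" arbitrary: A I rule: less_induct)
  case less
  interpret relation_system A I P N by fact
  show ?case
  proof (cases "card A \<ge> 2")
    case False
    have "card I = 0"
    proof (cases "A = {}")
      case True
      then have "I = {}" using P_subset P_nonempty by auto
      then show ?thesis by simp
    next
      case False
      then show ?thesis using card_I_less \<open>\<not> card A \<ge> 2\<close> by linarith
    qed
    then show ?thesis using vec.dim_le_card'[OF finite_A] by simp
  next
    case True
    then obtain A1 A2 where split: "splitting A I P N A1 A2"
      using dominating_splitting[OF dominating_axioms] by blast
    then have A: "A = A1 \<union> A2" by (simp add: splitting_def)
    obtain a where a: "a \<in> pos_cone A1" "a \<in> pos_cone A2"
      "card I = card (enclosed I P N A1) + card (enclosed I P N A2) + vec.dim {a}"
      by (rule splitting_common_point[OF split])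
    have "vec.dim {a} \<le> vec.dim (vec.span A1 \<inter> vec.span A2)"
      using a(1,2) pos_cone_in_span by (intro vec.dim_subset) auto
    moreover have "vec.dim A1 + card (enclosed I P N A1) \<le> card A1"
      "vec.dim A2 + card (enclosed I P N A2) \<le> card A2"
      using splitting_card_less[OF split] A by (auto intro!: less.hyps relation_system_restrict)
    ultimately show ?thesis
      using dim_Un_Int_span[of A1 A2] splitting_card_less(1)[OF split] a(3) A by simp
  qed
qed

lemma (in relation_system) tight_splitting:
  assumes split: "splitting A I P N A1 A2" and tight: "vec.dim A + card I = card A"
  obtains a where "a \<in> pos_cone A1" "a \<in> pos_cone A2" "vec.span A1 \<inter> vec.span A2 = vec.span {a}"
    "vec.dim A1 + card (enclosed I P N A1) = card A1" "vec.dim A2 + card (enclosed I P N A2) = card A2"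
proof -
  have A: "A = A1 \<union> A2" using split by (simp add: splitting_def)
  obtain a where a: "a \<in> pos_cone A1" "a \<in> pos_cone A2"
    "card I = card (enclosed I P N A1) + card (enclosed I P N A2) + vec.dim {a}"
    by (rule splitting_common_point[OF split])
  have sub: "vec.span {a} \<subseteq> vec.span A1 \<inter> vec.span A2"
    using a(1,2) pos_cone_in_span by (intro vec.span_minimal vec.subspace_inter vec.subspace_span) auto
  have "vec.dim (vec.span {a}) \<le> vec.dim (vec.span A1 \<inter> vec.span A2)" using sub by (rule vec.dim_subset)
  moreover have "vec.dim A1 + card (enclosed I P N A1) \<le> card A1"
    "vec.dim A2 + card (enclosed I P N A2) \<le> card A2"
    by (auto intro!: relation_system_dim_le relation_system_restrict simp: A)
  ultimately have eq: "vec.dim (vec.span {a}) = vec.dim (vec.span A1 \<inter> vec.span A2)"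
    "vec.dim A1 + card (enclosed I P N A1) = card A1" "vec.dim A2 + card (enclosed I P N A2) = card A2"
    using dim_Un_Int_span[of A1 A2] splitting_card_less(1)[OF split] tight a(3) A by simp_all
  have "vec.span {a} = vec.span A1 \<inter> vec.span A2"
    using sub eq(1) by (intro vec.subspace_dim_equal vec.subspace_inter vec.subspace_span) auto
  then show thesis using that a(1,2) eq(2,3) by simp
qed

theorem relation_system_bipyramid_bounded:
  assumes "relation_system A I P N" "vec.dim A + card I = card A" "vec.dim A \<ge> 2"
  shows "bipyramid_bounded (pos_cone A)"
  using assms
proof (induction "card A" arbitrary: A I rule: less_induct)
  case less
  interpret relation_system A I P N by fact
  have "card A \<ge> 2" using less.prems(3) vec.dim_le_card'[OF finite_A] by linarith
  then obtain A1 A2 where split: "splitting A I P N A1 A2"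
    using dominating_splitting[OF dominating_axioms] by blast
  then have A: "A = A1 \<union> A2" by (simp add: splitting_def)
  obtain a where a: "a \<in> pos_cone A1" "a \<in> pos_cone A2" "vec.span A1 \<inter> vec.span A2 = vec.span {a}"
    and tight: "vec.dim A1 + card (enclosed I P N A1) = card A1"
      "vec.dim A2 + card (enclosed I P N A2) = card A2"
    by (rule tight_splitting[OF split less.prems(2)])
  have parts: "relation_system A1 (enclosed I P N A1) P N" "relation_system A2 (enclosed I P N A2) P N"
    using A by (auto intro!: relation_system_restrict)
  have "bipyramid_bounded (pos_cone A1)" if "vec.dim A1 \<ge> 2"
    using less.hyps[OF _ parts(1) tight(1) that] splitting_card_less[OF split] by blast
  moreover have "bipyramid_bounded (pos_cone A2)" if "vec.dim A2 \<ge> 2"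
    using less.hyps[OF _ parts(2) tight(2) that] splitting_card_less[OF split] by blast
  moreover have "finite A1" "finite A2" using finite_A A by auto
  ultimately show ?case unfolding A
    using a splitting_card_less[OF split] pointed less.prems(3) A by (intro bipyramid_bounded_Un) auto
qed

section \<open>Toric ideals\<close>

abbreviation lookup :: "('a \<Rightarrow>\<^sub>0 'b::zero) \<Rightarrow> 'a \<Rightarrow> 'b" where "lookup \<equiv> Poly_Mapping.lookup"
abbreviation keys :: "('a \<Rightarrow>\<^sub>0 'b::zero) \<Rightarrow> 'a set" where "keys \<equiv> Poly_Mapping.keys"
abbreviation single :: "'a \<Rightarrow> 'b::zero \<Rightarrow> 'a \<Rightarrow>\<^sub>0 'b" where "single \<equiv> Poly_Mapping.single"

type_synonym 'n exponent = "(int ^ 'n) \<Rightarrow>\<^sub>0 nat"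

lemma lat_deg_superset:
  assumes "finite S" "keys e \<subseteq> S"
  shows "lat_deg e = (\<Sum>a\<in>S. int (lookup e a) *s a)"
  unfolding lat_deg_def using assms by (intro sum.mono_neutral_cong_left) (auto simp: in_keys_iff)

lemma lat_deg_add: "lat_deg (e + f) = lat_deg e + lat_deg f"
proof -
  have expand: "lat_deg g = (\<Sum>a\<in>keys e \<union> keys f. int (lookup g a) *s a)"
    if "keys g \<subseteq> keys e \<union> keys f" for g
    using that by (intro lat_deg_superset) auto
  show ?thesis using keys_add[of e f]
    by (simp add: expand lookup_add vector_sadd_rdistrib sum.distrib)
qed

lemma lat_deg_0 [simp]: "lat_deg 0 = 0"
  by (simp add: lat_deg_def)

lemma lat_deg_single: "lat_deg (single a k) = int k *s a"
  by (simp add: lat_deg_def)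

lemma rat_of_lat_simps:
  "rat_of_lat (a + b) = rat_of_lat a + rat_of_lat b"
  "rat_of_lat (k *s a) = of_int k *s rat_of_lat a"
  "rat_of_lat 0 = 0"
  by (simp_all add: rat_of_lat_def vec_eq_iff)

lemma rat_of_lat_eq_iff: "rat_of_lat a = rat_of_lat b \<longleftrightarrow> a = b"
  by (simp add: rat_of_lat_def vec_eq_iff)

lemma inj_on_rat_of_lat: "inj_on rat_of_lat S"
  by (simp add: inj_on_def rat_of_lat_eq_iff)

lemma rat_of_lat_sum: "rat_of_lat (\<Sum>i\<in>S. f i) = (\<Sum>i\<in>S. rat_of_lat (f i))"
  by (induction S rule: infinite_finite_induct) (auto simp: rat_of_lat_simps)

lemma rat_of_lat_lat_deg:
  "finite S \<Longrightarrow> keys e \<subseteq> S \<Longrightarrow> rat_of_lat (lat_deg e) = (\<Sum>a\<in>S. of_nat (lookup e a) *s rat_of_lat a)"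
  by (simp add: lat_deg_superset rat_of_lat_sum rat_of_lat_simps)

lemma qdot_lat_deg:
  "finite S \<Longrightarrow> keys e \<subseteq> S \<Longrightarrow>
    qdot c (rat_of_lat (lat_deg e)) = (\<Sum>a\<in>S. of_nat (lookup e a) * qdot c (rat_of_lat a))"
  by (simp add: rat_of_lat_lat_deg qdot_sum qdot_simps)

definition monomial_on :: "'a set \<Rightarrow> ('a \<Rightarrow> nat) \<Rightarrow> ('a \<Rightarrow>\<^sub>0 nat)" where
  "monomial_on B g = (\<Sum>b\<in>B. single b (g b))"

lemma lookup_monomial_on: "finite B \<Longrightarrow> lookup (monomial_on B g) a = (if a \<in> B then g a else 0)"
  by (simp add: monomial_on_def lookup_sum lookup_single when_def)

lemma keys_monomial_on: "finite B \<Longrightarrow> keys (monomial_on B g) \<subseteq> B"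
  by (auto simp: in_keys_iff lookup_monomial_on split: if_splits)

lemma lat_deg_monomial_on: "finite B \<Longrightarrow> lat_deg (monomial_on B g) = (\<Sum>b\<in>B. int (g b) *s b)"
  using lat_deg_superset[OF _ keys_monomial_on, of B g] by (simp add: lookup_monomial_on)

lemma rational_lattice_basis:
  fixes A :: "(int ^ 'n) set"
  obtains B where "B \<subseteq> A" "finite B" "card B = vec.dim (rat_of_lat ` A)"
    "vec.independent (rat_of_lat ` B)" "rat_of_lat ` A \<subseteq> vec.span (rat_of_lat ` B)"
proof -
  obtain C where C: "C \<subseteq> rat_of_lat ` A" "vec.independent C" "rat_of_lat ` A \<subseteq> vec.span C"
    "card C = vec.dim (rat_of_lat ` A)" using vec.basis_exists by metis
  then obtain B where B: "B \<subseteq> A" "C = rat_of_lat ` B" by (meson subset_image_iff)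
  moreover have "finite B"
    using vec.finiteI_independent[OF C(2)] B(2) inj_on_rat_of_lat finite_imageD by blast
  moreover have "card B = card C" unfolding B(2) by (rule card_image[OF inj_on_rat_of_lat, symmetric])
  ultimately show thesis using that C by simp
qed

lemma inj_on_lat_deg_independent:
  assumes "vec.independent (rat_of_lat ` B)" "finite B"
  shows "inj_on lat_deg {e. keys e \<subseteq> B}"
proof (rule inj_onI, rule poly_mapping_eqI)
  fix e f b assume ef: "e \<in> {e. keys e \<subseteq> B}" "f \<in> {e. keys e \<subseteq> B}" "lat_deg e = lat_deg f"
  show "lookup e b = lookup f b"
  proof (cases "b \<in> B")
    case True
    obtain c where "\<And>v. v \<in> rat_of_lat ` B \<Longrightarrow> qdot c v = of_bool (v = rat_of_lat b)"
      by (rule qdot_independent_extend[OF assms(1)]) (rule that)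
    then have c: "qdot c (rat_of_lat a) = of_bool (a = b)" if "a \<in> B" for a
      using that by (simp add: rat_of_lat_eq_iff)
    have "qdot c (rat_of_lat (lat_deg g)) = of_nat (lookup g b)" if "keys g \<subseteq> B" for g
      using qdot_lat_deg[OF assms(2) that, of c] c True assms(2) by simp
    then have "(of_nat (lookup e b) :: rat) = of_nat (lookup f b)" using ef by (metis mem_Collect_eq)
    then show ?thesis by simp
  next
    case False
    then have "b \<notin> keys e" "b \<notin> keys f" using ef by auto
    then show ?thesis by (simp add: in_keys_iff)
  qed
qed

lemma poly_mapping_sum_single: "p = (\<Sum>e\<in>keys p. single e (lookup p e))"
  by (rule poly_mapping_eqI) (auto simp: lookup_sum lookup_single when_def in_keys_iff sum.delta)

lemma poly_mapping_mult_eq_sum: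
  fixes p q :: "('e::comm_monoid_add \<Rightarrow>\<^sub>0 'k::comm_ring_1)"
  shows "p * q = (\<Sum>g\<in>keys p. \<Sum>e\<in>keys q. single (g + e) (lookup p g * lookup q e))"
proof -
  have "p * q = (\<Sum>g\<in>keys p. single g (lookup p g)) * (\<Sum>e\<in>keys q. single e (lookup q e))"
    using poly_mapping_sum_single[of p] poly_mapping_sum_single[of q] by simp
  then show ?thesis by (simp add: sum_product mult_single)
qed

lemma lookup_const_mult:
  fixes p :: "'e::comm_monoid_add \<Rightarrow>\<^sub>0 'k::comm_ring_1"
  shows "lookup (single 0 d * p) e = d * lookup p e"
proof -
  have "single 0 d * p = Poly_Mapping.map ((*) d) p" by (simp add: mult_map_scale_conv_mult)
  then show ?thesis by (simp add: Poly_Mapping.map.rep_eq when_def)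
qed

lemma poly_ring_0 [simp]: "0 \<in> poly_ring K A"
  by (simp add: poly_ring_def)

lemma poly_ring_single [simp]: "keys e \<subseteq> A \<Longrightarrow> single e c \<in> poly_ring K A"
  by (simp add: poly_ring_def)

lemma poly_ring_1 [simp]: "1 \<in> poly_ring K A"
  by (simp add: poly_ring_def)

lemma poly_ring_add: "p \<in> poly_ring K A \<Longrightarrow> q \<in> poly_ring K A \<Longrightarrow> p + q \<in> poly_ring K A"
  using keys_add[of p q] by (auto simp: poly_ring_def)

lemma poly_ring_uminus: "p \<in> poly_ring K A \<Longrightarrow> - p \<in> poly_ring K A"
  by (auto simp: poly_ring_def in_keys_iff)

lemma poly_ring_mult:
  assumes "p \<in> poly_ring K A" "q \<in> poly_ring K A" shows "p * q \<in> poly_ring K A"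
proof -
  have "keys e \<subseteq> A" if e: "e \<in> keys (p * q)" for e
  proof -
    obtain g f where "e = g + f" "g \<in> keys p" "f \<in> keys q" using e keys_mult[of p q] by blast
    then show ?thesis using assms keys_add[of g f] unfolding poly_ring_def by blast
  qed
  then show ?thesis by (simp add: poly_ring_def)
qed

lemma poly_ring_sum: "(\<And>i. i \<in> S \<Longrightarrow> f i \<in> poly_ring K A) \<Longrightarrow> (\<Sum>i\<in>S. f i) \<in> poly_ring K A"
  by (induction S rule: infinite_finite_induct) (auto intro: poly_ring_add)

lemma poly_ring_power: "p \<in> poly_ring K A \<Longrightarrow> p ^ n \<in> poly_ring K A"
  by (induction n) (auto intro: poly_ring_mult)

text \<open>Laurent monomials are encoded with exponents in \<open>nat \<Rightarrow>\<^sub>0 int\<close>, whose lexicographic order lets the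
  library recognize the target of \<open>toric_map\<close> as an integral domain.\<close>

definition lex_vec :: "int ^ 'n \<Rightarrow> nat \<Rightarrow>\<^sub>0 int" where
  "lex_vec v = (\<Sum>i\<in>UNIV. single (to_nat_on UNIV i) (v $ i))"

lemma lookup_lex_vec:
  fixes v :: "int ^ 'n"
  shows "lookup (lex_vec v) (to_nat_on UNIV i) = v $ i"
proof -
  have "to_nat_on UNIV j = to_nat_on UNIV i \<longleftrightarrow> j = i" for j :: 'n by (simp add: countable_finite)
  then show ?thesis by (simp add: lex_vec_def lookup_sum lookup_single when_def)
qed

lemma lex_vec_eq_iff: "lex_vec u = lex_vec v \<longleftrightarrow> u = v"
  by (metis lookup_lex_vec vec_eq_iff)

lemma lex_vec_add: "lex_vec (u + v) = lex_vec u + lex_vec v"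
  by (simp add: lex_vec_def single_add sum.distrib)

definition toric_map :: "('k::field, 'n::finite) lpoly \<Rightarrow> (nat \<Rightarrow>\<^sub>0 int) \<Rightarrow>\<^sub>0 'k" where
  "toric_map p = (\<Sum>e\<in>keys p. single (lex_vec (lat_deg e)) (lookup p e))"

lemma toric_map_superset:
  "finite S \<Longrightarrow> keys p \<subseteq> S \<Longrightarrow> toric_map p = (\<Sum>e\<in>S. single (lex_vec (lat_deg e)) (lookup p e))"
  unfolding toric_map_def by (intro sum.mono_neutral_left) (auto simp: in_keys_iff)

lemma toric_map_add: "toric_map (p + q) = toric_map p + toric_map q"
proof -
  have expand: "toric_map g = (\<Sum>e\<in>keys p \<union> keys q. single (lex_vec (lat_deg e)) (lookup g e))"
    if "keys g \<subseteq> keys p \<union> keys q" for g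
    using that by (intro toric_map_superset) auto
  show ?thesis using keys_add[of p q] by (simp add: expand lookup_add single_add sum.distrib)
qed

lemma toric_map_0 [simp]: "toric_map 0 = 0"
  by (simp add: toric_map_def)

lemma toric_map_sum: "toric_map (\<Sum>i\<in>S. f i) = (\<Sum>i\<in>S. toric_map (f i))"
  by (induction S rule: infinite_finite_induct) (auto simp: toric_map_add)

lemma toric_map_single [simp]: "toric_map (single e c) = single (lex_vec (lat_deg e)) c"
  by (simp add: toric_map_def)

lemma toric_map_mult: "toric_map (p * q) = toric_map p * toric_map q"
  unfolding poly_mapping_mult_eq_sum[of p q] toric_map_sum
  by (simp add: toric_map_def[of p] toric_map_def[of q] sum_product mult_single lat_deg_add lex_vec_add)

lemma lookup_toric_map: "lookup (toric_map p) (lex_vec u) = toric_image_coeff p u"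
  unfolding toric_map_def toric_image_coeff_def lookup_sum
  by (intro sum.mono_neutral_cong_right) (auto simp: lookup_single when_def lex_vec_eq_iff)

lemma toric_map_eq_0_iff:
  fixes p :: "('k::field, 'n::finite) lpoly"
  shows "toric_map p = 0 \<longleftrightarrow> (\<forall>u. toric_image_coeff p u = 0)"
proof
  let ?image = "range (lex_vec :: int ^ 'n \<Rightarrow> _)"
  assume "\<forall>u. toric_image_coeff p u = 0"
  then have "lookup (toric_map p) m = 0" if "m \<in> ?image" for m
    using that by (auto simp: lookup_toric_map)
  moreover have "lookup (toric_map p) m = 0" if "m \<notin> ?image" for m
    using that unfolding toric_map_def lookup_sum
    by (intro sum.neutral) (auto simp: lookup_single when_def)
  ultimately show "toric_map p = 0" by (intro poly_mapping_eqI) auto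
qed (simp flip: lookup_toric_map)

lemma toric_ideal_iff: "p \<in> toric_ideal K A \<longleftrightarrow> p \<in> poly_ring K A \<and> toric_map p = 0"
  by (simp add: toric_ideal_def toric_map_eq_0_iff)

lemma ideal_in_toric_ideal: "ideal_in (poly_ring K A) (toric_ideal K A)"
  by (auto simp: ideal_in_def toric_ideal_iff toric_map_add toric_map_mult
      intro: poly_ring_add poly_ring_mult)

lemma prime_toric_ideal:
  fixes K :: "'k::field itself" and A :: "(int ^ 'n) set"
  shows "prime_ideal_in (poly_ring K A) (toric_ideal K A)"
proof -
  have "toric_map (1 :: ('k, 'n) lpoly) \<noteq> 0"
    unfolding single_one[symmetric] toric_map_single by (simp flip: keys_eq_empty)
  then have "1 \<notin> toric_ideal K A" by (simp add: toric_ideal_iff)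
  then have "toric_ideal K A \<noteq> poly_ring K A" using poly_ring_1[of K A] by blast
  moreover have "x \<in> toric_ideal K A \<or> y \<in> toric_ideal K A"
    if "x \<in> poly_ring K A" "y \<in> poly_ring K A" "x * y \<in> toric_ideal K A" for x y
    using that by (auto simp: toric_ideal_iff toric_map_mult)
  ultimately show ?thesis unfolding prime_ideal_in_def using ideal_in_toric_ideal by blast
qed

lemma ideal_in_add: "ideal_in R J \<Longrightarrow> x \<in> J \<Longrightarrow> y \<in> J \<Longrightarrow> x + y \<in> J"
  and ideal_in_mult: "ideal_in R J \<Longrightarrow> r \<in> R \<Longrightarrow> x \<in> J \<Longrightarrow> r * x \<in> J"
  by (auto simp: ideal_in_def)

lemma ideal_in_uminus: "ideal_in (poly_ring K A) J \<Longrightarrow> x \<in> J \<Longrightarrow> - x \<in> J"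
  using ideal_in_mult[of "poly_ring K A" J "- 1" x] poly_ring_uminus[OF poly_ring_1, of K A] by simp

lemma ideal_in_sum:
  assumes "ideal_in R J" "\<And>i. i \<in> S \<Longrightarrow> f i \<in> J"
  shows "(\<Sum>i\<in>S. f i) \<in> J"
  using assms(2)
  by (induction S rule: infinite_finite_induct) (use assms(1) in \<open>auto simp: ideal_in_def\<close>)

lemma generated_ideal_in_base:
  assumes "finite G" "g \<in> G" shows "g \<in> generated_ideal_in (poly_ring K A) G"
proof -
  have "(\<Sum>x\<in>G. of_bool (x = g) * x) = (\<Sum>x\<in>G. if x = g then x else 0)" by (intro sum.cong) auto
  then have "g = (\<Sum>x\<in>G. of_bool (x = g) * x)" using assms by simp
  then show ?thesis unfolding generated_ideal_in_def
    by (intro CollectI exI[of _ "\<lambda>x. of_bool (x = g)"]) (auto simp: of_bool_def)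
qed

lemma ideal_in_generated_ideal_in:
  assumes "G \<subseteq> poly_ring K A"
  shows "ideal_in (poly_ring K A) (generated_ideal_in (poly_ring K A) G)"
  unfolding ideal_in_def
proof (intro conjI ballI)
  let ?R = "poly_ring K A"
  show "generated_ideal_in ?R G \<subseteq> ?R"
    using assms by (auto simp: generated_ideal_in_def intro!: poly_ring_sum poly_ring_mult)
  show "0 \<in> generated_ideal_in ?R G" unfolding generated_ideal_in_def
    by (intro CollectI exI[of _ "\<lambda>_. 0"]) auto
  fix x assume "x \<in> generated_ideal_in ?R G"
  then obtain h where h: "x = (\<Sum>g\<in>G. h g * g)" "\<forall>g\<in>G. h g \<in> ?R" by (auto simp: generated_ideal_in_def)
  show "x + y \<in> generated_ideal_in ?R G" if y: "y \<in> generated_ideal_in ?R G" for y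
  proof -
    obtain k where "y = (\<Sum>g\<in>G. k g * g)" "\<forall>g\<in>G. k g \<in> ?R" using y by (auto simp: generated_ideal_in_def)
    then show ?thesis unfolding generated_ideal_in_def using h
      by (intro CollectI exI[of _ "\<lambda>g. h g + k g"])
         (auto simp: distrib_right sum.distrib intro: poly_ring_add)
  qed
  show "r * x \<in> generated_ideal_in ?R G" if "r \<in> ?R" for r
    unfolding generated_ideal_in_def using h that
    by (intro CollectI exI[of _ "\<lambda>g. r * h g"])
       (auto simp: sum_distrib_left mult.assoc intro: poly_ring_mult)
qed

lemma generated_ideal_in_minimal:
  "ideal_in R J \<Longrightarrow> G \<subseteq> J \<Longrightarrow> generated_ideal_in R G \<subseteq> J"
  by (auto simp: generated_ideal_in_def intro!: ideal_in_sum ideal_in_mult)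

section \<open>The height of a toric ideal\<close>

definition exponent_box :: "'a set \<Rightarrow> nat \<Rightarrow> ('a \<Rightarrow>\<^sub>0 nat) set" where
  "exponent_box A D = {e. keys e \<subseteq> A \<and> (\<forall>a. lookup e a \<le> D)}"

lemma exponent_box_bij_betw:
  assumes "finite A"
  shows "bij_betw (\<lambda>e. restrict (lookup e) A) (exponent_box A D) (\<Pi>\<^sub>E a\<in>A. {..D})"
proof (rule bij_betwI')
  fix e f assume ef: "e \<in> exponent_box A D" "f \<in> exponent_box A D"
  show "restrict (lookup e) A = restrict (lookup f) A \<longleftrightarrow> e = f"
  proof
    assume eq: "restrict (lookup e) A = restrict (lookup f) A"
    have "lookup e a = lookup f a" for a
    proof (cases "a \<in> A")
      case True
      then show ?thesis using fun_cong[OF eq, of a] by simp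
    next
      case False
      then have "a \<notin> keys e" "a \<notin> keys f" using ef by (auto simp: exponent_box_def)
      then show ?thesis by (simp add: in_keys_iff)
    qed
    then show "e = f" by (rule poly_mapping_eqI)
  qed simp
next
  fix g assume g: "g \<in> (\<Pi>\<^sub>E a\<in>A. {..D})"
  have "monomial_on A g \<in> exponent_box A D"
    using g assms keys_monomial_on[OF assms] by (auto simp: exponent_box_def lookup_monomial_on PiE_iff)
  moreover have "g = restrict (lookup (monomial_on A g)) A"
    using g assms by (intro ext) (auto simp: lookup_monomial_on PiE_iff extensional_def)
  ultimately show "\<exists>e\<in>exponent_box A D. g = restrict (lookup e) A" by blast
qed (auto simp: exponent_box_def)

lemma finite_exponent_box: "finite A \<Longrightarrow> finite (exponent_box A D)"
  using bij_betw_finite[OF exponent_box_bij_betw, of A D] by (simp add: finite_PiE)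

lemma card_exponent_box: "finite A \<Longrightarrow> card (exponent_box A D) = Suc D ^ card A"
  using bij_betw_same_card[OF exponent_box_bij_betw, of A D] by (simp add: card_PiE)

lemma exponent_box_mono: "A \<subseteq> B \<Longrightarrow> D \<le> E \<Longrightarrow> exponent_box A D \<subseteq> exponent_box B E"
  unfolding exponent_box_def by (auto intro: order_trans)

lemma keys_mult_exponent_box:
  assumes "keys p \<subseteq> exponent_box A D" "keys q \<subseteq> exponent_box A E"
  shows "keys (p * q) \<subseteq> exponent_box A (D + E)"
proof
  fix e assume "e \<in> keys (p * q)"
  then obtain g f where e: "e = g + f" "g \<in> keys p" "f \<in> keys q" using keys_mult[of p q] by blast
  then have "g \<in> exponent_box A D" "f \<in> exponent_box A E" using assms by auto
  then show "e \<in> exponent_box A (D + E)"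
    using keys_add[of g f] unfolding e(1) exponent_box_def by (auto simp: lookup_add add_mono)
qed

lemma keys_power_exponent_box:
  "keys p \<subseteq> exponent_box A D \<Longrightarrow> keys (p ^ n) \<subseteq> exponent_box A (n * D)"
proof (induction n)
  case 0
  then show ?case by (simp add: exponent_box_def)
next
  case (Suc n)
  then show ?case using keys_mult_exponent_box[of p A D "p ^ n" "n * D"] by simp
qed

lemma poly_ring_exponent_box:
  assumes "p \<in> poly_ring K A" obtains D where "keys p \<subseteq> exponent_box A D"
proof -
  let ?values = "insert 0 (\<Union>e\<in>keys p. lookup e ` keys e)"
  have "lookup e a \<in> ?values" if "e \<in> keys p" for e a
  proof (cases "a \<in> keys e")
    case False
    then show ?thesis by (simp add: in_keys_iff)
  qed (use that in blast)
  then have "lookup e a \<le> Max ?values" if "e \<in> keys p" for e a using that by (intro Max_ge) auto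
  then have "keys p \<subseteq> exponent_box A (Max ?values)"
    using assms by (auto simp: exponent_box_def poly_ring_def)
  then show thesis by (rule that)
qed

lemma exponent_box_poly_ring: "keys p \<subseteq> exponent_box A D \<Longrightarrow> p \<in> poly_ring K A"
  by (auto simp: poly_ring_def exponent_box_def)

definition indep_mod ::
    "('e::comm_monoid_add \<Rightarrow>\<^sub>0 'k::comm_ring_1) set \<Rightarrow> 's set \<Rightarrow> ('s \<Rightarrow> 'e \<Rightarrow>\<^sub>0 'k) \<Rightarrow> bool" where
  "indep_mod P S v \<longleftrightarrow> (\<forall>c. (\<Sum>s\<in>S. single 0 (c s) * v s) \<in> P \<longrightarrow> (\<forall>s\<in>S. c s = 0))"

lemma indep_modD:
  "indep_mod P S v \<Longrightarrow> (\<Sum>s\<in>S. single 0 (c s) * v s) \<in> P \<Longrightarrow> s \<in> S \<Longrightarrow> c s = 0"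
  unfolding indep_mod_def by blast

lemma indep_mod_reindex:
  assumes "bij_betw h T S" "indep_mod P S v" shows "indep_mod P T (\<lambda>t. v (h t))"
  unfolding indep_mod_def
proof (intro allI impI)
  fix c assume "(\<Sum>t\<in>T. single 0 (c t) * v (h t)) \<in> P"
  moreover have inv: "the_inv_into T h (h t) = t" if "t \<in> T" for t
    using assms(1) that by (simp add: bij_betw_def the_inv_into_f_f)
  ultimately have "(\<Sum>s\<in>S. single 0 (c (the_inv_into T h s)) * v s) \<in> P"
    using sum.reindex_bij_betw[OF assms(1), of "\<lambda>s. single 0 (c (the_inv_into T h s)) * v s"] by simp
  then have "\<forall>s\<in>S. c (the_inv_into T h s) = 0"
    using indep_modD[OF assms(2), of "\<lambda>s. c (the_inv_into T h s)"] by blast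
  then show "\<forall>t\<in>T. c t = 0" using inv assms(1) by (metis bij_betw_apply)
qed

lemma indep_mod_card_le:
  fixes v :: "'s \<Rightarrow> ('k::field, 'n::finite) lpoly"
  assumes A: "finite A" and S: "finite S" and ind: "indep_mod P S v" and "0 \<in> P"
    and v: "\<And>s. s \<in> S \<Longrightarrow> keys (v s) \<subseteq> exponent_box A D"
  shows "card S \<le> Suc D ^ card A"
proof (rule ccontr)
  assume "\<not> ?thesis"
  then have "card (exponent_box A D) < card S" by (simp add: card_exponent_box A)
  then obtain c where c: "\<exists>s\<in>S. c s \<noteq> 0" "\<And>e. e \<in> exponent_box A D \<Longrightarrow> (\<Sum>s\<in>S. c s * lookup (v s) e) = 0"
    by (rule homogeneous_system_nontrivial[OF finite_exponent_box[OF A] S,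
          where a = "\<lambda>s e. lookup (v s) e"]) (rule that)
  have "(\<Sum>s\<in>S. c s * lookup (v s) e) = 0" for e
  proof (cases "e \<in> exponent_box A D")
    case False
    then have "lookup (v s) e = 0" if "s \<in> S" for s using v[OF that] by (auto simp: in_keys_iff)
    then show ?thesis by simp
  qed (rule c(2))
  then have "(\<Sum>s\<in>S. single 0 (c s) * v s) = 0"
    by (intro poly_mapping_eqI) (simp add: lookup_sum lookup_const_mult)
  then show False using ind \<open>0 \<in> P\<close> c(1) by (auto simp: indep_mod_def)
qed

lemma prime_ideal_power_sum:
  fixes K :: "'k::field itself"
  assumes P: "prime_ideal_in (poly_ring K A) P" and Q: "ideal_in (poly_ring K A) Q"
    and PQ: "P \<subseteq> Q" and f: "f \<in> Q" "f \<notin> P"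
    and T: "\<And>l. T l \<in> poly_ring K A" "\<And>l. T l \<in> Q \<Longrightarrow> T l = 0"
    and sum: "(\<Sum>l<t. f ^ l * T l) \<in> P" and "l < t"
  shows "T l = 0"
  using T sum \<open>l < t\<close>
proof (induction t arbitrary: T l)
  case (Suc t)
  let ?rest = "\<Sum>l<t. f ^ l * T (Suc l)"
  have R: "f \<in> poly_ring K A" "?rest \<in> poly_ring K A"
    using f(1) Q Suc.prems(1)
    by (auto simp: ideal_in_def intro!: poly_ring_sum poly_ring_mult poly_ring_power)
  have decomp: "(\<Sum>l<Suc t. f ^ l * T l) = T 0 + f * ?rest"
    unfolding sum.lessThan_Suc_shift by (simp add: sum_distrib_left mult.assoc)
  have "f * ?rest \<in> Q" using ideal_in_mult[OF Q R(2) f(1)] by (simp add: mult.commute)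
  moreover have "T 0 + f * ?rest \<in> Q" using Suc.prems(3) PQ unfolding decomp by blast
  ultimately have "T 0 + f * ?rest + - (f * ?rest) \<in> Q"
    using ideal_in_add[OF Q] ideal_in_uminus[OF Q] by blast
  then have T0: "T 0 = 0" using Suc.prems(2) by simp
  then have "f * ?rest \<in> P" using Suc.prems(3) unfolding decomp by simp
  then have "?rest \<in> P" using P R f(2) unfolding prime_ideal_in_def by blast
  then have "T (Suc l) = 0" if "l < t" for l using Suc.IH[of "\<lambda>l. T (Suc l)"] Suc.prems(1,2) that by blast
  then show ?case using T0 Suc.prems(4) by (cases l) auto
qed simp

lemma indep_mod_times_powers:
  fixes K :: "'k::field itself"
  assumes P: "prime_ideal_in (poly_ring K A) P" and Q: "ideal_in (poly_ring K A) Q"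
    and PQ: "P \<subseteq> Q" and f: "f \<in> Q" "f \<notin> P"
    and v: "\<And>s. s \<in> S \<Longrightarrow> v s \<in> poly_ring K A" and ind: "indep_mod Q S v"
  shows "indep_mod P ({..<t} \<times> S) (\<lambda>(l, s). f ^ l * v s)"
  unfolding indep_mod_def
proof (intro allI impI)
  fix c :: "nat \<times> _ \<Rightarrow> 'k"
  define T where "T l = (\<Sum>s\<in>S. single 0 (c (l, s)) * v s)" for l
  have coeffs: "\<forall>s\<in>S. c (l, s) = 0" if "T l \<in> Q" for l
    using indep_modD[OF ind, of "\<lambda>s. c (l, s)"] that unfolding T_def by blast
  assume "(\<Sum>x\<in>{..<t} \<times> S. single 0 (c x) * (case x of (l, s) \<Rightarrow> f ^ l * v s)) \<in> P"
  moreover have "(\<Sum>x\<in>{..<t} \<times> S. single 0 (c x) * (case x of (l, s) \<Rightarrow> f ^ l * v s)) = (\<Sum>l<t. f ^ l * T l)"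
    by (simp add: T_def sum.cartesian_product' sum_distrib_left mult.left_commute)
  ultimately have sum: "(\<Sum>l<t. f ^ l * T l) \<in> P" by simp
  have R: "T l \<in> poly_ring K A" for l
    unfolding T_def using v by (intro poly_ring_sum poly_ring_mult poly_ring_single) auto
  have "T l = 0" if "T l \<in> Q" for l
    unfolding T_def by (intro sum.neutral) (simp add: coeffs[OF that])
  then have "T l = 0" if "l < t" for l by (rule prime_ideal_power_sum[OF P Q PQ f R _ sum that])
  then have "T l \<in> Q" if "l < t" for l using that Q by (simp add: ideal_in_def)
  then show "\<forall>x\<in>{..<t} \<times> S. c x = 0" using coeffs by auto
qed

definition growth_at_least :: "(int ^ 'n) set \<Rightarrow> ('k::field, 'n::finite) lpoly set \<Rightarrow> nat \<Rightarrow> bool" where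
  "growth_at_least A P k \<longleftrightarrow> (\<exists>D. \<forall>t\<ge>1. \<exists>v.
    (\<forall>s<t ^ k. keys (v s) \<subseteq> exponent_box A (D * t)) \<and> indep_mod P {..<t ^ k} v)"

lemma growth_at_leastI:
  assumes "\<And>t. t \<ge> 1 \<Longrightarrow> finite (S t) \<and> card (S t) = t ^ k"
    and "\<And>t s. t \<ge> 1 \<Longrightarrow> s \<in> S t \<Longrightarrow> keys (v t s) \<subseteq> exponent_box A (D * t)"
    and "\<And>t. t \<ge> 1 \<Longrightarrow> indep_mod P (S t) (v t)"
  shows "growth_at_least A P k"
  unfolding growth_at_least_def
proof (intro exI[of _ D] allI impI)
  fix t :: nat assume t: "t \<ge> 1"
  then obtain h where h: "bij_betw h {..<t ^ k} (S t)"
    using ex_bij_betw_nat_finite[of "S t"] assms(1)[OF t] by (auto simp: atLeast0LessThan)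
  then show "\<exists>v. (\<forall>s<t ^ k. keys (v s) \<subseteq> exponent_box A (D * t)) \<and> indep_mod P {..<t ^ k} v"
    using indep_mod_reindex[OF h assms(3)[OF t]] assms(2)[OF t] bij_betw_apply[OF h]
    by (intro exI[of _ "\<lambda>s. v t (h s)"]) auto
qed

lemma growth_toric_ideal:
  fixes K :: "'k::field itself" and A :: "(int ^ 'n) set"
  shows "growth_at_least A (toric_ideal K A) (vec.dim (rat_of_lat ` A))"
proof -
  obtain B where B: "B \<subseteq> A" "finite B" "card B = vec.dim (rat_of_lat ` A)"
    "vec.independent (rat_of_lat ` B)"
    by (rule rational_lattice_basis[of A])
  let ?v = "\<lambda>(t::nat) e. single e (1::'k)"
  have "indep_mod (toric_ideal K A) (exponent_box B (t - 1)) (?v t)" for t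
    unfolding indep_mod_def
  proof (intro allI impI ballI)
    let ?E = "exponent_box B (t - 1)"
    fix c e assume sum: "(\<Sum>s\<in>?E. single 0 (c s) * single s 1) \<in> toric_ideal K A" and e: "e \<in> ?E"
    have "inj_on lat_deg ?E"
      by (rule inj_on_subset[OF inj_on_lat_deg_independent[OF B(4,2)]]) (auto simp: exponent_box_def)
    then have eq: "lat_deg s = lat_deg e \<longleftrightarrow> s = e" if "s \<in> ?E" for s using that e by (auto dest: inj_onD)
    have "0 = lookup (toric_map (\<Sum>s\<in>?E. single 0 (c s) * single s 1)) (lex_vec (lat_deg e))"
      using sum by (simp add: toric_ideal_iff)
    also have "\<dots> = (\<Sum>s\<in>?E. if s = e then c s else 0)"
      unfolding toric_map_sum lookup_sum
      by (intro sum.cong) (auto simp: mult_single lookup_single when_def lex_vec_eq_iff eq)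
    finally show "c e = 0" using e finite_exponent_box[OF B(2)] by simp
  qed
  moreover have "finite (exponent_box B (t - 1)) \<and> card (exponent_box B (t - 1)) = t ^ card B"
    if "t \<ge> 1" for t
    using that B(2) by (simp add: finite_exponent_box card_exponent_box)
  moreover have "keys (?v t e) \<subseteq> exponent_box A (1 * t)" if "e \<in> exponent_box B (t - 1)" for t e
    using that exponent_box_mono[OF B(1), of "t - 1" t] by auto
  ultimately show ?thesis
    unfolding B(3)[symmetric] by (intro growth_at_leastI[of "\<lambda>t. exponent_box B (t - 1)"]) blast+
qed

lemma growth_Suc_prime:
  fixes K :: "'k::field itself"
  assumes P: "prime_ideal_in (poly_ring K A) P" and Q: "prime_ideal_in (poly_ring K A) Q"
    and PQ: "P \<subset> Q" and growth: "growth_at_least A Q k"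
  shows "growth_at_least A P (Suc k)"
proof -
  have Q': "ideal_in (poly_ring K A) Q" using Q by (simp add: prime_ideal_in_def)
  obtain f where f: "f \<in> Q" "f \<notin> P" using PQ by blast
  then have "f \<in> poly_ring K A" using Q' by (auto simp: ideal_in_def)
  then obtain E where E: "keys f \<subseteq> exponent_box A E" by (rule poly_ring_exponent_box)
  obtain D v where v: "\<And>t s. t \<ge> 1 \<Longrightarrow> s < t ^ k \<Longrightarrow> keys (v t s) \<subseteq> exponent_box A (D * t)"
    "\<And>t. t \<ge> 1 \<Longrightarrow> indep_mod Q {..<t ^ k} (v t)"
    using growth unfolding growth_at_least_def by metis
  show ?thesis
  proof (rule growth_at_leastI[where S = "\<lambda>t. {..<t} \<times> {..<t ^ k}" and D = "E + D"])
    fix t :: nat assume t: "t \<ge> 1"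
    show "finite ({..<t} \<times> {..<t ^ k}) \<and> card ({..<t} \<times> {..<t ^ k}) = t ^ Suc k" by simp
    show "indep_mod P ({..<t} \<times> {..<t ^ k}) (\<lambda>(l, s). f ^ l * v t s)"
      using exponent_box_poly_ring[OF v(1)[OF t]]
      by (intro indep_mod_times_powers[OF P Q' psubset_imp_subset[OF PQ] f _ v(2)[OF t]]) simp
    fix x assume "x \<in> {..<t} \<times> {..<t ^ k}"
    then obtain l s where x: "x = (l, s)" "l < t" "s < t ^ k" by blast
    have "keys (f ^ l) \<subseteq> exponent_box A (t * E)"
      using keys_power_exponent_box[OF E, of l] exponent_box_mono[OF order_refl, of "l * E" "t * E" A] x(2)
      by auto
    then have "keys (f ^ l * v t s) \<subseteq> exponent_box A (t * E + D * t)"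
      using v(1)[OF t x(3)] by (rule keys_mult_exponent_box)
    then show "keys (case x of (l, s) \<Rightarrow> f ^ l * v t s) \<subseteq> exponent_box A ((E + D) * t)"
      by (simp add: x(1) algebra_simps)
  qed
qed

lemma power_le_power_mult_imp_le:
  fixes a m C :: nat
  assumes "\<And>t. t \<ge> 1 \<Longrightarrow> t ^ a \<le> (C * t) ^ m"
  shows "a \<le> m"
proof (rule ccontr)
  assume "\<not> a \<le> m"
  then have a: "a = m + Suc (a - Suc m)" by simp
  define t where "t = C ^ m + 1"
  have "t \<ge> 1" by (simp add: t_def)
  then have "t ^ m * t \<le> t ^ m * (t * t ^ (a - Suc m))" by simp
  also have "\<dots> = t ^ a" by (subst a) (simp add: power_add)
  also have "\<dots> \<le> (C * t) ^ m" by (rule assms[OF \<open>t \<ge> 1\<close>])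
  also have "\<dots> = t ^ m * C ^ m" by (simp add: power_mult_distrib)
  finally have "t \<le> C ^ m" using \<open>t \<ge> 1\<close> by simp
  then show False by (simp add: t_def)
qed

lemma growth_le_card:
  assumes A: "finite A" and "0 \<in> P" and "growth_at_least A P k"
  shows "k \<le> card A"
proof -
  obtain D v where v: "\<And>t s. t \<ge> 1 \<Longrightarrow> s < t ^ k \<Longrightarrow> keys (v t s) \<subseteq> exponent_box A (D * t)"
    "\<And>t. t \<ge> 1 \<Longrightarrow> indep_mod P {..<t ^ k} (v t)"
    using assms(3) unfolding growth_at_least_def by metis
  show ?thesis
  proof (rule power_le_power_mult_imp_le[of _ "D + 1"])
    fix t :: nat assume t: "t \<ge> 1"
    have "card {..<t ^ k} \<le> Suc (D * t) ^ card A"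
      by (rule indep_mod_card_le[OF A _ v(2)[OF t] \<open>0 \<in> P\<close>]) (use v(1)[OF t] in auto)
    also have "\<dots> \<le> ((D + 1) * t) ^ card A" using t by (intro power_mono) auto
    finally show "t ^ k \<le> ((D + 1) * t) ^ card A" by simp
  qed
qed

lemma prime_chain_length_le:
  fixes K :: "'k::field itself" and A :: "(int ^ 'n) set"
  assumes A: "finite A" and prime: "\<And>i. i \<le> n \<Longrightarrow> prime_ideal_in (poly_ring K A) (c i)"
    and strict: "\<And>i. i < n \<Longrightarrow> c i \<subset> c (Suc i)" and last: "c n = toric_ideal K A"
  shows "n + vec.dim (rat_of_lat ` A) \<le> card A"
proof -
  have "growth_at_least A (c (n - j)) (j + vec.dim (rat_of_lat ` A))" if "j \<le> n" for j
    using that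
  proof (induction j)
    case 0
    show ?case using growth_toric_ideal by (simp add: last)
  next
    case (Suc j)
    then have "Suc (n - Suc j) = n - j" by simp
    then have "c (n - Suc j) \<subset> c (n - j)" using strict[of "n - Suc j"] Suc.prems by simp
    moreover have "growth_at_least A (c (n - j)) (j + vec.dim (rat_of_lat ` A))" using Suc by simp
    ultimately have "growth_at_least A (c (n - Suc j)) (Suc (j + vec.dim (rat_of_lat ` A)))"
      by (rule growth_Suc_prime[OF prime prime, rotated 2]) simp_all
    then show ?case by simp
  qed
  from this[of n] have "growth_at_least A (c 0) (n + vec.dim (rat_of_lat ` A))" by simp
  moreover have "0 \<in> c 0" using prime[of 0] by (auto simp: prime_ideal_in_def ideal_in_def)
  ultimately show ?thesis using growth_le_card[OF A] by blast
qed

theorem height_toric_ideal_le: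
  fixes K :: "'k::field itself" and A :: "(int ^ 'n) set"
  assumes "finite A"
  shows "ideal_height (poly_ring K A) (toric_ideal K A) \<le> enat (card A - vec.dim (rat_of_lat ` A))"
proof -
  have "ideal_height (poly_ring K A) (toric_ideal K A) \<le> prime_height (poly_ring K A) (toric_ideal K A)"
    unfolding ideal_height_def using prime_toric_ideal by (intro INF_lower) auto
  also have "\<dots> \<le> enat (card A - vec.dim (rat_of_lat ` A))"
    unfolding prime_height_def
  proof (rule SUP_least)
    fix n assume "n \<in> {n. \<exists>c. (\<forall>i\<le>n. prime_ideal_in (poly_ring K A) (c i)) \<and>
        (\<forall>i<n. c i \<subset> c (Suc i)) \<and> c n = toric_ideal K A}"
    then have "n + vec.dim (rat_of_lat ` A) \<le> card A" using prime_chain_length_le[OF assms, of n K] by blast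
    then show "enat n \<le> enat (card A - vec.dim (rat_of_lat ` A))" by simp
  qed
  finally show ?thesis .
qed

section \<open>Functionals on polynomials\<close>

definition coeff_sum :: "('e \<Rightarrow> 'k) \<Rightarrow> ('e \<Rightarrow>\<^sub>0 'k) \<Rightarrow> 'k::comm_ring_1" where
  "coeff_sum \<phi> p = (\<Sum>e\<in>keys p. \<phi> e * lookup p e)"

lemma coeff_sum_superset:
  assumes "finite S" "keys p \<subseteq> S"
  shows "coeff_sum \<phi> p = (\<Sum>e\<in>S. \<phi> e * lookup p e)"
  unfolding coeff_sum_def using assms by (intro sum.mono_neutral_left) (auto simp: in_keys_iff)

lemma coeff_sum_add: "coeff_sum \<phi> (p + q) = coeff_sum \<phi> p + coeff_sum \<phi> q"
proof -
  have expand: "coeff_sum \<phi> g = (\<Sum>e\<in>keys p \<union> keys q. \<phi> e * lookup g e)"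
    if "keys g \<subseteq> keys p \<union> keys q" for g
    using that by (intro coeff_sum_superset) auto
  show ?thesis using keys_add[of p q] by (simp add: expand lookup_add distrib_left sum.distrib)
qed

lemma coeff_sum_0 [simp]: "coeff_sum \<phi> 0 = 0"
  by (simp add: coeff_sum_def)

lemma coeff_sum_sum: "coeff_sum \<phi> (\<Sum>i\<in>S. f i) = (\<Sum>i\<in>S. coeff_sum \<phi> (f i))"
  by (induction S rule: infinite_finite_induct) (auto simp: coeff_sum_add)

lemma coeff_sum_single [simp]: "coeff_sum \<phi> (single e c) = \<phi> e * c"
  by (simp add: coeff_sum_def)

lemma coeff_sum_mult:
  fixes p q :: "('e::comm_monoid_add \<Rightarrow>\<^sub>0 'k::comm_ring_1)"
  shows "coeff_sum \<phi> (p * q) = (\<Sum>g\<in>keys p. lookup p g * coeff_sum (\<lambda>e. \<phi> (g + e)) q)"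
  by (simp add: poly_mapping_mult_eq_sum[of p q] coeff_sum_sum)
     (simp add: coeff_sum_def sum_distrib_left algebra_simps)

lemma toric_ideal_coeff_sum_eq_0:
  assumes p: "p \<in> toric_ideal K A"
    and \<phi>: "\<And>e f. keys e \<subseteq> A \<Longrightarrow> keys f \<subseteq> A \<Longrightarrow> lat_deg e = lat_deg f \<Longrightarrow> \<phi> e = \<phi> f"
  shows "coeff_sum \<phi> p = 0"
proof -
  let ?of_degree = "\<lambda>u. {e \<in> keys p. lat_deg e = u}"
  have keys: "keys e \<subseteq> A" if "e \<in> keys p" for e using p that by (auto simp: toric_ideal_def poly_ring_def)
  have "coeff_sum \<phi> p = (\<Sum>u\<in>lat_deg ` keys p. \<Sum>e\<in>?of_degree u. \<phi> e * lookup p e)"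
    unfolding coeff_sum_def by (rule sum.image_gen) simp
  also have "\<dots> = 0"
  proof (rule sum.neutral, rule ballI)
    fix u assume "u \<in> lat_deg ` keys p"
    then obtain e0 where e0: "e0 \<in> keys p" "lat_deg e0 = u" by blast
    have "(\<Sum>e\<in>?of_degree u. \<phi> e * lookup p e) = (\<Sum>e\<in>?of_degree u. \<phi> e0 * lookup p e)"
      using \<phi> keys e0 by (intro sum.cong arg_cong2[of _ _ _ _ "(*)"]) auto
    also have "\<dots> = \<phi> e0 * toric_image_coeff p u" by (simp add: toric_image_coeff_def sum_distrib_left)
    also have "\<dots> = 0" using p by (simp add: toric_ideal_def)
    finally show "(\<Sum>e\<in>?of_degree u. \<phi> e * lookup p e) = 0" .
  qed
  finally show ?thesis .
qed

text \<open>The functionals \<open>\<phi> j\<close> are independent on \<open>I / (\<mm> \<cdot> I)\<close>, where \<open>\<mm>\<close> is the kernel of the augmentation \<open>\<eta>\<close>.\<close>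

lemma card_dual_functionals_le:
  fixes \<phi> :: "'j \<Rightarrow> 'e::comm_monoid_add \<Rightarrow> 'k::field"
  assumes G: "finite G" and J: "finite J"
    and mult: "\<And>j h g. j \<in> J \<Longrightarrow> h \<in> R \<Longrightarrow> g \<in> G \<Longrightarrow> coeff_sum (\<phi> j) (h * g) = \<eta> h * coeff_sum (\<phi> j) g"
    and b: "\<And>k. k \<in> J \<Longrightarrow> b k \<in> generated_ideal_in R G"
    and dual: "\<And>j k. j \<in> J \<Longrightarrow> k \<in> J \<Longrightarrow> coeff_sum (\<phi> j) (b k) = of_bool (j = k)"
  shows "card J \<le> card G"
proof (rule ccontr)
  assume "\<not> card J \<le> card G"
  then obtain c where c: "\<exists>j\<in>J. c j \<noteq> 0" "\<And>g. g \<in> G \<Longrightarrow> (\<Sum>j\<in>J. c j * coeff_sum (\<phi> j) g) = 0"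
    using homogeneous_system_nontrivial[OF G J, of "\<lambda>j g. coeff_sum (\<phi> j) g"] by auto
  have "c k = 0" if k: "k \<in> J" for k
  proof -
    obtain h where h: "b k = (\<Sum>g\<in>G. h g * g)" "\<forall>g\<in>G. h g \<in> R"
      using b[OF k] by (auto simp: generated_ideal_in_def)
    have "c k = (\<Sum>j\<in>J. c j * coeff_sum (\<phi> j) (b k))" using k J by (simp add: dual)
    also have "\<dots> = (\<Sum>j\<in>J. c j * (\<Sum>g\<in>G. \<eta> (h g) * coeff_sum (\<phi> j) g))"
      using mult h by (simp add: coeff_sum_sum)
    also have "\<dots> = (\<Sum>j\<in>J. \<Sum>g\<in>G. \<eta> (h g) * (c j * coeff_sum (\<phi> j) g))"
      by (simp add: sum_distrib_left mult.left_commute)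
    also have "\<dots> = (\<Sum>g\<in>G. \<eta> (h g) * (\<Sum>j\<in>J. c j * coeff_sum (\<phi> j) g))"
      unfolding sum_distrib_left by (rule sum.swap)
    also have "\<dots> = 0" using c(2) by simp
    finally show ?thesis .
  qed
  then show False using c(1) by blast
qed

section \<open>Pure binomials\<close>

definition monomial_diff :: "'e \<Rightarrow> 'e \<Rightarrow> 'e \<Rightarrow>\<^sub>0 'k::comm_ring_1" where
  "monomial_diff e f = single e 1 - single f 1"

lemma coeff_sum_monomial_diff: "coeff_sum \<phi> (monomial_diff e f) = \<phi> e - \<phi> f"
proof -
  have "monomial_diff e f = single e (1::'a) + single f (- 1)"
    by (simp add: monomial_diff_def single_uminus)
  then show ?thesis by (simp add: coeff_sum_add)
qed

lemma monomial_diff_in_poly_ring: "keys e \<subseteq> A \<Longrightarrow> keys f \<subseteq> A \<Longrightarrow> monomial_diff e f \<in> poly_ring K A"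
  unfolding monomial_diff_def diff_conv_add_uminus
  by (intro poly_ring_add poly_ring_uminus poly_ring_single)

lemma monomial_diff_in_toric_ideal:
  fixes K :: "'k::field itself"
  assumes "keys e \<subseteq> A" "keys f \<subseteq> A" "lat_deg e = lat_deg f"
  shows "monomial_diff e f \<in> toric_ideal K A"
proof -
  have "monomial_diff e f + single f (1 :: 'k) = single e 1" by (simp add: monomial_diff_def)
  then have "toric_map (monomial_diff e f + single f (1 :: 'k)) = toric_map (single e 1)" by (rule arg_cong)
  then have "toric_map (monomial_diff e f :: ('k, _) lpoly) = 0"
    using assms(3) unfolding toric_map_add by simp
  then show ?thesis using assms by (simp add: toric_ideal_iff monomial_diff_in_poly_ring)
qed

lemma ideal_monomial_diff_refl: "ideal_in R J \<Longrightarrow> monomial_diff e e \<in> J"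
  by (simp add: monomial_diff_def ideal_in_def)

lemma ideal_monomial_diff_sym:
  "ideal_in (poly_ring K A) J \<Longrightarrow> monomial_diff e f \<in> J \<Longrightarrow> monomial_diff f e \<in> J"
  using ideal_in_uminus[of K A J "monomial_diff e f"] by (simp add: monomial_diff_def)

lemma ideal_monomial_diff_trans:
  "ideal_in R J \<Longrightarrow> monomial_diff e f \<in> J \<Longrightarrow> monomial_diff f g \<in> J \<Longrightarrow> monomial_diff e g \<in> J"
  using ideal_in_add[of R J "monomial_diff e f" "monomial_diff f g"] by (simp add: monomial_diff_def)

lemma ideal_monomial_diff_shift:
  "ideal_in (poly_ring K A) J \<Longrightarrow> keys g \<subseteq> A \<Longrightarrow> monomial_diff e f \<in> J \<Longrightarrow> monomial_diff (g + e) (g + f) \<in> J"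
  using ideal_in_mult[of "poly_ring K A" J "single g 1" "monomial_diff e f"]
  by (simp add: monomial_diff_def right_diff_distrib mult_single)

lemma toric_ideal_subset_if_monomial_diffs:
  fixes K :: "'k::field itself"
  assumes J: "ideal_in (poly_ring K A) J"
    and diffs: "\<And>e f. keys e \<subseteq> A \<Longrightarrow> keys f \<subseteq> A \<Longrightarrow> lat_deg e = lat_deg f \<Longrightarrow> monomial_diff e f \<in> J"
  shows "toric_ideal K A \<subseteq> J"
proof
  fix p assume p: "p \<in> toric_ideal K A"
  have keys: "keys e \<subseteq> A" if "e \<in> keys p" for e using p that by (auto simp: toric_ideal_def poly_ring_def)
  define r where "r u = (SOME e. e \<in> keys p \<and> lat_deg e = u)" for u
  have r: "r (lat_deg e) \<in> keys p \<and> lat_deg (r (lat_deg e)) = lat_deg e" if "e \<in> keys p" for e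
    unfolding r_def by (rule someI[of "\<lambda>x. x \<in> keys p \<and> lat_deg x = lat_deg e" e]) (simp add: that)
  have "(\<Sum>e\<in>keys p. single (r (lat_deg e)) (lookup p e)) = 0"
  proof (rule poly_mapping_eqI)
    fix m
    have "lookup (\<Sum>e\<in>keys p. single (r (lat_deg e)) (lookup p e)) m =
        coeff_sum (\<lambda>e. of_bool (r (lat_deg e) = m)) p"
      unfolding coeff_sum_def lookup_sum by (intro sum.cong) (auto simp: lookup_single when_def)
    also have "\<dots> = 0" by (intro toric_ideal_coeff_sum_eq_0[OF p]) simp
    finally show "lookup (\<Sum>e\<in>keys p. single (r (lat_deg e)) (lookup p e)) m = lookup 0 m" by simp
  qed
  then have "p = (\<Sum>e\<in>keys p. single e (lookup p e)) - (\<Sum>e\<in>keys p. single (r (lat_deg e)) (lookup p e))"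
    using poly_mapping_sum_single[of p] by simp
  also have "\<dots> = (\<Sum>e\<in>keys p. single 0 (lookup p e) * monomial_diff e (r (lat_deg e)))"
    unfolding sum_subtractf[symmetric] monomial_diff_def
    by (intro sum.cong) (auto simp: right_diff_distrib mult_single)
  also have "\<dots> \<in> J" using r keys by (intro ideal_in_sum[OF J] ideal_in_mult[OF J] diffs) auto
  finally show "p \<in> J" .
qed

section \<open>Dickson's lemma and exponents\<close>

lemma nat_incseq_subseq:
  fixes g :: "nat \<Rightarrow> nat"
  obtains r where "strict_mono r" "incseq (\<lambda>n. g (r n))"
proof -
  obtain s where s: "strict_mono s" "monoseq (\<lambda>n. g (s n))" using seq_monosub[of g] by blast
  show thesis
  proof (cases "incseq (\<lambda>n. g (s n))")
    case False
    then have dec: "decseq (\<lambda>n. g (s n))" using s(2) by (auto simp: monoseq_iff)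
    obtain N where N: "\<And>n. g (s N) \<le> g (s n)" using ex_has_least_nat[of "\<lambda>_. True" _ "\<lambda>n. g (s n)"] by blast
    have "g (s (n + N)) = g (s N)" for n using N[of "n + N"] decseqD[OF dec, of N "n + N"] by simp
    then have "incseq (\<lambda>n. g (s (n + N)))" by (simp add: incseq_def)
    moreover have "strict_mono (\<lambda>n. s (n + N))" using s(1) by (auto simp: strict_mono_def)
    ultimately show thesis using that by blast
  qed (use that s in blast)
qed

lemma incseq_subseq:
  fixes f :: "nat \<Rightarrow> 'a \<Rightarrow> nat"
  assumes "finite A"
  shows "\<exists>r. strict_mono r \<and> (\<forall>a\<in>A. incseq (\<lambda>n. f (r n) a))"
  using assms
proof (induction A)
  case empty
  then show ?case by (auto intro: exI[of _ id] simp: strict_mono_def)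
next
  case (insert a A)
  then obtain r where r: "strict_mono r" "\<forall>a\<in>A. incseq (\<lambda>n. f (r n) a)" by blast
  obtain s where s: "strict_mono s" "incseq (\<lambda>n. f (r (s n)) a)"
    using nat_incseq_subseq[of "\<lambda>n. f (r n) a"] by blast
  have "incseq (\<lambda>n. f (r (s n)) b)" if "b \<in> A" for b
    using r(2) that strict_mono_mono[OF s(1)] unfolding incseq_def mono_def by blast
  moreover have "strict_mono (\<lambda>n. r (s n))" using r(1) s(1) by (auto simp: strict_mono_def)
  ultimately show ?case using s(2) by (intro exI[of _ "\<lambda>n. r (s n)"]) auto
qed

theorem dickson_antichain_finite:
  fixes f :: "'b \<Rightarrow> 'a \<Rightarrow> nat"
  assumes "finite A" and antichain: "\<And>x y. x \<in> M \<Longrightarrow> y \<in> M \<Longrightarrow> (\<And>a. a \<in> A \<Longrightarrow> f x a \<le> f y a) \<Longrightarrow> x = y"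
  shows "finite M"
proof (rule ccontr)
  assume "infinite M"
  then obtain s :: "nat \<Rightarrow> 'b" where s: "inj s" "range s \<subseteq> M" using infinite_countable_subset by blast
  obtain r where r: "strict_mono r" "\<forall>a\<in>A. incseq (\<lambda>n. f (s (r n)) a)"
    using incseq_subseq[OF assms(1), of "\<lambda>n. f (s n)"] by blast
  have "f (s (r 0)) a \<le> f (s (r 1)) a" if "a \<in> A" for a using r(2) that unfolding incseq_def by blast
  then have "s (r 0) = s (r 1)" using antichain[of "s (r 0)" "s (r 1)"] s(2) by blast
  then have "r 0 = r 1" using s(1) by (simp add: inj_eq)
  then show False using strict_monoD[OF r(1), of 0 1] by simp
qed

lemma exponent_add_diff:
  fixes e f :: "'a \<Rightarrow>\<^sub>0 nat"
  assumes "\<And>a. lookup f a \<le> lookup e a" shows "f + (e - f) = e"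
  using assms by (intro poly_mapping_eqI) (simp add: lookup_add lookup_minus)

lemma exponent_single_add_diff: "a \<in> keys e \<Longrightarrow> single a 1 + (e - single a 1) = e"
  for e :: "'a \<Rightarrow>\<^sub>0 nat"
  by (rule exponent_add_diff) (auto simp: lookup_single when_def in_keys_iff)

lemma keys_exponent_diff_subset: "keys (e - f) \<subseteq> keys e"
  for e f :: "'a \<Rightarrow>\<^sub>0 nat"
  by (auto simp: in_keys_iff lookup_minus)

lemma keys_exponent_add: "keys (e + f) = keys e \<union> keys f"
  for e f :: "'a \<Rightarrow>\<^sub>0 nat"
  by (auto simp: in_keys_iff lookup_add)

section \<open>Lattice relations\<close>

lemma clear_denominators:
  fixes l :: "'a \<Rightarrow> rat"
  assumes "finite S"
  obtains N :: nat and k where "N > 0" "\<And>s. s \<in> S \<Longrightarrow> of_nat N * l s = of_int (k s)"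
proof -
  define n where "n s = fst (quotient_of (l s))" for s
  define d where "d s = nat (snd (quotient_of (l s)))" for s
  have d: "d s > 0 \<and> of_nat (d s) * l s = of_int (n s)" for s
  proof -
    let ?b = "snd (quotient_of (l s))"
    have b: "?b > 0" by (rule quotient_of_denom_pos')
    have "l s = of_int (n s) / of_int ?b" by (rule quotient_of_div) (simp add: n_def)
    then have "l s * of_int ?b = of_int (n s)"
      using b nonzero_eq_divide_eq[of "of_int ?b" "l s" "of_int (n s)"] by simp
    then show ?thesis using b by (simp add: d_def mult.commute)
  qed
  have "of_nat (\<Prod>s\<in>S. d s) * l s = of_int (int (\<Prod>t\<in>S - {s}. d t) * n s)" if "s \<in> S" for s
  proof -
    have "of_nat (\<Prod>s\<in>S. d s) * l s = of_nat (\<Prod>t\<in>S - {s}. d t) * (of_nat (d s) * l s)"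
      unfolding prod.remove[OF assms that, of d] by (simp add: mult_ac)
    then show ?thesis by (simp add: d)
  qed
  moreover have "(\<Prod>s\<in>S. d s) > 0" using d by (intro prod_pos) simp
  ultimately show thesis by (rule that[rotated])
qed

lemma lattice_relation:
  assumes B: "finite B" and c: "rat_of_lat c \<in> vec.span (rat_of_lat ` B)"
  obtains N e f where "N > 0" "keys e \<subseteq> B" "keys f \<subseteq> B" "lat_deg (single c N + e) = lat_deg f"
proof -
  obtain u where "rat_of_lat c = (\<Sum>v\<in>rat_of_lat ` B. u v *s v)"
    using c vec.span_finite[of "rat_of_lat ` B"] B by auto
  then have u: "rat_of_lat c = (\<Sum>b\<in>B. u (rat_of_lat b) *s rat_of_lat b)"
    by (simp add: sum.reindex[OF inj_on_rat_of_lat])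
  obtain N :: nat and k where N: "N > 0" "\<And>b. b \<in> B \<Longrightarrow> of_nat N * u (rat_of_lat b) = of_int (k b)"
    by (rule clear_denominators[OF B, of "\<lambda>b. u (rat_of_lat b)"]) (rule that)
  have "rat_of_lat (int N *s c) = (\<Sum>b\<in>B. (of_nat N * u (rat_of_lat b)) *s rat_of_lat b)"
    by (simp add: rat_of_lat_simps u vec.scale_sum_right)
  also have "\<dots> = rat_of_lat (\<Sum>b\<in>B. k b *s b)"
    using N(2) by (simp add: rat_of_lat_sum rat_of_lat_simps)
  finally have multiple: "int N *s c = (\<Sum>b\<in>B. k b *s b)" by (simp add: rat_of_lat_eq_iff)
  let ?e = "monomial_on B (\<lambda>b. nat (- k b))" and ?f = "monomial_on B (\<lambda>b. nat (k b))"
  have "lat_deg (single c N + ?e) = (\<Sum>b\<in>B. k b *s b + int (nat (- k b)) *s b)"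
    by (simp add: lat_deg_add lat_deg_single lat_deg_monomial_on[OF B] multiple sum.distrib)
  also have "\<dots> = lat_deg ?f" unfolding lat_deg_monomial_on[OF B]
    by (intro sum.cong refl) (simp add: vec_eq_iff distrib_right[symmetric])
  finally show thesis using that[of N ?e ?f] N(1) keys_monomial_on[OF B] by blast
qed

section \<open>Pointed configurations\<close>

locale pointed_config =
  fixes A :: "(int ^ 'n) set"
  assumes finite_A: "finite A" and pointed: "nat_monoid A \<inter> uminus ` nat_monoid A = {0}"
begin

abbreviation points :: "(int ^ 'n) set" where
  "points \<equiv> A - {0}"

definition monomials :: "'n exponent set" where
  "monomials = {e. keys e \<subseteq> points}"

lemma finite_points: "finite points"
  using finite_A by simp

lemma rat_of_lat_points: "rat_of_lat ` points = rat_of_lat ` A - {0}"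
  using image_set_diff[OF inj_on_rat_of_lat, of A "{0}"] by (simp add: rat_of_lat_simps)

lemma dim_rat_of_lat_points: "vec.dim (rat_of_lat ` points) = vec.dim (rat_of_lat ` A)"
  unfolding rat_of_lat_points by (rule vec.span_eq_dim) simp

lemma pos_cone_rat_of_lat_points: "pos_cone (rat_of_lat ` points) = pos_cone (rat_of_lat ` A)"
  unfolding rat_of_lat_points by (rule pos_cone_delete_0)

lemma keys_monomials: "e \<in> monomials \<Longrightarrow> keys e \<subseteq> A"
  by (auto simp: monomials_def)

lemma monomials_diff: "e \<in> monomials \<Longrightarrow> e - f \<in> monomials"
  using keys_exponent_diff_subset[of e f] by (auto simp: monomials_def)

lemma lat_deg_in_nat_monoid: "e \<in> monomials \<Longrightarrow> lat_deg e \<in> nat_monoid A"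
  using lat_deg_superset[OF finite_A keys_monomials] by (auto simp: nat_monoid_def)

lemma lat_deg_eq_0_iff:
  assumes "e \<in> monomials" shows "lat_deg e = 0 \<longleftrightarrow> e = 0"
proof
  assume deg: "lat_deg e = 0"
  show "e = 0"
  proof (rule ccontr)
    assume "e \<noteq> 0"
    then obtain a where a: "a \<in> keys e" by (metis all_not_in_conv keys_eq_empty)
    then have "a \<in> points" using assms by (auto simp: monomials_def)
    have "lat_deg (single a 1) + lat_deg (e - single a 1) = 0"
      using exponent_single_add_diff[OF a] deg by (metis lat_deg_add)
    then have "lat_deg (e - single a 1) = - a" by (simp add: lat_deg_single eq_neg_iff_add_eq_0 add.commute)
    then have "- a \<in> nat_monoid A" using lat_deg_in_nat_monoid[OF monomials_diff[OF assms]] by metis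
    moreover have "a \<in> nat_monoid A"
      using lat_deg_in_nat_monoid[of "single a 1"] \<open>a \<in> points\<close> by (simp add: monomials_def lat_deg_single)
    ultimately have "a \<in> nat_monoid A \<inter> uminus ` nat_monoid A" by (metis IntI image_eqI minus_minus)
    then show False using pointed \<open>a \<in> points\<close> by auto
  qed
qed simp

lemma not_positively_dependent_points: "\<not> positively_dependent points rat_of_lat"
proof
  assume "positively_dependent points rat_of_lat"
  then obtain l where l: "\<forall>a\<in>points. l a \<ge> 0" "\<exists>a\<in>points. l a > 0" "(\<Sum>a\<in>points. l a *s rat_of_lat a) = 0"
    unfolding positively_dependent_def by blast
  obtain N :: nat and k where N: "N > 0" "\<And>a. a \<in> points \<Longrightarrow> of_nat N * l a = of_int (k a)"
    by (rule clear_denominators[OF finite_points, of l]) (rule that)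
  have k: "k a \<ge> 0" if "a \<in> points" for a
  proof -
    have "(of_int (k a) :: rat) \<ge> 0"
      using N(2)[OF that] l(1) that by (metis mult_nonneg_nonneg of_nat_0_le_iff)
    then show ?thesis by simp
  qed
  let ?e = "monomial_on points (\<lambda>a. nat (k a))"
  have "rat_of_lat (lat_deg ?e) = (\<Sum>a\<in>points. (of_nat N * l a) *s rat_of_lat a)"
    unfolding lat_deg_monomial_on[OF finite_points] rat_of_lat_sum
    using N(2) k by (intro sum.cong) (auto simp: rat_of_lat_simps)
  also have "\<dots> = of_nat N *s (\<Sum>a\<in>points. l a *s rat_of_lat a)" by (simp add: vec.scale_sum_right)
  also have "\<dots> = rat_of_lat 0" by (simp add: l(3) rat_of_lat_simps)
  finally have "?e = 0"
    using lat_deg_eq_0_iff[of ?e] keys_monomial_on[OF finite_points]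
    by (simp add: monomials_def rat_of_lat_eq_iff)
  then have "nat (k a) = 0" if "a \<in> points" for a
    using that lookup_monomial_on[OF finite_points, of "\<lambda>a. nat (k a)" a] by simp
  then have "of_nat N * l a = 0" if "a \<in> points" for a using N(2)[OF that] k[OF that] that by force
  then show False using l(2) N(1) by force
qed

lemma weight_exists:
  obtains w where "\<And>a. a \<in> points \<Longrightarrow> qdot w (rat_of_lat a) \<ge> 1"
proof -
  obtain w where w: "\<And>a. a \<in> points \<Longrightarrow> qdot w (rat_of_lat a) > 0"
    by (rule gordan[OF finite_points not_positively_dependent_points]) (rule that)
  let ?values = "insert 1 ((\<lambda>a. qdot w (rat_of_lat a)) ` points)"
  define \<delta> where "\<delta> = Min ?values"
  have "\<delta> > 0" using w finite_points by (auto simp: \<delta>_def)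
  moreover have "\<delta> \<le> qdot w (rat_of_lat a)" if "a \<in> points" for a
    unfolding \<delta>_def using that finite_points by (intro Min_le) auto
  ultimately have "qdot ((1 / \<delta>) *s w) (rat_of_lat a) \<ge> 1" if "a \<in> points" for a
    using that by (simp add: qdot_simps)
  then show thesis by (rule that)
qed

lemma grading:
  obtains \<omega> :: "'n exponent \<Rightarrow> nat" where
    "\<And>e a. e \<in> monomials \<Longrightarrow> a \<in> keys e \<Longrightarrow> \<omega> (e - single a 1) < \<omega> e"
    "\<And>e f. lat_deg e = lat_deg f \<Longrightarrow> \<omega> e = \<omega> f"
proof -
  obtain w where w: "\<And>a. a \<in> points \<Longrightarrow> qdot w (rat_of_lat a) \<ge> 1" by (rule weight_exists) (rule that)
  let ?w = "\<lambda>e. qdot w (rat_of_lat (lat_deg e))"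
  have nonneg: "?w e \<ge> 0" if "e \<in> monomials" for e
  proof -
    have "qdot w (rat_of_lat a) \<ge> 0" if "a \<in> points" for a using w[OF that] by simp
    then show ?thesis using that qdot_lat_deg[OF finite_points, of e w]
      by (auto simp: monomials_def intro!: sum_nonneg mult_nonneg_nonneg)
  qed
  have "nat \<lfloor>?w (e - single a 1)\<rfloor> < nat \<lfloor>?w e\<rfloor>" if e: "e \<in> monomials" and a: "a \<in> keys e" for e a
  proof -
    have "?w e = ?w (single a 1) + ?w (e - single a 1)"
      using exponent_single_add_diff[OF a] by (metis lat_deg_add rat_of_lat_simps(1) qdot_simps(1))
    moreover have "a \<in> points" using e a by (auto simp: monomials_def)
    ultimately have "?w (e - single a 1) + 1 \<le> ?w e" using w by (simp add: lat_deg_single)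
    then have "\<lfloor>?w (e - single a 1)\<rfloor> + 1 \<le> \<lfloor>?w e\<rfloor>" by (metis floor_mono floor_add_int of_int_1)
    moreover have "\<lfloor>?w (e - single a 1)\<rfloor> \<ge> 0" using nonneg[OF monomials_diff[OF e]] by simp
    ultimately show ?thesis by linarith
  qed
  then show thesis by (rule that) simp_all
qed

definition shares :: "'n exponent \<Rightarrow> 'n exponent \<Rightarrow> bool" where
  "shares e f \<longleftrightarrow> e \<in> monomials \<and> f \<in> monomials \<and> lat_deg e = lat_deg f \<and> keys e \<inter> keys f \<noteq> {}"

abbreviation linked :: "'n exponent \<Rightarrow> 'n exponent \<Rightarrow> bool" where
  "linked \<equiv> shares\<^sup>*\<^sup>*"

lemma linked_sym: "linked e f \<Longrightarrow> linked f e"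
proof -
  have "symp shares" by (auto simp: symp_def shares_def)
  then show "linked e f \<Longrightarrow> linked f e" by (metis symp_rtranclp sympD)
qed

lemma linked_same_degree: "linked e f \<Longrightarrow> e \<in> monomials \<Longrightarrow> f \<in> monomials \<and> lat_deg f = lat_deg e"
  by (induction rule: rtranclp_induct) (auto simp: shares_def)

definition representative :: "int ^ 'n \<Rightarrow> 'n exponent" where
  "representative u = (SOME e. e \<in> monomials \<and> lat_deg e = u)"

lemma representative:
  "e \<in> monomials \<Longrightarrow>
    representative (lat_deg e) \<in> monomials \<and> lat_deg (representative (lat_deg e)) = lat_deg e"
  unfolding representative_def by (rule someI[of "\<lambda>x. x \<in> monomials \<and> lat_deg x = lat_deg e"]) simp

text \<open>Every class of linked monomials that does not contain the representative of its degree contributes one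
  binomial to a minimal generating set.\<close>

definition classes :: "'n exponent set set" where
  "classes = {Collect (linked e) | e. e \<in> monomials \<and> \<not> linked e (representative (lat_deg e))}"

definition lhs :: "'n exponent set \<Rightarrow> 'n exponent" where
  "lhs \<gamma> = (SOME e. e \<in> monomials \<and> \<gamma> = Collect (linked e) \<and> \<not> linked e (representative (lat_deg e)))"

definition rhs :: "'n exponent set \<Rightarrow> 'n exponent" where
  "rhs \<gamma> = representative (lat_deg (lhs \<gamma>))"

lemma
  assumes "\<gamma> \<in> classes"
  shows lhs_monomial: "lhs \<gamma> \<in> monomials" and rhs_monomial: "rhs \<gamma> \<in> monomials"
    and lat_deg_rhs: "lat_deg (rhs \<gamma>) = lat_deg (lhs \<gamma>)"
    and class_eq: "\<gamma> = Collect (linked (lhs \<gamma>))" and lhs_not_linked_rhs: "\<not> linked (lhs \<gamma>) (rhs \<gamma>)"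
proof -
  have "\<exists>e. e \<in> monomials \<and> \<gamma> = Collect (linked e) \<and> \<not> linked e (representative (lat_deg e))"
    using assms by (auto simp: classes_def)
  then have lhs: "lhs \<gamma> \<in> monomials \<and> \<gamma> = Collect (linked (lhs \<gamma>)) \<and>
      \<not> linked (lhs \<gamma>) (representative (lat_deg (lhs \<gamma>)))"
    unfolding lhs_def by (rule someI_ex)
  then show "lhs \<gamma> \<in> monomials" "\<gamma> = Collect (linked (lhs \<gamma>))" "\<not> linked (lhs \<gamma>) (rhs \<gamma>)"
    by (auto simp: rhs_def)
  show "rhs \<gamma> \<in> monomials" "lat_deg (rhs \<gamma>) = lat_deg (lhs \<gamma>)"
    using representative[of "lhs \<gamma>"] lhs by (auto simp: rhs_def)
qed

lemma lhs_rhs_nonzero: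
  assumes \<gamma>: "\<gamma> \<in> classes" shows "lhs \<gamma> \<noteq> 0 \<and> rhs \<gamma> \<noteq> 0"
proof -
  have "lhs \<gamma> = 0 \<longleftrightarrow> rhs \<gamma> = 0"
    using lat_deg_eq_0_iff lhs_monomial[OF \<gamma>] rhs_monomial[OF \<gamma>] lat_deg_rhs[OF \<gamma>] by metis
  moreover have "lhs \<gamma> \<noteq> rhs \<gamma>" using lhs_not_linked_rhs[OF \<gamma>] by auto
  ultimately show ?thesis by metis
qed

lemma linked_mem_class_iff: "\<gamma> \<in> classes \<Longrightarrow> linked e f \<Longrightarrow> e \<in> \<gamma> \<longleftrightarrow> f \<in> \<gamma>"
  using class_eq[of \<gamma>] linked_sym by (metis mem_Collect_eq rtranclp_trans)

lemma lhs_mem_class_iff: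
  assumes "\<beta> \<in> classes" "\<gamma> \<in> classes" shows "lhs \<gamma> \<in> \<beta> \<longleftrightarrow> \<beta> = \<gamma>"
proof
  assume "lhs \<gamma> \<in> \<beta>"
  then have link: "linked (lhs \<beta>) (lhs \<gamma>)" using class_eq[OF assms(1)] by blast
  then have "linked (lhs \<beta>) x \<longleftrightarrow> linked (lhs \<gamma>) x" for x
    using linked_sym[OF link] by (meson rtranclp_trans)
  then have "Collect (linked (lhs \<beta>)) = Collect (linked (lhs \<gamma>))" by (rule Collect_cong)
  then show "\<beta> = \<gamma>" using class_eq[OF assms(1)] class_eq[OF assms(2)] by simp
next
  assume "\<beta> = \<gamma>"
  then show "lhs \<gamma> \<in> \<beta>" using class_eq[OF assms(1)] by blast
qed

lemma rhs_notin_class: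
  assumes "\<beta> \<in> classes" "\<gamma> \<in> classes" shows "rhs \<gamma> \<notin> \<beta>"
proof
  assume "rhs \<gamma> \<in> \<beta>"
  then have link: "linked (lhs \<beta>) (rhs \<gamma>)" using class_eq[OF assms(1)] by blast
  then have "lat_deg (lhs \<gamma>) = lat_deg (lhs \<beta>)"
    using linked_same_degree[OF link lhs_monomial[OF assms(1)]] lat_deg_rhs[OF assms(2)] by simp
  then show False using link lhs_not_linked_rhs[OF assms(1)] by (simp add: rhs_def)
qed

text \<open>If \<open>lhs \<beta>\<close> properly divided \<open>lhs \<gamma>\<close>, then \<open>lhs \<gamma>\<close> and \<open>rhs \<gamma>\<close> would be linked through
  \<open>(lhs \<gamma> - lhs \<beta>) + rhs \<beta>\<close>.\<close>

lemma class_eq_if_divides: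
  assumes \<beta>: "\<beta> \<in> classes" and \<gamma>: "\<gamma> \<in> classes"
    and le: "\<And>a. lookup (lhs \<beta>) a \<le> lookup (lhs \<gamma>) a" "\<And>a. lookup (rhs \<beta>) a \<le> lookup (rhs \<gamma>) a"
  shows "\<beta> = \<gamma>"
proof -
  have divides: "lhs \<beta> + (lhs \<gamma> - lhs \<beta>) = lhs \<gamma>" "rhs \<beta> + (rhs \<gamma> - rhs \<beta>) = rhs \<gamma>"
    using le by (auto intro: exponent_add_diff)
  define g where "g = (lhs \<gamma> - lhs \<beta>) + rhs \<beta>"
  have "g \<in> monomials"
    using monomials_diff[OF lhs_monomial[OF \<gamma>], of "lhs \<beta>"] rhs_monomial[OF \<beta>]
    by (simp add: g_def monomials_def keys_exponent_add)
  moreover have "lat_deg g = lat_deg (lhs \<gamma>)"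
    using divides(1) lat_deg_rhs[OF \<beta>] by (metis g_def lat_deg_add add.commute)
  moreover have "keys g \<inter> keys (rhs \<gamma>) \<noteq> {}"
    using lhs_rhs_nonzero[OF \<beta>] keys_exponent_add[of "rhs \<beta>" "rhs \<gamma> - rhs \<beta>"]
    unfolding divides(2) g_def keys_exponent_add by (auto simp flip: keys_eq_empty)
  ultimately have "shares g (rhs \<gamma>)"
    using rhs_monomial[OF \<gamma>] lat_deg_rhs[OF \<gamma>] by (simp add: shares_def)
  then have "\<not> shares (lhs \<gamma>) g"
    using lhs_not_linked_rhs[OF \<gamma>] by (meson converse_rtranclp_into_rtranclp r_into_rtranclp)
  then have "keys (lhs \<gamma>) \<inter> keys g = {}"
    using lhs_monomial[OF \<gamma>] \<open>g \<in> monomials\<close> \<open>lat_deg g = lat_deg (lhs \<gamma>)\<close> by (simp add: shares_def)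
  then have "keys (lhs \<gamma> - lhs \<beta>) = {}"
    using keys_exponent_diff_subset[of "lhs \<gamma>" "lhs \<beta>"] unfolding g_def keys_exponent_add by blast
  then have "lhs \<beta> = lhs \<gamma>" using divides(1) by simp
  then show ?thesis using class_eq[OF \<beta>] class_eq[OF \<gamma>] by simp
qed

lemma finite_classes: "finite classes"
proof (rule dickson_antichain_finite)
  let ?f = "\<lambda>\<gamma> x. case x of Inl a \<Rightarrow> lookup (lhs \<gamma>) a | Inr a \<Rightarrow> lookup (rhs \<gamma>) a"
  show "finite (A <+> A)" using finite_A by simp
  fix \<beta> \<gamma> assume \<beta>: "\<beta> \<in> classes" and \<gamma>: "\<gamma> \<in> classes"
    and le: "\<And>x. x \<in> A <+> A \<Longrightarrow> ?f \<beta> x \<le> ?f \<gamma> x"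
  have "lookup (lhs \<beta>) a \<le> lookup (lhs \<gamma>) a \<and> lookup (rhs \<beta>) a \<le> lookup (rhs \<gamma>) a" for a
  proof (cases "a \<in> A")
    case True
    then show ?thesis using le[OF InlI] le[OF InrI] by auto
  next
    case False
    then have "a \<notin> keys (lhs \<beta>)" "a \<notin> keys (rhs \<beta>)"
      using keys_monomials lhs_monomial[OF \<beta>] rhs_monomial[OF \<beta>] by blast+
    then show ?thesis by (simp add: in_keys_iff)
  qed
  then show "\<beta> = \<gamma>" using class_eq_if_divides[OF \<beta> \<gamma>] by blast
qed

definition monomial_congruence :: "('n exponent \<Rightarrow> 'n exponent \<Rightarrow> bool) \<Rightarrow> bool" where
  "monomial_congruence Q \<longleftrightarrow>
    reflp_on monomials Q \<and> symp_on monomials Q \<and> transp_on monomials Q \<and>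
    (\<forall>e\<in>monomials. \<forall>f\<in>monomials. \<forall>a\<in>points. Q e f \<longrightarrow> Q (single a 1 + e) (single a 1 + f))"

lemma
  assumes "monomial_congruence Q" "e \<in> monomials" "f \<in> monomials"
  shows monomial_congruence_refl: "Q e e"
    and monomial_congruence_sym: "Q e f \<Longrightarrow> Q f e"
    and monomial_congruence_trans: "g \<in> monomials \<Longrightarrow> Q e f \<Longrightarrow> Q f g \<Longrightarrow> Q e g"
    and monomial_congruence_shift: "a \<in> points \<Longrightarrow> Q e f \<Longrightarrow> Q (single a 1 + e) (single a 1 + f)"
proof -
  have Q: "reflp_on monomials Q" "symp_on monomials Q" "transp_on monomials Q"
    "\<forall>e\<in>monomials. \<forall>f\<in>monomials. \<forall>a\<in>points. Q e f \<longrightarrow> Q (single a 1 + e) (single a 1 + f)"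
    using assms(1) unfolding monomial_congruence_def by simp_all
  show "Q e e" by (rule reflp_onD[OF Q(1) assms(2)])
  show "Q f e" if "Q e f" by (rule symp_onD[OF Q(2) assms(2,3) that])
  show "Q e g" if "g \<in> monomials" "Q e f" "Q f g" by (rule transp_onD[OF Q(3) assms(2,3) that])
  show "Q (single a 1 + e) (single a 1 + f)" if "a \<in> points" "Q e f" using Q(4) assms(2,3) that by blast
qed

lemma monomial_congruence_ideal:
  assumes J: "ideal_in (poly_ring K A) J"
  shows "monomial_congruence (\<lambda>e f. monomial_diff e f \<in> J)"
  unfolding monomial_congruence_def
proof (intro conjI ballI impI reflp_onI symp_onI transp_onI)
  fix e f g a
  show "monomial_diff e e \<in> J" by (rule ideal_monomial_diff_refl[OF J])
  assume "monomial_diff e f \<in> J"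
  then show "monomial_diff f e \<in> J" by (rule ideal_monomial_diff_sym[OF J])
  show "monomial_diff e g \<in> J" if "monomial_diff f g \<in> J"
    using \<open>monomial_diff e f \<in> J\<close> that by (rule ideal_monomial_diff_trans[OF J])
  show "monomial_diff (single a 1 + e) (single a 1 + f) \<in> J" if "a \<in> points"
    using that \<open>monomial_diff e f \<in> J\<close> by (intro ideal_monomial_diff_shift[OF J]) auto
qed

lemma linked_imp_congruent:
  assumes Q: "monomial_congruence Q"
    and shares: "\<And>g h. shares g h \<Longrightarrow> lat_deg g = u \<Longrightarrow> Q g h"
    and "linked e f" and e: "e \<in> monomials" "lat_deg e = u"
  shows "Q e f"
  using \<open>linked e f\<close>
proof (induction rule: rtranclp_induct)
  case base
  show ?case by (rule monomial_congruence_refl[OF Q e(1) e(1)])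
next
  case (step y z)
  have y: "y \<in> monomials" "lat_deg y = u" using linked_same_degree[OF step.hyps(1) e(1)] e(2) by auto
  moreover have "z \<in> monomials" using step.hyps(2) by (auto simp: shares_def)
  moreover have "Q y z" using shares[OF step.hyps(2) y(2)] .
  ultimately show ?case using monomial_congruence_trans[OF Q e(1)] step.IH by blast
qed

lemma congruent_representative:
  assumes Q: "monomial_congruence Q"
    and linked: "\<And>g h. linked g h \<Longrightarrow> g \<in> monomials \<Longrightarrow> lat_deg g = u \<Longrightarrow> Q g h"
    and binomials: "\<And>\<gamma>. \<gamma> \<in> classes \<Longrightarrow> Q (lhs \<gamma>) (rhs \<gamma>)"
    and e: "e \<in> monomials" "lat_deg e = u"
  shows "Q e (representative u)"
proof (cases "linked e (representative u)")
  case True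
  then show ?thesis using linked e by blast
next
  case False
  define \<gamma> where "\<gamma> = Collect (linked e)"
  have \<gamma>: "\<gamma> \<in> classes" using False e unfolding classes_def \<gamma>_def by blast
  have "linked (lhs \<gamma>) e" using class_eq[OF \<gamma>] by (auto simp: \<gamma>_def)
  then have link: "linked e (lhs \<gamma>)" by (rule linked_sym)
  then have "lat_deg (lhs \<gamma>) = u" using linked_same_degree[OF link e(1)] e(2) by simp
  then have "Q (lhs \<gamma>) (representative u)" using binomials[OF \<gamma>] by (simp add: rhs_def)
  moreover have "Q e (lhs \<gamma>)" using linked[OF link e] .
  moreover have "representative u \<in> monomials" using representative[OF e(1)] e(2) by simp
  ultimately show ?thesis using monomial_congruence_trans[OF Q e(1) lhs_monomial[OF \<gamma>]] by blast
qed

theorem monomial_congruence_equal_degree: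
  assumes Q: "monomial_congruence Q" and binomials: "\<And>\<gamma>. \<gamma> \<in> classes \<Longrightarrow> Q (lhs \<gamma>) (rhs \<gamma>)"
    and "e \<in> monomials" "f \<in> monomials" "lat_deg e = lat_deg f"
  shows "Q e f"
proof -
  obtain \<omega> :: "'n exponent \<Rightarrow> nat" where
    less: "\<And>e a. e \<in> monomials \<Longrightarrow> a \<in> keys e \<Longrightarrow> \<omega> (e - single a 1) < \<omega> e"
    and degree: "\<And>e f. lat_deg e = lat_deg f \<Longrightarrow> \<omega> e = \<omega> f" by (rule grading) (rule that)
  show ?thesis using assms(3-5)
  proof (induction "\<omega> e" arbitrary: e f rule: less_induct)
    case less_weight: less
    define u where "u = lat_deg e"
    have shares: "Q g h" if gh: "shares g h" and u: "lat_deg g = u" for g h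
    proof -
      obtain a where a: "a \<in> keys g" "a \<in> keys h" and mon: "g \<in> monomials" "h \<in> monomials"
        and deg: "lat_deg g = lat_deg h" using gh by (auto simp: shares_def)
      note g = exponent_single_add_diff[OF a(1)] and h = exponent_single_add_diff[OF a(2)]
      have "lat_deg (g - single a 1) = lat_deg (h - single a 1)"
        using deg by (metis g h lat_deg_add add_left_cancel)
      moreover have "\<omega> (g - single a 1) < \<omega> e"
        using less[OF mon(1) a(1)] degree[of g e] u by (simp add: u_def)
      ultimately have "Q (g - single a 1) (h - single a 1)" by (intro less_weight.hyps monomials_diff mon)
      moreover have "a \<in> points" using mon(1) a(1) by (auto simp: monomials_def)
      ultimately have "Q (single a 1 + (g - single a 1)) (single a 1 + (h - single a 1))"
        by (intro monomial_congruence_shift[OF Q] monomials_diff mon)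
      then show ?thesis unfolding g h .
    qed
    have linked: "Q g h" if "linked g h" "g \<in> monomials" "lat_deg g = u" for g h
      by (rule linked_imp_congruent[OF Q shares that])
    have "Q g (representative u)" if "g \<in> monomials" "lat_deg g = u" for g
      using congruent_representative[OF Q linked binomials that] by blast
    then have "Q e (representative u)" "Q f (representative u)"
      using less_weight.prems by (auto simp: u_def)
    moreover have "representative u \<in> monomials"
      using representative[OF less_weight.prems(1)] by (simp add: u_def)
    ultimately show ?case
      using less_weight.prems(1,2) monomial_congruence_sym[OF Q] monomial_congruence_trans[OF Q] by metis
  qed
qed

definition drop0 :: "'n exponent \<Rightarrow> 'n exponent" where
  "drop0 e = e - single 0 (lookup e 0)"

lemma lookup_drop0: "lookup (drop0 e) a = (if a = 0 then 0 else lookup e a)"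
  by (simp add: drop0_def lookup_minus lookup_single when_def)

lemma drop0_add: "drop0 (e + f) = drop0 e + drop0 f"
  by (rule poly_mapping_eqI) (simp add: lookup_drop0 lookup_add)

lemma drop0_decomp: "single 0 (lookup e 0) + drop0 e = e"
  by (rule poly_mapping_eqI) (auto simp: lookup_drop0 lookup_add lookup_single when_def)

lemma lat_deg_drop0: "lat_deg (drop0 e) = lat_deg e"
proof -
  have "lat_deg e = lat_deg (single 0 (lookup e 0)) + lat_deg (drop0 e)"
    by (metis drop0_decomp lat_deg_add)
  then show ?thesis by (simp add: lat_deg_single)
qed

lemma drop0_monomial: "keys e \<subseteq> A \<Longrightarrow> drop0 e \<in> monomials"
  by (auto simp: monomials_def in_keys_iff lookup_drop0 split: if_splits)

lemma drop0_id: "e \<in> monomials \<Longrightarrow> drop0 e = e"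
  by (rule poly_mapping_eqI) (auto simp: monomials_def in_keys_iff lookup_drop0)

lemma drop0_0 [simp]: "drop0 0 = 0"
  and drop0_single_0 [simp]: "drop0 (single 0 k) = 0"
  by (auto intro!: poly_mapping_eqI simp: lookup_drop0 lookup_single when_def)

text \<open>\<open>None\<close> stands for the binomial \<open>x\<^sub>0 - 1\<close>, needed if the point \<open>0\<close> belongs to the configuration.\<close>

definition generator_index :: "'n exponent set option set" where
  "generator_index = Some ` classes \<union> (if 0 \<in> A then {None} else {})"

definition gen_lhs :: "'n exponent set option \<Rightarrow> 'n exponent" where
  "gen_lhs j = (case j of Some \<gamma> \<Rightarrow> lhs \<gamma> | None \<Rightarrow> single 0 1)"

definition gen_rhs :: "'n exponent set option \<Rightarrow> 'n exponent" where
  "gen_rhs j = (case j of Some \<gamma> \<Rightarrow> rhs \<gamma> | None \<Rightarrow> 0)"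

lemma generator_index_cases:
  assumes "j \<in> generator_index"
  obtains (zero) "j = None" "0 \<in> A" | (cls) \<gamma> where "j = Some \<gamma>" "\<gamma> \<in> classes"
  using assms by (auto simp: generator_index_def split: if_splits)

lemma finite_generator_index: "finite generator_index"
  using finite_classes by (simp add: generator_index_def)

lemma card_generator_index: "card generator_index = card classes + of_bool (0 \<in> A)"
  using finite_classes by (auto simp: generator_index_def card_image card_insert_if)

lemma generator_in_toric_ideal:
  assumes "j \<in> generator_index" shows "monomial_diff (gen_lhs j) (gen_rhs j) \<in> toric_ideal K A"
  using assms
proof (cases j rule: generator_index_cases)
  case zero
  then show ?thesis
    by (intro monomial_diff_in_toric_ideal) (auto simp: gen_lhs_def gen_rhs_def lat_deg_single)
next
  case (cls \<gamma>)
  then show ?thesis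
    by (intro monomial_diff_in_toric_ideal)
       (simp_all add: gen_lhs_def gen_rhs_def keys_monomials lhs_monomial rhs_monomial lat_deg_rhs)
qed

lemma monomial_diff_drop0_mem:
  assumes J: "ideal_in (poly_ring K A) J"
    and gens: "\<And>j. j \<in> generator_index \<Longrightarrow> monomial_diff (gen_lhs j) (gen_rhs j) \<in> J"
    and e: "keys e \<subseteq> A"
  shows "monomial_diff e (drop0 e) \<in> J"
proof -
  have "monomial_diff (single 0 k + drop0 e) (drop0 e) \<in> J" if "k \<le> lookup e 0" for k
    using that
  proof (induction k)
    case 0
    show ?case using ideal_monomial_diff_refl[OF J] by simp
  next
    case (Suc k)
    then have "0 \<in> A" using e by (auto simp: in_keys_iff)
    then have "monomial_diff (single 0 1) 0 \<in> J"
      using gens[of None] by (simp add: generator_index_def gen_lhs_def gen_rhs_def)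
    moreover have "keys (single 0 k + drop0 e) \<subseteq> A"
      using \<open>0 \<in> A\<close> keys_monomials[OF drop0_monomial[OF e]] by (simp add: keys_exponent_add)
    ultimately have "monomial_diff (single 0 k + drop0 e + single 0 1) (single 0 k + drop0 e + 0) \<in> J"
      by (intro ideal_monomial_diff_shift[OF J])
    moreover have "single 0 k + drop0 e + single 0 1 = single 0 (Suc k) + drop0 e"
      by (simp add: single_add[symmetric] add.assoc add.left_commute add.commute)
    ultimately show ?case using ideal_monomial_diff_trans[OF J] Suc by simp
  qed
  from this[of "lookup e 0"] show ?thesis by (simp add: drop0_decomp)
qed

theorem toric_ideal_generated:
  fixes K :: "'k::field itself"
  shows "generated_ideal_in (poly_ring K A)
      ((\<lambda>j. monomial_diff (gen_lhs j) (gen_rhs j)) ` generator_index) =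
    toric_ideal K A" (is "?J = _")
proof
  let ?G = "(\<lambda>j. monomial_diff (gen_lhs j) (gen_rhs j) :: ('k, 'n) lpoly) ` generator_index"
  have sub: "?G \<subseteq> toric_ideal K A" using generator_in_toric_ideal by blast
  show "?J \<subseteq> toric_ideal K A" using ideal_in_toric_ideal sub by (rule generated_ideal_in_minimal)
  have "?G \<subseteq> poly_ring K A" using sub by (auto simp: toric_ideal_def)
  then have J: "ideal_in (poly_ring K A) ?J" by (rule ideal_in_generated_ideal_in)
  have gens: "monomial_diff (gen_lhs j) (gen_rhs j) \<in> ?J" if "j \<in> generator_index" for j
    using that finite_generator_index by (intro generated_ideal_in_base) auto
  let ?Q = "\<lambda>e f. monomial_diff e f \<in> ?J"
  have "?Q (lhs \<gamma>) (rhs \<gamma>)" if "\<gamma> \<in> classes" for \<gamma>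
    using gens[of "Some \<gamma>"] that by (simp add: generator_index_def gen_lhs_def gen_rhs_def)
  then have "?Q e f" if "e \<in> monomials" "f \<in> monomials" "lat_deg e = lat_deg f" for e f
    using that by (rule monomial_congruence_equal_degree[OF monomial_congruence_ideal[OF J]])
  then have drop0: "?Q (drop0 e) (drop0 f)" if "keys e \<subseteq> A" "keys f \<subseteq> A" "lat_deg e = lat_deg f" for e f
    using that by (simp add: drop0_monomial lat_deg_drop0)
  show "toric_ideal K A \<subseteq> ?J"
  proof (rule toric_ideal_subset_if_monomial_diffs[OF J])
    fix e f :: "'n exponent" assume ef: "keys e \<subseteq> A" "keys f \<subseteq> A" "lat_deg e = lat_deg f"
    have "?Q e (drop0 e)" "?Q (drop0 f) f"
      using monomial_diff_drop0_mem[OF J gens] ideal_monomial_diff_sym[OF J] ef by blast+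
    then show "?Q e f" using drop0[OF ef] ideal_monomial_diff_trans[OF J] by blast
  qed
qed

definition augmentation :: "'n exponent \<Rightarrow> 'k::field" where
  "augmentation g = of_bool (drop0 g = 0)"

definition derivation_like :: "('n exponent \<Rightarrow> 'k::field) \<Rightarrow> bool" where
  "derivation_like \<phi> \<longleftrightarrow> (\<forall>g e f. keys g \<subseteq> A \<longrightarrow> keys e \<subseteq> A \<longrightarrow> keys f \<subseteq> A \<longrightarrow> lat_deg e = lat_deg f \<longrightarrow>
    \<phi> (g + e) - augmentation g * \<phi> e = \<phi> (g + f) - augmentation g * \<phi> f)"

lemma derivation_like_mult:
  fixes K :: "'k::field itself"
  assumes \<phi>: "derivation_like \<phi>" and h: "h \<in> poly_ring K A" and p: "p \<in> toric_ideal K A"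
  shows "coeff_sum \<phi> (h * p) = coeff_sum augmentation h * coeff_sum \<phi> p"
proof -
  have "coeff_sum (\<lambda>e. \<phi> (g + e)) p = augmentation g * coeff_sum \<phi> p" if "g \<in> keys h" for g
  proof -
    have g: "keys g \<subseteq> A" using h that by (auto simp: poly_ring_def)
    have "coeff_sum (\<lambda>e. \<phi> (g + e) - augmentation g * \<phi> e) p = 0"
      using \<phi> g unfolding derivation_like_def by (intro toric_ideal_coeff_sum_eq_0[OF p]) blast
    moreover have "coeff_sum (\<lambda>e. \<phi> (g + e) - augmentation g * \<phi> e) p =
        coeff_sum (\<lambda>e. \<phi> (g + e)) p - augmentation g * coeff_sum \<phi> p"
      by (simp add: coeff_sum_def left_diff_distrib sum_subtractf sum_distrib_left mult.assoc)
    ultimately show ?thesis by simp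
  qed
  then have "coeff_sum \<phi> (h * p) = (\<Sum>g\<in>keys h. lookup h g * (augmentation g * coeff_sum \<phi> p))"
    unfolding coeff_sum_mult by (intro sum.cong refl) simp
  also have "\<dots> = coeff_sum augmentation h * coeff_sum \<phi> p"
    unfolding coeff_sum_def[of augmentation] sum_distrib_right by (intro sum.cong refl) (simp add: mult_ac)
  finally show ?thesis .
qed

lemma derivation_like_class:
  assumes "\<gamma> \<in> classes"
  shows "derivation_like (\<lambda>e. of_bool (drop0 e \<in> \<gamma>))"
  unfolding derivation_like_def
proof (intro allI impI)
  fix g e f :: "'n exponent"
  assume k: "keys g \<subseteq> A" "keys e \<subseteq> A" "keys f \<subseteq> A" "lat_deg e = lat_deg f"
  show "of_bool (drop0 (g + e) \<in> \<gamma>) - augmentation g * of_bool (drop0 e \<in> \<gamma>) =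
    of_bool (drop0 (g + f) \<in> \<gamma>) - augmentation g * of_bool (drop0 f \<in> \<gamma>)"
  proof (cases "drop0 g = 0")
    case True
    then show ?thesis by (simp add: drop0_add augmentation_def)
  next
    case False
    then have "keys (drop0 (g + e)) \<inter> keys (drop0 (g + f)) \<noteq> {}"
      by (auto simp: drop0_add keys_exponent_add simp flip: keys_eq_empty)
    moreover have "drop0 (g + e) \<in> monomials" "drop0 (g + f) \<in> monomials"
      using k by (auto intro!: drop0_monomial simp: keys_exponent_add)
    moreover have "lat_deg (drop0 (g + e)) = lat_deg (drop0 (g + f))"
      using k(4) by (simp add: lat_deg_drop0 lat_deg_add)
    ultimately have "shares (drop0 (g + e)) (drop0 (g + f))" by (simp add: shares_def)
    then have "drop0 (g + e) \<in> \<gamma> \<longleftrightarrow> drop0 (g + f) \<in> \<gamma>" using linked_mem_class_iff[OF assms] by blast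
    then show ?thesis using False by (simp add: augmentation_def)
  qed
qed

lemma derivation_like_zero: "derivation_like (\<lambda>e. of_bool (drop0 e = 0) * of_nat (lookup e 0))"
  unfolding derivation_like_def
proof (intro allI impI)
  fix g e f :: "'n exponent"
  assume k: "keys g \<subseteq> A" "keys e \<subseteq> A" "keys f \<subseteq> A" "lat_deg e = lat_deg f"
  have add: "drop0 (g + x) = 0 \<longleftrightarrow> drop0 g = 0 \<and> drop0 x = 0" for x
    by (simp add: drop0_add keys_exponent_add flip: keys_eq_empty)
  have "drop0 e = 0 \<longleftrightarrow> drop0 f = 0"
    using lat_deg_eq_0_iff[OF drop0_monomial[OF k(2)]] lat_deg_eq_0_iff[OF drop0_monomial[OF k(3)]] k(4)
    by (simp add: lat_deg_drop0)
  then show "of_bool (drop0 (g + e) = 0) * of_nat (lookup (g + e) 0) -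
      augmentation g * (of_bool (drop0 e = 0) * of_nat (lookup e 0)) =
    of_bool (drop0 (g + f) = 0) * of_nat (lookup (g + f) 0) -
      augmentation g * (of_bool (drop0 f = 0) * of_nat (lookup f 0))"
    by (simp add: add lookup_add augmentation_def)
qed

definition dual :: "'n exponent set option \<Rightarrow> 'n exponent \<Rightarrow> 'k::field" where
  "dual j e = (case j of Some \<gamma> \<Rightarrow> of_bool (drop0 e \<in> \<gamma>)
    | None \<Rightarrow> of_bool (drop0 e = 0) * of_nat (lookup e 0))"

lemma derivation_like_dual: "j \<in> generator_index \<Longrightarrow> derivation_like (dual j)"
  by (cases j rule: generator_index_cases)
     (simp_all add: dual_def[abs_def] derivation_like_zero derivation_like_class)

lemma dual_generator:
  assumes "j \<in> generator_index" "k \<in> generator_index"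
  shows "dual j (gen_lhs k) - dual j (gen_rhs k) = of_bool (j = k)"
  using assms(2)
proof (cases k rule: generator_index_cases)
  case zero
  then show ?thesis by (cases j) (simp_all add: dual_def gen_lhs_def gen_rhs_def)
next
  case (cls \<gamma>)
  then have id: "drop0 (lhs \<gamma>) = lhs \<gamma>" "drop0 (rhs \<gamma>) = rhs \<gamma>"
    by (simp_all add: drop0_id lhs_monomial rhs_monomial)
  show ?thesis using assms(1)
  proof (cases j rule: generator_index_cases)
    case zero
    then show ?thesis using cls lhs_rhs_nonzero by (simp add: dual_def gen_lhs_def gen_rhs_def id)
  next
    case (cls \<beta>)
    then show ?thesis using \<open>k = Some \<gamma>\<close> \<open>\<gamma> \<in> classes\<close>
      by (simp add: dual_def gen_lhs_def gen_rhs_def id lhs_mem_class_iff rhs_notin_class)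
  qed
qed

lemma card_generator_index_le:
  fixes K :: "'k::field itself"
  assumes G: "finite G" "generated_ideal_in (poly_ring K A) G = toric_ideal K A"
  shows "card generator_index \<le> card G"
proof (rule card_dual_functionals_le[OF G(1) finite_generator_index, where \<eta> = "coeff_sum augmentation"])
  fix j h g assume "j \<in> generator_index" "h \<in> poly_ring K A" "g \<in> G"
  moreover have "g \<in> toric_ideal K A" using generated_ideal_in_base[OF G(1) \<open>g \<in> G\<close>, of K A] G(2) by simp
  ultimately show "coeff_sum (dual j) (h * g) = coeff_sum augmentation h * coeff_sum (dual j) g"
    using derivation_like_mult[OF derivation_like_dual] by blast
next
  show "monomial_diff (gen_lhs j) (gen_rhs j) \<in> generated_ideal_in (poly_ring K A) G"
    if "j \<in> generator_index" for j
    unfolding G(2) using that by (rule generator_in_toric_ideal)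
qed (simp add: coeff_sum_monomial_diff dual_generator)

theorem complete_intersection_card_classes:
  fixes K :: "'k::field itself"
  assumes ci: "complete_intersection_ideal (poly_ring K A) (toric_ideal K A)"
  shows "card classes + vec.dim (rat_of_lat ` points) \<le> card points"
proof -
  let ?generates = "\<lambda>n. \<exists>G. finite G \<and> card G = n \<and> G \<subseteq> poly_ring K A \<and>
    generated_ideal_in (poly_ring K A) G = toric_ideal K A"
  let ?G = "(\<lambda>j. monomial_diff (gen_lhs j) (gen_rhs j) :: ('k, 'n) lpoly) ` generator_index"
  have "?G \<subseteq> poly_ring K A" using generator_in_toric_ideal by (auto simp: toric_ideal_def)
  then have "?generates (card ?G)" using toric_ideal_generated finite_generator_index by blast
  then have "?generates (min_num_gens (poly_ring K A) (toric_ideal K A))"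
    unfolding min_num_gens_def by (rule LeastI)
  then have "card generator_index \<le> min_num_gens (poly_ring K A) (toric_ideal K A)"
    using card_generator_index_le by metis
  also have "\<dots> \<le> card A - vec.dim (rat_of_lat ` A)"
    using ci height_toric_ideal_le[OF finite_A, of K] unfolding complete_intersection_ideal_def
    by (metis enat_ord_simps(1))
  finally have "card classes + of_bool (0 \<in> A) \<le> card A - vec.dim (rat_of_lat ` A)"
    by (simp add: card_generator_index)
  moreover have "card A = card points + of_bool (0 \<in> A)"
    using card_Suc_Diff1[OF finite_A, of 0] by (cases "0 \<in> A") auto
  moreover have "vec.dim (rat_of_lat ` points) = vec.dim (rat_of_lat ` A)"
    by (rule dim_rat_of_lat_points)
  moreover have "vec.dim (rat_of_lat ` points) \<le> card points"
    using vec.dim_le_card'[of "rat_of_lat ` points"] card_image_le[OF finite_points, of rat_of_lat]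
    finite_points by simp
  ultimately show ?thesis by linarith
qed

section \<open>Faces of a pointed configuration\<close>

definition is_face :: "(int ^ 'n) set \<Rightarrow> bool" where
  "is_face E \<longleftrightarrow> E \<subseteq> points \<and> (\<forall>\<gamma>\<in>classes. keys (lhs \<gamma>) \<subseteq> E \<longleftrightarrow> keys (rhs \<gamma>) \<subseteq> E)"

definition weight_on :: "(int ^ 'n) set \<Rightarrow> (int ^ 'n \<Rightarrow> rat) \<Rightarrow> 'n exponent \<Rightarrow> rat" where
  "weight_on E l e = (\<Sum>a\<in>E. l a * of_nat (lookup e a))"

lemma weight_on_add: "weight_on E l (e + f) = weight_on E l e + weight_on E l f"
  by (simp add: weight_on_def lookup_add distrib_left sum.distrib)

lemma weight_on_single: "finite E \<Longrightarrow> a \<in> E \<Longrightarrow> weight_on E l (single a N) = l a * of_nat N"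
  by (simp add: weight_on_def lookup_single when_def if_distrib cong: if_cong)

lemma weight_on_eq_0:
  assumes "keys e \<subseteq> B" "\<And>b. b \<in> B \<Longrightarrow> l b = 0" shows "weight_on E l e = 0"
proof -
  have "l a * of_nat (lookup e a) = 0" for a
  proof (cases "a \<in> keys e")
    case True
    then show ?thesis using assms by (simp add: subsetD)
  qed (simp add: in_keys_iff)
  then show ?thesis unfolding weight_on_def by (intro sum.neutral ballI)
qed

definition balanced :: "(int ^ 'n) set \<Rightarrow> (int ^ 'n \<Rightarrow> rat) \<Rightarrow> bool" where
  "balanced E l \<longleftrightarrow> (\<forall>\<gamma>\<in>classes. keys (lhs \<gamma>) \<subseteq> E \<longrightarrow> weight_on E l (lhs \<gamma>) = weight_on E l (rhs \<gamma>))"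

lemma face_equal_degree:
  assumes face: "is_face E" and l: "balanced E l"
    and ef: "e \<in> monomials" "f \<in> monomials" "lat_deg e = lat_deg f"
  shows "keys e \<subseteq> E \<longleftrightarrow> keys f \<subseteq> E" and "keys e \<subseteq> E \<Longrightarrow> weight_on E l e = weight_on E l f"
proof -
  let ?Q = "\<lambda>e f. (keys e \<subseteq> E \<longleftrightarrow> keys f \<subseteq> E) \<and> (keys e \<subseteq> E \<longrightarrow> weight_on E l e = weight_on E l f)"
  have "monomial_congruence ?Q"
    unfolding monomial_congruence_def
    by (auto intro!: reflp_onI symp_onI transp_onI simp: keys_exponent_add weight_on_add)
  moreover have "?Q (lhs \<gamma>) (rhs \<gamma>)" if "\<gamma> \<in> classes" for \<gamma>
    using that face l by (simp add: is_face_def balanced_def)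
  ultimately have "?Q e f" using ef by (rule monomial_congruence_equal_degree)
  then show "keys e \<subseteq> E \<longleftrightarrow> keys f \<subseteq> E" "keys e \<subseteq> E \<Longrightarrow> weight_on E l e = weight_on E l f" by blast+
qed

lemma face_relation:
  assumes face: "is_face E" and B: "B \<subseteq> E" and c: "c \<in> points" "rat_of_lat c \<in> vec.span (rat_of_lat ` B)"
  obtains N e f where "N > 0" "keys e \<subseteq> B" "keys f \<subseteq> B" "c \<in> E"
    "\<And>l. balanced E l \<Longrightarrow> weight_on E l (single c N + e) = weight_on E l f"
proof -
  have E: "E \<subseteq> points" using face by (simp add: is_face_def)
  then have "finite B" using B finite_points by (meson finite_subset)
  then obtain N e f where N: "N > 0" "keys e \<subseteq> B" "keys f \<subseteq> B" "lat_deg (single c N + e) = lat_deg f"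
    by (rule lattice_relation[OF _ c(2)])
  have monomials: "single c N + e \<in> monomials" "f \<in> monomials"
    using N(1-3) B E c(1) by (auto simp: monomials_def keys_exponent_add)
  have keys_f: "keys f \<subseteq> E" using N(3) B by blast
  have "balanced E (\<lambda>_. 0)" by (simp add: balanced_def weight_on_def)
  then have inside: "keys (single c N + e) \<subseteq> E"
    using face_equal_degree(1)[OF face _ monomials N(4)] keys_f by blast
  then have "c \<in> E" using N(1) by (simp add: keys_exponent_add)
  moreover have "weight_on E l (single c N + e) = weight_on E l f" if "balanced E l" for l
    using face_equal_degree(2)[OF face that monomials N(4) inside] .
  ultimately show thesis using that N(1-3) by blast
qed

lemma balanced_eq_0:
  assumes face: "is_face E" and B: "B \<subseteq> E" "rat_of_lat ` E \<subseteq> vec.span (rat_of_lat ` B)"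
    and l: "balanced E l" "\<And>b. b \<in> B \<Longrightarrow> l b = 0" and a: "a \<in> E"
  shows "l a = 0"
proof -
  have "a \<in> points" "finite E" using face a finite_points finite_subset by (auto simp: is_face_def)
  obtain N e f where N: "N > 0" "keys e \<subseteq> B" "keys f \<subseteq> B"
    "\<And>l. balanced E l \<Longrightarrow> weight_on E l (single a N + e) = weight_on E l f"
    by (rule face_relation[OF face B(1) \<open>a \<in> points\<close>]) (use B(2) a that in auto)
  have "weight_on E l e = 0" "weight_on E l f = 0" using weight_on_eq_0 N(2,3) l(2) by blast+
  then have "l a * of_nat N = 0"
    using N(4)[OF l(1)] weight_on_single[OF \<open>finite E\<close> a] by (simp add: weight_on_add)
  then show ?thesis using N(1) by simp
qed

lemma card_face_le:
  assumes face: "is_face E"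
  shows "card E \<le> vec.dim (rat_of_lat ` E) + card {\<gamma> \<in> classes. keys (lhs \<gamma>) \<subseteq> E}"
proof (rule ccontr)
  let ?C = "{\<gamma> \<in> classes. keys (lhs \<gamma>) \<subseteq> E}"
  assume small: "\<not> ?thesis"
  obtain B where B: "B \<subseteq> E" "finite B" "card B = vec.dim (rat_of_lat ` E)"
    "rat_of_lat ` E \<subseteq> vec.span (rat_of_lat ` B)"
    by (rule rational_lattice_basis[of E]) (rule that)
  have finE: "finite E" using face finite_points finite_subset by (auto simp: is_face_def)
  let ?T = "B <+> ?C"
  define m :: "int ^ 'n \<Rightarrow> (int ^ 'n) + 'n exponent set \<Rightarrow> rat" where
    "m a t = (case t of Inl b \<Rightarrow> of_bool (a = b)
      | Inr \<gamma> \<Rightarrow> of_nat (lookup (lhs \<gamma>) a) - of_nat (lookup (rhs \<gamma>) a))" for a t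
  have finT: "finite ?T" using B(2) finite_classes by simp
  have "card ?T < card E" using small B(2,3) finite_classes by (simp add: card_Plus)
  then obtain l where l: "\<exists>a\<in>E. l a \<noteq> 0" "\<And>t. t \<in> ?T \<Longrightarrow> (\<Sum>a\<in>E. l a * m a t) = 0"
    by (rule homogeneous_system_nontrivial[OF finT finE, where a = m]) (rule that)
  have "l b = 0" if "b \<in> B" for b
  proof -
    have "(\<Sum>a\<in>E. l a * m a (Inl b)) = l b" using that B(1) finE by (auto simp: m_def)
    then show ?thesis using l(2)[OF InlI[OF that]] by simp
  qed
  moreover have "balanced E l"
    unfolding balanced_def
  proof (intro ballI impI)
    fix \<gamma> assume "\<gamma> \<in> classes" "keys (lhs \<gamma>) \<subseteq> E"
    then have "(\<Sum>a\<in>E. l a * m a (Inr \<gamma>)) = 0" by (intro l(2) InrI) simp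
    then show "weight_on E l (lhs \<gamma>) = weight_on E l (rhs \<gamma>)"
      by (simp add: m_def weight_on_def right_diff_distrib sum_subtractf)
  qed
  ultimately have "l a = 0" if "a \<in> E" for a using balanced_eq_0[OF face B(1,4)] that by blast
  then show False using l(1) by blast
qed

lemma is_face_points: "is_face points"
  using lhs_monomial rhs_monomial by (auto simp: is_face_def monomials_def)

lemma face_eq_points:
  assumes face: "is_face E" and dim: "vec.dim (rat_of_lat ` points) \<le> vec.dim (rat_of_lat ` E)"
  shows "E = points"
proof
  show sub: "E \<subseteq> points" using face by (simp add: is_face_def)
  then have span: "vec.span (rat_of_lat ` E) = vec.span (rat_of_lat ` points)"
    using dim by (intro vec.dim_eq_span) auto
  show "points \<subseteq> E"
  proof
    fix c assume "c \<in> points"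
    moreover from this have "rat_of_lat c \<in> vec.span (rat_of_lat ` E)"
      unfolding span by (intro vec.span_base) auto
    ultimately show "c \<in> E" by (rule face_relation[OF face order_refl])
  qed
qed

lemma dominating_classes:
  assumes card: "card classes + vec.dim (rat_of_lat ` points) \<le> card points"
  shows "dominating points classes (\<lambda>\<gamma>. keys (lhs \<gamma>)) (\<lambda>\<gamma>. keys (rhs \<gamma>))"
proof
  have sides: "keys (lhs \<gamma>) \<subseteq> points \<and> keys (rhs \<gamma>) \<subseteq> points \<and> keys (lhs \<gamma>) \<noteq> {} \<and> keys (rhs \<gamma>) \<noteq> {}"
    if "\<gamma> \<in> classes" for \<gamma>
    using that lhs_monomial rhs_monomial lhs_rhs_nonzero by (auto simp: monomials_def)
  then show "keys (lhs \<gamma>) \<subseteq> points" "keys (rhs \<gamma>) \<subseteq> points" "keys (lhs \<gamma>) \<noteq> {}" "keys (rhs \<gamma>) \<noteq> {}"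
    if "\<gamma> \<in> classes" for \<gamma> using that by blast+
  let ?S = "straddling classes (\<lambda>\<gamma>. keys (lhs \<gamma>)) (\<lambda>\<gamma>. keys (rhs \<gamma>))"
  fix C assume C: "C \<subseteq> points" "C \<noteq> {}"
  show "card (?S C) < card C"
  proof (rule ccontr)
    assume "\<not> card (?S C) < card C"
    then have violation: "card C \<le> card (?S C)" by simp
    obtain D where D: "C \<subseteq> D" "D \<subseteq> points" "card D \<le> card (?S D)"
      and saturated: "\<And>\<gamma>. \<gamma> \<in> classes \<Longrightarrow> keys (lhs \<gamma>) \<inter> D = {} \<longleftrightarrow> keys (rhs \<gamma>) \<inter> D = {}"
      by (rule saturated_violation[OF finite_points finite_classes _ C(1) violation])
         (erule sides, rule that)
    define E where "E = points - D"
    have avoid: "keys (lhs \<gamma>) \<subseteq> E \<longleftrightarrow> keys (lhs \<gamma>) \<inter> D = {}" "keys (rhs \<gamma>) \<subseteq> E \<longleftrightarrow> keys (rhs \<gamma>) \<inter> D = {}"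
      if "\<gamma> \<in> classes" for \<gamma> using sides[OF that] by (auto simp: E_def)
    then have face: "is_face E" using saturated by (auto simp: is_face_def E_def)
    have "?S D = classes - {\<gamma> \<in> classes. keys (lhs \<gamma>) \<subseteq> E}"
      unfolding straddling_def using avoid(1) saturated by blast
    then have "card (?S D) + card {\<gamma> \<in> classes. keys (lhs \<gamma>) \<subseteq> E} = card classes"
      using finite_classes by (simp add: card_Diff_subset card_mono)
    moreover have "card E + card D = card points"
      using card_Diff_subset[OF finite_subset[OF D(2) finite_points] D(2)] card_mono[OF finite_points D(2)]
      by (simp add: E_def)
    ultimately have "vec.dim (rat_of_lat ` points) \<le> vec.dim (rat_of_lat ` E)"
      using card D(3) card_face_le[OF face] by linarith
    then have "E = points" by (rule face_eq_points[OF face])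
    then show False using C D(1,2) by (auto simp: E_def)
  qed
qed (use finite_points finite_classes in auto)

lemma strongly_convex_pos_cone_points: "strongly_convex (pos_cone (rat_of_lat ` points))"
proof -
  obtain w where "\<And>a. a \<in> points \<Longrightarrow> qdot w (rat_of_lat a) \<ge> 1" by (rule weight_exists) (rule that)
  then have "\<forall>v\<in>rat_of_lat ` points. v \<noteq> 0 \<longrightarrow> qdot w v > 0" by fastforce
  then show ?thesis using strongly_convex_pos_cone_iff[OF finite_imageI[OF finite_points]] by blast
qed

lemma lat_deg_in_pos_cone: "rat_of_lat (lat_deg e) \<in> pos_cone (rat_of_lat ` keys e)"
  by (subst rat_of_lat_lat_deg[of "keys e"]) (auto intro!: pos_cone_sum pos_cone_scale_base)

lemma relation_system_classes:
  assumes "card classes + vec.dim (rat_of_lat ` points) \<le> card points"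
  shows "relation_system (rat_of_lat ` points) classes (\<lambda>\<gamma>. rat_of_lat ` keys (lhs \<gamma>))
    (\<lambda>\<gamma>. rat_of_lat ` keys (rhs \<gamma>))"
proof -
  interpret dominating "rat_of_lat ` points" classes "\<lambda>\<gamma>. rat_of_lat ` keys (lhs \<gamma>)"
    "\<lambda>\<gamma>. rat_of_lat ` keys (rhs \<gamma>)"
    by (rule dominating_image[OF dominating_classes[OF assms] inj_on_rat_of_lat])
  show ?thesis
  proof
    show "0 \<notin> rat_of_lat ` points" by (simp add: rat_of_lat_points)
    show "strongly_convex (pos_cone (rat_of_lat ` points))" by (rule strongly_convex_pos_cone_points)
    fix \<gamma> assume \<gamma>: "\<gamma> \<in> classes"
    let ?a = "rat_of_lat (lat_deg (lhs \<gamma>))"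
    have "?a \<noteq> 0"
      using lhs_rhs_nonzero[OF \<gamma>] lat_deg_eq_0_iff[OF lhs_monomial[OF \<gamma>]]
        rat_of_lat_eq_iff[of "lat_deg (lhs \<gamma>)" 0] by (simp add: rat_of_lat_simps)
    then show "\<exists>a. a \<noteq> 0 \<and> a \<in> pos_cone (rat_of_lat ` keys (lhs \<gamma>)) \<inter> pos_cone (rat_of_lat ` keys (rhs \<gamma>))"
      using lat_deg_in_pos_cone[of "lhs \<gamma>"] lat_deg_in_pos_cone[of "rhs \<gamma>"] lat_deg_rhs[OF \<gamma>]
      by (intro exI[of _ ?a]) simp
  qed
qed

theorem complete_intersection_bipyramid_bounded:
  fixes K :: "'k::field itself"
  assumes "complete_intersection_ideal (poly_ring K A) (toric_ideal K A)"
    and "vec.dim (rat_of_lat ` A) \<ge> 2"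
  shows "bipyramid_bounded (pos_cone (rat_of_lat ` A))"
proof -
  note card = complete_intersection_card_classes[OF assms(1)]
  have "card points \<le> vec.dim (rat_of_lat ` points) + card {\<gamma> \<in> classes. keys (lhs \<gamma>) \<subseteq> points}"
    by (rule card_face_le[OF is_face_points])
  also have "card {\<gamma> \<in> classes. keys (lhs \<gamma>) \<subseteq> points} \<le> card classes"
    using finite_classes by (intro card_mono) auto
  finally have "vec.dim (rat_of_lat ` points) + card classes = card (rat_of_lat ` points)"
    using card card_image[OF inj_on_rat_of_lat, of points] by simp
  then have "bipyramid_bounded (pos_cone (rat_of_lat ` points))"
    using assms(2) by (intro relation_system_bipyramid_bounded[OF relation_system_classes[OF card]])
      (simp_all add: dim_rat_of_lat_points)
  then show ?thesis by (simp add: pos_cone_rat_of_lat_points)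
qed

end

theorem theorem3p5:
  fixes K :: "'k::field itself" and \<sigma> :: "(rat ^ 'n) set"
  assumes "ci_cone K \<sigma>" and "cone_dim \<sigma> > 1"
  shows "card (extreme_rays \<sigma>) \<le> 2 * cone_dim \<sigma> - 2
     \<and> (card (extreme_rays \<sigma>) = 2 * cone_dim \<sigma> - 2 \<longleftrightarrow> \<sigma> \<in> general_bipyramidal)"
proof -
  obtain A where A: "finite A" "nat_monoid A \<inter> uminus ` nat_monoid A = {0}" "\<sigma> = pos_cone (rat_of_lat ` A)"
    and ci: "complete_intersection_ideal (poly_ring K A) (toric_ideal K A)"
    using assms(1) unfolding ci_cone_def by blast
  interpret pointed_config A using A(1,2) by unfold_locales
  have "vec.dim (rat_of_lat ` A) \<ge> 2" using assms(2) by (simp add: A(3) cone_dim_pos_cone)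
  then have "bipyramid_bounded \<sigma>" unfolding A(3) by (rule complete_intersection_bipyramid_bounded[OF ci])
  then show ?thesis using general_bipyramidal_extreme_rays by (auto simp: bipyramid_bounded_def)
qed

end
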